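(* Let $1\le m\le n-1$ be integers and let $E\subset\mathbb{R}^n$ be a non-empty Borel set (assumed to be bounded in (ii) and (iii)). Then for all $V\in G(n,m)$, (i) $\dim_{\rm H}\pi_V E\le \dim_{\rm H}^m E = \min\{m,\dim_{\rm H}E\}$, (ii) $\underline{\dim}_{\rm B}\,\pi_V E\le \underline{\dim}_{\rm B}^m E$, (iii) $\overline{\dim}_{\rm B}\,\pi_V E\le \overline{\dim}_{\rm B}^m E$, (iv) $\dim_{\rm P}\pi_V E\le \dim_{\rm P}^m E$, and in each of (i)–(iv) equality holds for $\gamma_{n,m}$-almost all $V\in G(n,m)$.
   Context: $G(n,m)$ is the Grassmannian of $m$-dimensional linear subspaces of $\mathbb{R}^n$, $\gamma_{n,m}$ its rotation-invariant Borel probability measure, and $\pi_V:\mathbb{R}^n\to V$ orthogonal projection. $\dim_{\rm H}$ is Hausdorff dimension. Box dimensions: for non-empty bounded $E$, $N_r(E)$ is the minimum number of sets of diameter $r$ that can cover $E$; $\underline{\dim}_{\rm B}E=\liminf_{r\to0}\frac{\log N_r(E)}{-\log r}$ and $\overline{\dim}_{\rm B}E=\limsup_{r\to0}\frac{\log N_r(E)}{-\log r}$. Packing dimension: $\dim_{\rm P}E=\inf\{\sup_{i}\overline{\dim}_{\rm B}E_i: E\subset\bigcup_{i=1}^\infty E_i\}$, where the infimum is over countable covers by non-empty bounded (equivalently, compact) sets $E_i$. Dimension profiles: for $s>0$, $r>0$ let $\phi_r^s(x)=\min\{1,(r/|x|)^s\}$ for $x\in\mathbb{R}^n$ (equal to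 $1$ at $x=0$). For non-empty compact $E$ let $\mathcal{M}(E)$ be the set of Borel probability measures supported by $E$, and define the capacity $C_r^s(E)$ by $\frac1{C_r^s(E)}=\inf_{\mu\in\mathcal{M}(E)}\int\int\phi_r^s(x-y)\,d\mu(x)\,d\mu(y)$. For non-empty bounded $E$, $C_r^s(E)$ is defined as the capacity of the closure of $E$. Then $\underline{\dim}_{\rm B}^sE=\liminf_{r\to0}\frac{\log C_r^s(E)}{-\log r}$, $\overline{\dim}_{\rm B}^sE=\limsup_{r\to0}\frac{\log C_r^s(E)}{-\log r}$, and for arbitrary non-empty $E\subset\mathbb{R}^n$, $\dim_{\rm P}^sE=\inf\{\sup_i\overline{\dim}_{\rm B}^sE_i:E\subset\bigcup_{i=1}^\infty E_i,\ \text{each }E_i\text{ non-empty and compact}\}$. Also $\dim_{\rm H}^sE:=\min\{s,\dim_{\rm H}E\}$. *)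

theory Defs
  imports "HOL-Probability.Probability"
begin

section \<open>The Grassmannian and its invariant measure\<close>

definition grassmannian :: "nat \<Rightarrow> 'a::euclidean_space set set"
  where "grassmannian m = {V. subspace V \<and> dim V = m}"

definition orth_proj :: "'a::euclidean_space set \<Rightarrow> 'a \<Rightarrow> 'a"
  where "orth_proj V x = (THE v. v \<in> V \<and> x - v \<in> V\<^sup>\<bottom>)"

lemma orth_proj_unique:
  assumes "subspace V" "v \<in> V" "x - v \<in> V\<^sup>\<bottom>"
  shows "orth_proj V x = v"
  unfolding orth_proj_def
proof (rule the_equality)
  show "v \<in> V \<and> x - v \<in> V\<^sup>\<bottom>" using assms by simp
next
  fix w assume w: "w \<in> V \<and> x - w \<in> V\<^sup>\<bottom>"
  have "w - v \<in> V" using assms w by (simp add: subspace_diff)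
  moreover have "w - v \<in> V\<^sup>\<bottom>"
    using subspace_diff[OF subspace_orthogonal_comp assms(3), of "x - w"] w by simp
  ultimately show "w = v" by (auto simp: orthogonal_comp_def orthogonal_def)
qed

lemma orth_proj_decomp:
  assumes "subspace V"
  shows "orth_proj V x \<in> V" and "x - orth_proj V x \<in> V\<^sup>\<bottom>"
proof -
  obtain y z where yz: "y \<in> span V" "\<And>w. w \<in> span V \<Longrightarrow> orthogonal z w" "x = y + z"
    using orthogonal_subspace_decomp_exists[of V x] by blast
  moreover have "span V = V" using assms by (simp add: span_eq_iff)
  ultimately have "y \<in> V" "x - y \<in> V\<^sup>\<bottom>"
    by (auto simp: orthogonal_comp_def orthogonal_commute)
  then show "orth_proj V x \<in> V" "x - orth_proj V x \<in> V\<^sup>\<bottom>"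
    using orth_proj_unique[OF assms] by auto
qed

lemma bounded_linear_orth_proj:
  assumes "subspace V"
  shows "bounded_linear (orth_proj V)"
proof -
  note D = orth_proj_decomp[OF assms] and S = subspace_orthogonal_comp[of V]
  have "linear (orth_proj V)"
  proof
    fix x y
    have "x + y - (orth_proj V x + orth_proj V y) \<in> V\<^sup>\<bottom>"
      using subspace_add[OF S D(2)[of x] D(2)[of y]] by (simp add: algebra_simps)
    then show "orth_proj V (x + y) = orth_proj V x + orth_proj V y"
      using D(1) assms by (intro orth_proj_unique) (auto intro: subspace_add)
  next
    fix c x
    have "c *\<^sub>R x - c *\<^sub>R orth_proj V x \<in> V\<^sup>\<bottom>"
      using subspace_scale[OF S D(2)[of x], of c] by (simp add: algebra_simps)
    then show "orth_proj V (c *\<^sub>R x) = c *\<^sub>R orth_proj V x"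
      using D(1) assms by (intro orth_proj_unique) (auto intro: subspace_scale)
  qed
  then show ?thesis by (simp add: linear_conv_bounded_linear)
qed

text \<open>
  The Grassmannian carries the topology induced by the injection of \<open>V\<close> into the bounded operators
  sending \<open>V\<close> to its orthogonal projection, i.e. that of the operator norm metric on projections.
  The Borel sigma-algebra of an initial topology is the pullback of the Borel sigma-algebra.
\<close>
definition borel_grassmannian :: "nat \<Rightarrow> 'a::euclidean_space set measure"
  where "borel_grassmannian m =
    vimage_algebra (grassmannian m) (\<lambda>V. Blinfun (orth_proj V)) borel"

text \<open>
  The rotation-invariant Borel probability measure exists and is unique; it is rendered by the
  properties that characterise it.  Invariance is only demanded for matrices of determinant 1,
  which for a measure on subspaces entails invariance under the full orthogonal group.
\<close>
definition grassmann_measure :: "nat \<Rightarrow> (real ^ 'n) set measure \<Rightarrow> bool"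
  where "grassmann_measure m \<gamma> \<longleftrightarrow>
    prob_space \<gamma> \<and>
    sets \<gamma> = sets (borel_grassmannian m) \<and>
    (\<forall>Q :: real ^ 'n ^ 'n. rotation_matrix Q \<longrightarrow>
       (\<forall>A \<in> sets \<gamma>. emeasure \<gamma> ((\<lambda>V. (*v) Q ` V) ` A) = emeasure \<gamma> A))"


section \<open>Hausdorff dimension\<close>

text \<open>
  The term \<open>|U|\<^sup>s\<close> in Hausdorff sums.  Since \<open>0 powr 0 = 0\<close> in the library, the exponent 0 is
  treated separately, so that the 0-dimensional measure is counting measure; the empty set
  contributes nothing, so that sequences of covering sets include finite covers.
\<close>
definition diam_pow :: "real \<Rightarrow> 'a::metric_space set \<Rightarrow> ennreal"
  where "diam_pow s U =
    (if U = {} then 0 else if s = 0 then 1 else ennreal (diameter U powr s))"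

text \<open>\<^const>\<open>diameter\<close> is meaningful for bounded sets only, hence the boundedness conditions.\<close>
definition hausdorff_content :: "real \<Rightarrow> real \<Rightarrow> 'a::metric_space set \<Rightarrow> ennreal"
  where "hausdorff_content \<delta> s E =
    (INF U \<in> {U :: nat \<Rightarrow> 'a set. (\<forall>i. bounded (U i) \<and> diameter (U i) \<le> \<delta>) \<and> E \<subseteq> (\<Union>i. U i)}.
       \<Sum>i. diam_pow s (U i))"

definition hausdorff_measure :: "real \<Rightarrow> 'a::metric_space set \<Rightarrow> ennreal"
  where "hausdorff_measure s E = (SUP \<delta> \<in> {0<..}. hausdorff_content \<delta> s E)"

definition hausdorff_dim :: "'a::metric_space set \<Rightarrow> ereal"
  where "hausdorff_dim E = (INF s \<in> {s. 0 \<le> s \<and> hausdorff_measure s E = 0}. ereal s)"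


section \<open>Box and packing dimensions\<close>

definition covering_number :: "real \<Rightarrow> 'a::metric_space set \<Rightarrow> nat"
  where "covering_number r E =
    (LEAST k. \<exists>F. finite F \<and> card F = k \<and> (\<forall>U \<in> F. bounded U \<and> diameter U = r) \<and> E \<subseteq> \<Union>F)"

definition lower_box_dim :: "'a::metric_space set \<Rightarrow> ereal"
  where "lower_box_dim E =
    Liminf (at_right 0) (\<lambda>r. ereal (ln (real (covering_number r E)) / - ln r))"

definition upper_box_dim :: "'a::metric_space set \<Rightarrow> ereal"
  where "upper_box_dim E =
    Limsup (at_right 0) (\<lambda>r. ereal (ln (real (covering_number r E)) / - ln r))"

definition packing_dim :: "'a::metric_space set \<Rightarrow> ereal"
  where "packing_dim E =
    (INF F \<in> {F :: nat \<Rightarrow> 'a set. (\<forall>i. F i \<noteq> {} \<and> bounded (F i)) \<and> E \<subseteq> (\<Union>i. F i)}.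
       SUP i. upper_box_dim (F i))"


section \<open>Dimension profiles\<close>

definition kernel_phi :: "real \<Rightarrow> real \<Rightarrow> 'a::real_normed_vector \<Rightarrow> real"
  where "kernel_phi s r x = (if x = 0 then 1 else min 1 ((r / norm x) powr s))"

definition prob_measures_on :: "'a::topological_space set \<Rightarrow> 'a measure set"
  where "prob_measures_on K =
    {\<mu>. prob_space \<mu> \<and> sets \<mu> = sets borel \<and> emeasure \<mu> (- K) = 0}"

text \<open>Taking the closure does not change compact \<open>E\<close> and extends the definition to bounded \<open>E\<close>.\<close>
definition capacity :: "real \<Rightarrow> real \<Rightarrow> 'a::euclidean_space set \<Rightarrow> real"
  where "capacity s r E =
    1 / (INF \<mu> \<in> prob_measures_on (closure E). \<integral>x. \<integral>y. kernel_phi s r (x - y) \<partial>\<mu> \<partial>\<mu>)"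

definition lower_box_profile :: "real \<Rightarrow> 'a::euclidean_space set \<Rightarrow> ereal"
  where "lower_box_profile s E =
    Liminf (at_right 0) (\<lambda>r. ereal (ln (capacity s r E) / - ln r))"

definition upper_box_profile :: "real \<Rightarrow> 'a::euclidean_space set \<Rightarrow> ereal"
  where "upper_box_profile s E =
    Limsup (at_right 0) (\<lambda>r. ereal (ln (capacity s r E) / - ln r))"

definition packing_profile :: "real \<Rightarrow> 'a::euclidean_space set \<Rightarrow> ereal"
  where "packing_profile s E =
    (INF F \<in> {F :: nat \<Rightarrow> 'a set. (\<forall>i. F i \<noteq> {} \<and> compact (F i)) \<and> E \<subseteq> (\<Union>i. F i)}.
       SUP i. upper_box_profile s (F i))"

definition hausdorff_profile :: "real \<Rightarrow> 'a::euclidean_space set \<Rightarrow> ereal"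
  where "hausdorff_profile s E = min (ereal s) (hausdorff_dim E)"

end

theory Submission
  imports Defs "HOL-Real_Asymp.Real_Asymp"
begin

text \<open>
  The basic estimate is \<open>\<gamma> {V. |\<pi>\<^sub>V x| \<le> \<rho>} \<le> C \<phi> x\<close> with the kernel \<open>\<phi> x = min 1 ((\<rho> / |x|) ^ m)\<close>:
  integrated against a measure of small energy, it shows that for almost all \<open>V\<close> few pairs of points
  have projections at distance at most \<open>\<rho>\<close>, and the Cauchy--Schwarz inequality turns this into a lower
  bound for covers of the projected set. Summing over the scales \<open>\<rho> = 2\<^sup>-\<^sup>k\<close> with weights \<open>k\<^sup>-\<^sup>2\<close> gives the
  box dimensions. The packing dimension is reduced to the upper box dimension by the Baire category
  theorem, applied to a closed set in \<open>\<real>\<^sup>n \<times> \<real>\<^sup>\<nat>\<close> of which \<open>E\<close> is the projection.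

  For the Hausdorff dimension, dyadic content is continuous along increasing sequences of arbitrary
  sets, so the same closed set yields decreasing sets of content bounded below which shrink to a
  compact subset of \<open>E\<close>. These carry finitely supported weights with a Frostman bound on dyadic cells,
  whose energies are bounded uniformly; Fatou's lemma then bounds the energies of their projections.
\<close>

section \<open>Orthogonal projections and separated sets\<close>

text \<open>A null set of \<open>V\<close> has to be fixed before a cover of the projection is seen,
  although there are uncountably many covers. For the box dimensions only the scales
  \<open>(1 / 2) ^ Suc k\<close> are tested, each with its own near-optimal measure; the price is a
  factor quadratic in the number of the scale, that is, in log (1 / r), which vanishes in the
  exponents. For the packing dimension all covers are reduced to countably many basic open sets. For
  the Hausdorff dimension a cover enters only after \<open>V\<close> is fixed: compactness leaves
  finitely many of its members, and a finite lower limit of the energies supplies a level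
  \<open>k\<close> beyond all that they involve.

  Each almost-sure statement rests on a measurable function of \<open>V\<close> with finite
  integral, not on measurability of a dimension. The bounds on \<open>m\<close> enter through n
  \<ge> 2: from there on rotations act transitively on spheres, so that the measure of a slab
  depends on |x| alone.\<close>

definition separated :: "real \<Rightarrow> 'a::metric_space set \<Rightarrow> bool"
  where "separated r P \<longleftrightarrow> (\<forall>p\<in>P. \<forall>q\<in>P. p \<noteq> q \<longrightarrow> r \<le> dist p q)"

text \<open>Coordinates in an orthonormal basis of \<open>V\<close> are rounded to a mesh; points
  with equal roundings are too close to be separated, so \<open>P\<close> injects into a box of
  integer vectors. The exponent is the dimension of \<open>V\<close>, not that of the ambient space,
  which lets the bound serve \<open>V\<close>, its complement and the whole space.\<close>

lemma card_separated_subspace: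
  fixes V :: "'a::euclidean_space set"
  assumes V: "subspace V" "dim V = m" and r: "0 < r" "r \<le> R"
    and P: "P \<subseteq> V" "P \<subseteq> cball x R" "separated r P"
  shows "finite P" and "real (card P) \<le> (2 * real m + 4) ^ m * (R / r) ^ m"
proof -
  obtain B where B: "B \<subseteq> V" "pairwise orthogonal B" "\<And>b. b \<in> B \<Longrightarrow> norm b = 1"
    "independent B" "card B = m" "span B = V"
    using orthonormal_basis_subspace[OF V(1)] V(2) by metis
  have finB: "finite B" using B(4) by (simp add: independent_imp_finite)
  define T where "T = R * (real m + 1) / r"
  \<comment> \<open>The mesh r / (m + 1) makes at most \<open>m\<close> coordinate differences add
    up to strictly less than \<open>r\<close>, and it stays meaningful for m = 0.\<close>
  define g where "g p b = \<lfloor>((p - x) \<bullet> b) * (real m + 1) / r\<rfloor>" for p b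
  define h where "h p = restrict (g p) B" for p
  have inj: "inj_on h P"
  proof (rule inj_onI, rule ccontr)
    fix p q assume pq: "p \<in> P" "q \<in> P" "h p = h q" "p \<noteq> q"
    have pqV: "p - q \<in> span B" using P pq B(6) V(1) by (auto intro: subspace_diff)
    have "\<bar>(p - q) \<bullet> b\<bar> \<le> r / (real m + 1)" if b: "b \<in> B" for b
    proof -
      have "g p b = g q b" using pq(3) b unfolding h_def by (metis restrict_apply')
      then have "\<bar>((p - x) \<bullet> b) * (real m + 1) / r - ((q - x) \<bullet> b) * (real m + 1) / r\<bar> < 1"
        unfolding g_def by linarith
      moreover have "((p - x) \<bullet> b) * (real m + 1) / r - ((q - x) \<bullet> b) * (real m + 1) / r
          = ((p - q) \<bullet> b) * ((real m + 1) / r)"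
        by (simp add: algebra_simps inner_diff_left diff_divide_distrib add_divide_distrib)
      ultimately have "\<bar>(p - q) \<bullet> b\<bar> * ((real m + 1) / r) < 1"
        using r by (simp add: abs_mult)
      then show ?thesis using r by (simp add: field_simps)
    qed note 1 = this
    have "norm (p - q) = norm (\<Sum>b\<in>B. ((p - q) \<bullet> b) *\<^sub>R b)"
      using orthonormal_basis_expand[OF B(2,3) pqV finB] by simp
    also have "\<dots> \<le> (\<Sum>b\<in>B. norm (((p - q) \<bullet> b) *\<^sub>R b))" by (rule norm_sum)
    also have "\<dots> \<le> (\<Sum>b\<in>B. r / (real m + 1))" by (rule sum_mono) (use B(3) 1 in simp)
    also have "\<dots> = real m * r / (real m + 1)" using B(5) by simp
    also have "\<dots> < r" using r by (simp add: field_simps)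
    finally have "dist p q < r" by (simp add: dist_norm)
    moreover have "r \<le> dist p q" using P(3) pq unfolding separated_def by blast
    ultimately show False by simp
  qed
  have img: "h ` P \<subseteq> PiE B (\<lambda>_. {\<lfloor>- T\<rfloor>..\<lfloor>T\<rfloor>})"
  proof (clarsimp simp: h_def)
    fix p b assume p: "p \<in> P" "b \<in> B"
    have "\<bar>(p - x) \<bullet> b\<bar> \<le> norm (p - x) * norm b" by (rule Cauchy_Schwarz_ineq2)
    also have "\<dots> \<le> R" using p P(2) B(3) by (auto simp: dist_norm norm_minus_commute)
    finally have "\<bar>(p - x) \<bullet> b\<bar> * ((real m + 1) / r) \<le> R * ((real m + 1) / r)"
      using r by (intro mult_right_mono) auto
    then have "\<bar>((p - x) \<bullet> b) * (real m + 1) / r\<bar> \<le> T"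
      using r by (simp add: T_def abs_mult)
    then have "- T \<le> ((p - x) \<bullet> b) * (real m + 1) / r" "((p - x) \<bullet> b) * (real m + 1) / r \<le> T"
      by linarith+
    then show "\<lfloor>- T\<rfloor> \<le> g p b \<and> g p b \<le> \<lfloor>T\<rfloor>"
      unfolding g_def by (blast intro: floor_mono)
  qed
  have fin: "finite (PiE B (\<lambda>_. {\<lfloor>- T\<rfloor>..\<lfloor>T\<rfloor>}))" by (simp add: finite_PiE finB)
  have "finite (h ` P)" using img fin by (rule finite_subset)
  then show "finite P" using inj by (rule finite_imageD)
  have "card P = card (h ` P)" using inj by (simp add: card_image)
  also have "\<dots> \<le> card (PiE B (\<lambda>_. {\<lfloor>- T\<rfloor>..\<lfloor>T\<rfloor>}))" by (rule card_mono[OF fin img])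
  also have "\<dots> = nat (\<lfloor>T\<rfloor> - \<lfloor>- T\<rfloor> + 1) ^ m" using finB B(5) by (simp add: card_PiE)
  finally have "real (card P) \<le> real (nat (\<lfloor>T\<rfloor> - \<lfloor>- T\<rfloor> + 1) ^ m)" by simp
  also have "\<dots> = real (nat (\<lfloor>T\<rfloor> - \<lfloor>- T\<rfloor> + 1)) ^ m" by simp
  \<comment> \<open>At most 2 \<open>T\<close> + 2 integers fit in the range;
    \<open>r \<le> R\<close> turns the summand 2 into a multiple of R / r.\<close>
  also have "\<dots> \<le> ((2 * real m + 4) * (R / r)) ^ m"
  proof (rule power_mono)
    have "T \<ge> 0" using r by (simp add: T_def)
    then have "real (nat (\<lfloor>T\<rfloor> - \<lfloor>- T\<rfloor> + 1)) \<le> 2 * T + 2" by linarith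
    also have "\<dots> = (2 * real m + 2) * (R / r) + 2" by (simp add: T_def)
    also have "\<dots> \<le> (2 * real m + 2) * (R / r) + 2 * (R / r)" using r by (simp add: field_simps)
    finally show "real (nat (\<lfloor>T\<rfloor> - \<lfloor>- T\<rfloor> + 1)) \<le> (2 * real m + 4) * (R / r)"
      by (simp add: algebra_simps)
  qed simp
  finally show "real (card P) \<le> (2 * real m + 4) ^ m * (R / r) ^ m"
    by (simp only: power_mult_distrib)
qed

text \<open>The bound on cardinalities yields a separated set of greatest size; a point at distance
  at least \<open>r\<close> from all of it could be added.\<close>

lemma maximal_separated:
  fixes S :: "'a::metric_space set"
  assumes bd: "\<And>P. P \<subseteq> S \<Longrightarrow> separated r P \<Longrightarrow> finite P \<and> real (card P) \<le> N" and r: "0 < r"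
  obtains P where "P \<subseteq> S" "finite P" "separated r P" "\<And>x. x \<in> S \<Longrightarrow> \<exists>p\<in>P. dist x p < r"
proof -
  let ?Q = "\<lambda>P. P \<subseteq> S \<and> separated r P"
  have "?Q {}" by (simp add: separated_def)
  moreover have "card P < Suc (nat \<lceil>N\<rceil>)" if "?Q P" for P
    using bd[of P] that by (simp add: le_imp_less_Suc) linarith
  ultimately obtain P where P: "?Q P" and max: "\<And>P'. ?Q P' \<Longrightarrow> card P' \<le> card P"
    using ex_has_greatest_nat[of ?Q "{}" card "Suc (nat \<lceil>N\<rceil>)"] by blast
  have fin: "finite P" using bd P by blast
  have "\<exists>p\<in>P. dist x p < r" if x: "x \<in> S" for x
  proof (rule ccontr)
    assume "\<not> (\<exists>p\<in>P. dist x p < r)"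
    then have far: "\<And>p. p \<in> P \<Longrightarrow> r \<le> dist x p" by (auto simp: not_less)
    then have "x \<notin> P" using r by force
    moreover have "separated r (insert x P)"
      using P far unfolding separated_def by (auto simp: dist_commute)
    then have "card (insert x P) \<le> card P" using P x by (intro max) simp
    ultimately show False using fin by simp
  qed
  then show thesis using that P fin by blast
qed

lemma maximal_separated_subspace:
  fixes V :: "'a::euclidean_space set"
  assumes V: "subspace V" "dim V = m" and r: "0 < r" "r \<le> R" and S: "S \<subseteq> V" "S \<subseteq> cball x R"
  obtains P where "P \<subseteq> S" "finite P" "separated r P" "\<And>x. x \<in> S \<Longrightarrow> \<exists>p\<in>P. dist x p < r"
    "real (card P) \<le> (2 * real m + 4) ^ m * (R / r) ^ m"
proof -
  have *: "finite P \<and> real (card P) \<le> (2 * real m + 4) ^ m * (R / r) ^ m"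
    if "P \<subseteq> S" "separated r P" for P
    using card_separated_subspace[OF V r _ _ that(2)] that(1) S by (metis subset_trans)
  show thesis
    using maximal_separated[OF * r(1)] that * by metis
qed

section \<open>Contraction by orthogonal projections\<close>

lemma orth_proj_Pythagoras:
  assumes "subspace V"
  shows "(norm x)\<^sup>2 = (norm (orth_proj V x))\<^sup>2 + (norm (x - orth_proj V x))\<^sup>2"
proof -
  have "orthogonal (orth_proj V x) (x - orth_proj V x)"
    using orth_proj_decomp[OF assms, of x] by (auto simp: orthogonal_comp_def)
  from norm_add_Pythagorean[OF this] show ?thesis by simp
qed

lemma norm_orth_proj_le:
  assumes "subspace V"
  shows "norm (orth_proj V x) \<le> norm x" and "norm (x - orth_proj V x) \<le> norm x"
  by (rule power2_le_imp_le, simp_all add: orth_proj_Pythagoras[OF assms, of x])+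

lemma orth_proj_diff:
  "subspace V \<Longrightarrow> orth_proj V (x - y) = orth_proj V x - orth_proj V y"
  by (rule linear_diff[OF bounded_linear.linear[OF bounded_linear_orth_proj]])

lemma dist_orth_proj: "subspace V \<Longrightarrow> dist (orth_proj V x) (orth_proj V y) = norm (orth_proj V (x - y))"
  by (simp add: orth_proj_diff dist_norm)

lemma dist_orth_proj_le: "subspace V \<Longrightarrow> dist (orth_proj V x) (orth_proj V y) \<le> dist x y"
  by (simp add: dist_orth_proj norm_orth_proj_le(1) dist_norm[of x y])

lemma continuous_orth_proj: "subspace V \<Longrightarrow> continuous_on S (orth_proj V)"
  by (simp add: bounded_linear.continuous_on[OF bounded_linear_orth_proj])

lemma dim_orthogonal_comp:
  fixes V :: "'a::euclidean_space set"
  assumes "subspace V"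
  shows "dim (V\<^sup>\<bottom>) + dim V = DIM('a)"
  using dim_subspace_orthogonal_to_vectors[OF assms subspace_UNIV] by (simp add: orthogonal_comp_def)

text \<open>Inside the unit ball the slab lies close to the \<open>k\<close>-dimensional unit ball
  of the orthogonal complement. A \<rho>-net there has of order \<rho>^-k points, and the balls of
  radius 2 \<rho> about them have volume of order \<rho>^(k + m), which leaves \<rho>^m.\<close>

lemma measure_slab_le:
  fixes V :: "'a::euclidean_space set"
  assumes V: "subspace V" "dim V = m" and rho: "0 < \<rho>" "\<rho> \<le> 1"
  defines "k \<equiv> DIM('a) - m"
  shows "emeasure lborel {x \<in> ball 0 1. norm (orth_proj V x) \<le> \<rho>}
    \<le> ennreal ((2 * real k + 4) ^ k * unit_ball_vol (DIM('a)) * 2 ^ DIM('a) * \<rho> ^ m)"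
proof -
  have m: "m \<le> DIM('a)" using dim_subset_UNIV[of V] V(2) by simp
  have dimW: "dim (V\<^sup>\<bottom>) = k" using dim_orthogonal_comp[OF V(1)] V(2) by (simp add: k_def)
  obtain P where P: "P \<subseteq> V\<^sup>\<bottom> \<inter> cball 0 1" "finite P" 
     "\<And>x. x \<in> V\<^sup>\<bottom> \<inter> cball 0 1 \<Longrightarrow> \<exists>p\<in>P. dist x p < \<rho>"
    "real (card P) \<le> (2 * real k + 4) ^ k * (1 / \<rho>) ^ k"
    using maximal_separated_subspace[OF subspace_orthogonal_comp dimW rho Int_lower1 Int_lower2] by metis
  have "{x \<in> ball 0 1. norm (orth_proj V x) \<le> \<rho>} \<subseteq> (\<Union>p\<in>P. cball p (2 * \<rho>))"
  proof clarsimp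
    fix x :: 'a assume x: "norm x < 1" "norm (orth_proj V x) \<le> \<rho>"
    have "x - orth_proj V x \<in> V\<^sup>\<bottom> \<inter> cball 0 1"
    proof
      show "x - orth_proj V x \<in> V\<^sup>\<bottom>" by (rule orth_proj_decomp(2)[OF V(1)])
      have "norm (x - orth_proj V x) \<le> 1"
        using norm_orth_proj_le(2)[OF V(1), of x] x(1) by linarith
      then show "x - orth_proj V x \<in> cball 0 1" unfolding mem_cball_0 .
    qed
    then obtain p where p: "p \<in> P" "dist (x - orth_proj V x) p < \<rho>" using P(3) by blast
    have "dist p x \<le> dist (x - orth_proj V x) p + norm (orth_proj V x)"
      using dist_triangle[of p x "x - orth_proj V x"] by (simp add: dist_norm norm_minus_commute)
    then show "\<exists>p\<in>P. dist p x \<le> 2 * \<rho>" using p x by force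
  qed
  then have "emeasure lborel {x \<in> ball 0 1. norm (orth_proj V x) \<le> \<rho>}
      \<le> emeasure lborel (\<Union>p\<in>P. cball p (2 * \<rho>))"
    by (rule emeasure_mono) (auto intro!: borel_closed closed_UN P)
  also have "\<dots> \<le> (\<Sum>p\<in>P. emeasure lborel (cball p (2 * \<rho>)))"
    by (rule emeasure_subadditive_finite) (auto simp: P)
  also have "\<dots> = ennreal (real (card P) * (unit_ball_vol (DIM('a)) * (2 * \<rho>) ^ DIM('a)))"
    using rho by (simp add: emeasure_cball ennreal_of_nat_eq_real_of_nat ennreal_mult[symmetric])
  also have "\<dots> \<le> ennreal ((2 * real k + 4) ^ k * (1 / \<rho>) ^ k * (unit_ball_vol (DIM('a)) * (2 * \<rho>) ^ DIM('a)))"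
    using rho by (intro ennreal_leI mult_right_mono P(4)) auto
  also have "(2 * real k + 4) ^ k * (1 / \<rho>) ^ k * (unit_ball_vol (DIM('a)) * (2 * \<rho>) ^ DIM('a))
     = (2 * real k + 4) ^ k * unit_ball_vol (DIM('a)) * 2 ^ DIM('a) * \<rho> ^ m"
  proof -
    have "DIM('a) = k + m" using m by (simp add: k_def)
    then have "\<rho> ^ DIM('a) = \<rho> ^ k * \<rho> ^ m" by (simp add: power_add)
    then show ?thesis using rho by (simp add: power_mult_distrib power_divide)
  qed
  finally show ?thesis .
qed


section \<open>The invariant measure of slabs\<close>

lemma space_grassmann_measure:
  assumes "grassmann_measure m \<gamma>"
  shows "space \<gamma> = grassmannian m"
proof -
  have "space \<gamma> = space (borel_grassmannian m)"
    using assms by (intro sets_eq_imp_space_eq) (simp add: grassmann_measure_def)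
  then show ?thesis by (simp add: borel_grassmannian_def)
qed

text \<open>The sigma-algebra is pulled back from the bounded operators, on which evaluation at
  \<open>x\<close> is continuous.\<close>

lemma measurable_orth_proj [measurable]:
  assumes "grassmann_measure m \<gamma>"
  shows "(\<lambda>V. orth_proj V x) \<in> borel_measurable \<gamma>"
proof -
  have 1: "(\<lambda>V. Blinfun (orth_proj V)) \<in> measurable \<gamma> borel"
    using assms measurable_vimage_algebra1[of "\<lambda>V. Blinfun (orth_proj V)" "grassmannian m" borel]
    by (simp add: grassmann_measure_def borel_grassmannian_def cong: measurable_cong_sets)
  have "(\<lambda>f. blinfun_apply f x) \<in> borel_measurable borel"
    by (intro borel_measurable_continuous_onI continuous_intros)
  from measurable_compose[OF 1 this]
  have "(\<lambda>V. blinfun_apply (Blinfun (orth_proj V)) x) \<in> borel_measurable \<gamma>" .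
  moreover have "blinfun_apply (Blinfun (orth_proj V)) x = orth_proj V x" if "V \<in> space \<gamma>" for V
    using that by (subst bounded_linear_Blinfun_apply)
      (auto simp: space_grassmann_measure[OF assms] grassmannian_def intro: bounded_linear_orth_proj)
  ultimately show ?thesis by (simp cong: measurable_cong)
qed

text \<open>Fubini's theorem asks for joint measurability; expanding \<open>x\<close> in the basis
  reduces it to the finitely many maps \<open>orth_proj V b\<close> of \<open>V\<close>
  alone.\<close>

lemma measurable_orth_proj_pair:
  assumes "grassmann_measure m \<gamma>"
  shows "(\<lambda>(V, x). orth_proj V x) \<in> borel_measurable (\<gamma> \<Otimes>\<^sub>M borel)"
proof -
  note measurable_orth_proj[OF assms, measurable]
  have "(\<lambda>(V, x). \<Sum>b\<in>Basis. (x \<bullet> b) *\<^sub>R orth_proj V b) \<in> borel_measurable (\<gamma> \<Otimes>\<^sub>M borel)"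
    by measurable
  moreover have "(\<Sum>b\<in>Basis. (x \<bullet> b) *\<^sub>R orth_proj V b) = orth_proj V x" if "V \<in> space \<gamma>" for V x
  proof -
    have "linear (orth_proj V)"
      using that space_grassmann_measure[OF assms] bounded_linear_orth_proj[of V]
      by (auto simp: grassmannian_def intro: bounded_linear.linear)
    then have "(\<Sum>b\<in>Basis. (x \<bullet> b) *\<^sub>R orth_proj V b) = orth_proj V (\<Sum>b\<in>Basis. (x \<bullet> b) *\<^sub>R b)"
      by (simp add: linear_sum linear_cmul)
    then show ?thesis by (simp add: euclidean_representation)
  qed
  ultimately show ?thesis
    by (subst measurable_cong[where g = "\<lambda>(V, x). \<Sum>b\<in>Basis. (x \<bullet> b) *\<^sub>R orth_proj V b"])
      (auto simp: space_pair_measure)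
qed

lemma orth_proj_orthogonal_image:
  assumes f: "orthogonal_transformation f" and V: "subspace V"
  shows "orth_proj (f ` V) (f x) = f (orth_proj V x)"
proof (rule orth_proj_unique)
  have lin: "linear f" using f by (rule orthogonal_transformation_linear)
  show "subspace (f ` V)" using lin V by (rule linear_subspace_image)
  show "f (orth_proj V x) \<in> f ` V" using orth_proj_decomp(1)[OF V] by blast
  have "f x - f (orth_proj V x) = f (x - orth_proj V x)" by (simp add: linear_diff[OF lin])
  then show "f x - f (orth_proj V x) \<in> (f ` V)\<^sup>\<bottom>"
    using orth_proj_decomp(2)[OF V, of x] f
    by (auto simp: orthogonal_comp_def orthogonal_def orthogonal_transformation_def)
qed

lemma orthogonal_image_grassmannian:
  assumes f: "orthogonal_transformation f" and V: "V \<in> grassmannian m"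
  shows "f ` V \<in> grassmannian m"
proof -
  have lin: "linear f" using f by (rule orthogonal_transformation_linear)
  have "inj f" using f by (rule orthogonal_transformation_inj)
  then have "dim (f ` V) = dim V" by (rule dim_image_eq[OF lin inj_on_subset[OF _ subset_UNIV]])
  then show ?thesis using V linear_subspace_image[OF lin] by (simp add: grassmannian_def)
qed

text \<open>A rotation \<open>f\<close> with \<open>f a = b\<close> carries the slab condition for
  \<open>a\<close> to that for \<open>b\<close>, because projecting commutes with moving
  \<open>V\<close> by \<open>f\<close>. In dimension 1 no rotation takes a nonzero vector to its
  negative, whence the bound on the dimension.\<close>

lemma grassmann_slab_rotate:
  fixes a b :: "real ^ 'n"
  assumes \<gamma>: "grassmann_measure m \<gamma>" and n: "2 \<le> CARD('n)" and ab: "norm a = norm b"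
  shows "emeasure \<gamma> {V \<in> space \<gamma>. norm (orth_proj V a) \<le> \<rho>}
    = emeasure \<gamma> {V \<in> space \<gamma>. norm (orth_proj V b) \<le> \<rho>}"
proof -
  note measurable_orth_proj[OF \<gamma>, measurable]
  obtain f where f: "orthogonal_transformation f" "det (matrix f) = 1" "f a = b"
    using rotation_exists[OF n ab] .
  have f': "orthogonal_transformation (inv f)" using orthogonal_transformation_inv[OF f(1)] .
  have surj: "f (inv f y) = y" for y
    using orthogonal_transformation_surj[OF f(1)] by (rule surj_f_inv_f)
  let ?A = "{V \<in> space \<gamma>. norm (orth_proj V a) \<le> \<rho>}"
  let ?B = "{V \<in> space \<gamma>. norm (orth_proj V b) \<le> \<rho>}"
  have mat: "(*v) (matrix f) = f"
    using orthogonal_transformation_linear[OF f(1)] by (rule matrix_vector_mul)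
  have norm: "norm (orth_proj (f ` V) b) = norm (orth_proj V a)" if "V \<in> grassmannian m" for V
    using orth_proj_orthogonal_image[OF f(1), of V a] that f(3) orthogonal_transformation_norm[OF f(1)]
    by (simp add: grassmannian_def)
  have eqAB: "(\<lambda>V. (*v) (matrix f) ` V) ` ?A = ?B"
  proof (intro equalityI subsetI)
    fix W assume "W \<in> (\<lambda>V. (*v) (matrix f) ` V) ` ?A"
    then obtain V where "V \<in> ?A" "W = f ` V" unfolding mat by blast
    then show "W \<in> ?B"
      using orthogonal_image_grassmannian[OF f(1), of V m] norm[of V] by (simp add: space_grassmann_measure[OF \<gamma>])
  next
    fix W assume W: "W \<in> ?B"
    have eq: "f ` (inv f ` W) = W" by (simp add: image_image surj)
    have G: "inv f ` W \<in> grassmannian m"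
      using orthogonal_image_grassmannian[OF f', of W m] W by (simp add: space_grassmann_measure[OF \<gamma>])
    then have "inv f ` W \<in> ?A"
      using norm[OF G] W unfolding eq by (simp add: space_grassmann_measure[OF \<gamma>])
    then show "W \<in> (\<lambda>V. (*v) (matrix f) ` V) ` ?A"
      unfolding mat using eq by blast
  qed
  have "?A \<in> sets \<gamma>" by measurable
  moreover have "rotation_matrix (matrix f)"
    using f orthogonal_transformation_matrix unfolding rotation_matrix_def by blast
  ultimately have "emeasure \<gamma> ((\<lambda>V. (*v) (matrix f) ` V) ` ?A) = emeasure \<gamma> ?A"
    using \<gamma> unfolding grassmann_measure_def by blast
  then show ?thesis using eqAB by simp
qed

lemma orth_proj_scaleR: "subspace V \<Longrightarrow> orth_proj V (c *\<^sub>R x) = c *\<^sub>R orth_proj V x"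
  by (rule linear_cmul[OF bounded_linear.linear[OF bounded_linear_orth_proj]])

lemma orth_proj_0: "subspace V \<Longrightarrow> orth_proj V 0 = 0"
  by (rule linear_0[OF bounded_linear.linear[OF bounded_linear_orth_proj]])

text \<open>
  By invariance the measure is the same for all unit vectors, so it can be averaged over the unit
  ball and computed by Fubini's theorem as the mean volume of slabs.
\<close>
lemma grassmann_slab_unit:
  fixes \<gamma> :: "(real ^ 'n) set measure"
  assumes \<gamma>: "grassmann_measure m \<gamma>" and n: "2 \<le> CARD('n)"
  obtains C where "1 \<le> C"
    "\<And>x \<rho>. norm x = 1 \<Longrightarrow> 0 < \<rho> \<Longrightarrow> \<rho> \<le> 1 \<Longrightarrow>
      emeasure \<gamma> {V \<in> space \<gamma>. norm (orth_proj V x) \<le> \<rho>} \<le> ennreal (C * \<rho> ^ m)"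
proof -
  interpret prob_space \<gamma> using \<gamma> by (simp add: grassmann_measure_def)
  interpret pair_sigma_finite \<gamma> "lborel :: (real ^ 'n) measure" ..
  note measurable_orth_proj_pair[OF \<gamma>, measurable] measurable_orth_proj[OF \<gamma>, measurable]
  define k where "k = DIM(real ^ 'n) - m"
  define K where "K = (2 * real k + 4) ^ k * unit_ball_vol (DIM(real ^ 'n)) * 2 ^ DIM(real ^ 'n)"
  define w where "w = unit_ball_vol (real (DIM(real ^ 'n)))"
  have w: "w > 0" by (simp add: w_def)
  have K: "K \<ge> 0" by (simp add: K_def)
  have main: "emeasure \<gamma> {V \<in> space \<gamma>. norm (orth_proj V e) \<le> \<rho>} \<le> ennreal (K / w * \<rho> ^ m)"
    if e: "norm e = 1" and rho: "0 < \<rho>" "\<rho> \<le> 1" for e :: "real ^ 'n" and \<rho>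
  proof -
    let ?p = "emeasure \<gamma> {V \<in> space \<gamma>. norm (orth_proj V e) \<le> \<rho>}"
    let ?S = "\<lambda>V x. indicator {x \<in> ball 0 1. norm (orth_proj V x) \<le> \<rho>} (x :: real ^ 'n) :: ennreal"
    have m2: "(\<lambda>(V, x). ?S V x) \<in> borel_measurable (\<gamma> \<Otimes>\<^sub>M lborel)"
    proof -
      let ?f = "\<lambda>(V, x). orth_proj V (x :: real ^ 'n)"
      let ?A = "space \<gamma> \<times> ball (0 :: real ^ 'n) 1"
      let ?B = "{z \<in> space (\<gamma> \<Otimes>\<^sub>M borel). norm (?f z) \<le> \<rho>}"
      have "?A \<in> sets (\<gamma> \<Otimes>\<^sub>M borel)" by (rule pair_measureI) auto
      moreover have "?B \<in> sets (\<gamma> \<Otimes>\<^sub>M borel)"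
        using measurable_compose[OF measurable_orth_proj_pair[OF \<gamma>] borel_measurable_norm]
        by (rule borel_measurable_le[OF _ borel_measurable_const])
      ultimately have "indicator (?A \<inter> ?B) \<in> borel_measurable (\<gamma> \<Otimes>\<^sub>M borel)"
        by (intro borel_measurable_indicator sets.Int)
      moreover have "sets (\<gamma> \<Otimes>\<^sub>M borel) = sets (\<gamma> \<Otimes>\<^sub>M lborel)"
        by (intro sets_pair_measure_cong) auto
      ultimately have "indicator (?A \<inter> ?B) \<in> borel_measurable (\<gamma> \<Otimes>\<^sub>M lborel)"
        by (simp cong: measurable_cong_sets)
      then show ?thesis
        by (rule measurable_cong[THEN iffD1, rotated]) (auto simp: indicator_def space_pair_measure)
    qed
    \<comment> \<open>\<open>norm (orth_proj V x) \<le> \<rho>\<close> is weaker than the same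
      condition with \<open>\<rho> * norm x\<close>, and the latter has measure \<open>?p\<close> by
      scaling and rotating \<open>e\<close>; at x = 0 the condition always holds.\<close>
    have low: "?p * indicator (ball 0 1) x \<le> (\<integral>\<^sup>+V. ?S V x \<partial>\<gamma>)" for x :: "real ^ 'n"
    proof (cases "x \<in> ball 0 1")
      case True
      have "?p = emeasure \<gamma> {V \<in> space \<gamma>. norm (orth_proj V (norm x *\<^sub>R e)) \<le> \<rho> * norm x}" if "x \<noteq> 0"
        using that by (intro arg_cong[of _ _ "emeasure \<gamma>"])
          (auto simp: space_grassmann_measure[OF \<gamma>] grassmannian_def orth_proj_scaleR mult_ac)
      also have "emeasure \<gamma> {V \<in> space \<gamma>. norm (orth_proj V (norm x *\<^sub>R e)) \<le> \<rho> * norm x}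
        = emeasure \<gamma> {V \<in> space \<gamma>. norm (orth_proj V x) \<le> \<rho> * norm x}"
        using e by (intro grassmann_slab_rotate[OF \<gamma> n]) simp
      also have "\<dots> \<le> emeasure \<gamma> {V \<in> space \<gamma>. norm (orth_proj V x) \<le> \<rho>}"
      proof -
        have "\<rho> * norm x \<le> \<rho>" using True rho by (simp add: mult_left_le)
        then show ?thesis by (intro emeasure_mono) auto
      qed
      finally have 1: "x \<noteq> 0 \<Longrightarrow> ?p \<le> emeasure \<gamma> {V \<in> space \<gamma>. norm (orth_proj V x) \<le> \<rho>}" .
      have "?p \<le> emeasure \<gamma> {V \<in> space \<gamma>. norm (orth_proj V x) \<le> \<rho>}"
      proof (cases "x = 0")
        case True
        have "{V \<in> space \<gamma>. norm (orth_proj V x) \<le> \<rho>} = space \<gamma>"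
          using rho True by (auto simp: orth_proj_0 space_grassmann_measure[OF \<gamma>] grassmannian_def)
        then show ?thesis by (simp add: emeasure_space_1 emeasure_le_1)
      qed (use 1 in simp)
      also have "\<dots> = (\<integral>\<^sup>+V. indicator {V \<in> space \<gamma>. norm (orth_proj V x) \<le> \<rho>} V \<partial>\<gamma>)"
        by (rule nn_integral_indicator[symmetric]) measurable
      also have "\<dots> = (\<integral>\<^sup>+V. ?S V x \<partial>\<gamma>)"
        by (rule nn_integral_cong) (use True in \<open>auto simp: indicator_def\<close>)
      finally show ?thesis using True by simp
    qed simp
    have "?p * ennreal w = (\<integral>\<^sup>+x. ?p * indicator (ball 0 1) x \<partial>(lborel :: (real ^ 'n) measure))"
      by (subst nn_integral_cmult_indicator) (simp_all add: emeasure_ball w_def)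
    also have "\<dots> \<le> (\<integral>\<^sup>+x. (\<integral>\<^sup>+V. ?S V x \<partial>\<gamma>) \<partial>lborel)"
      by (intro nn_integral_mono low)
    also have "\<dots> = (\<integral>\<^sup>+V. (\<integral>\<^sup>+x. ?S V x \<partial>lborel) \<partial>\<gamma>)"
      using Fubini'[OF m2] .
    also have "\<dots> \<le> (\<integral>\<^sup>+V. ennreal (K * \<rho> ^ m) \<partial>\<gamma>)"
    proof (rule nn_integral_mono)
      fix V assume "V \<in> space \<gamma>"
      then have V: "subspace V" "dim V = m" by (auto simp: space_grassmann_measure[OF \<gamma>] grassmannian_def)
      have "continuous_on UNIV (\<lambda>x. norm (orth_proj V x))"
        by (intro continuous_intros continuous_orth_proj V)
      then have "{x. norm (orth_proj V x) \<le> \<rho>} \<in> sets borel"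
        by (intro borel_closed closed_Collect_le) auto
      then have "ball 0 1 \<inter> {x. norm (orth_proj V x) \<le> \<rho>} \<in> sets borel" by (intro sets.Int) auto
      moreover have "ball 0 1 \<inter> {x. norm (orth_proj V x) \<le> \<rho>} = {x \<in> ball 0 1. norm (orth_proj V x) \<le> \<rho>}"
        by blast
      ultimately have "(\<integral>\<^sup>+x. ?S V x \<partial>lborel) = emeasure lborel {x \<in> ball 0 1. norm (orth_proj V x) \<le> \<rho>}"
        by (intro nn_integral_indicator) simp
      also have "\<dots> \<le> ennreal (K * \<rho> ^ m)"
        using measure_slab_le[OF V rho] by (simp only: K_def k_def)
      finally show "(\<integral>\<^sup>+x. ?S V x \<partial>lborel) \<le> ennreal (K * \<rho> ^ m)" .
    qed
    also have "\<dots> = ennreal (K * \<rho> ^ m)" by (simp add: emeasure_space_1)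
    finally have "?p * ennreal w \<le> ennreal (K * \<rho> ^ m)" .
    then have "measure \<gamma> {V \<in> space \<gamma>. norm (orth_proj V e) \<le> \<rho>} * w \<le> K * \<rho> ^ m"
      using w K rho by (simp add: emeasure_eq_measure ennreal_mult[symmetric])
    then show ?thesis
      using w unfolding emeasure_eq_measure by (intro ennreal_leI) (simp add: field_simps)
  qed
  show thesis
  \<comment> \<open>The maximum with 1 keeps the constant valid where the kernel equals 1 and only
    the trivial bound by the total mass is at hand.\<close>
  proof (rule that[of "max 1 (K / w)"])
    fix x :: "real ^ 'n" and \<rho> :: real assume a: "norm x = 1" "0 < \<rho>" "\<rho> \<le> 1"
    have "ennreal (K / w * \<rho> ^ m) \<le> ennreal (max 1 (K / w) * \<rho> ^ m)"
      using a by (intro ennreal_leI mult_right_mono) auto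
    then show "emeasure \<gamma> {V \<in> space \<gamma>. norm (orth_proj V x) \<le> \<rho>} \<le> ennreal (max 1 (K / w) * \<rho> ^ m)"
      using main[OF a] by (rule order_trans[rotated])
  qed simp
qed

text \<open>Homogeneity moves a vector with |x| > \<rho> to the unit sphere, with width \<rho> /
  |x|.\<close>

lemma grassmann_slab:
  fixes \<gamma> :: "(real ^ 'n) set measure"
  assumes \<gamma>: "grassmann_measure m \<gamma>" and n: "2 \<le> CARD('n)"
  obtains C where "1 \<le> C"
    "\<And>x \<rho>. 0 < \<rho> \<Longrightarrow>
      emeasure \<gamma> {V \<in> space \<gamma>. norm (orth_proj V x) \<le> \<rho>} \<le> ennreal (C * kernel_phi m \<rho> x)"
proof -
  interpret prob_space \<gamma> using \<gamma> by (simp add: grassmann_measure_def)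
  obtain C where C: "1 \<le> C" "\<And>x \<rho>. norm x = 1 \<Longrightarrow> 0 < \<rho> \<Longrightarrow> \<rho> \<le> 1 \<Longrightarrow>
      emeasure \<gamma> {V \<in> space \<gamma>. norm (orth_proj V x) \<le> \<rho>} \<le> ennreal (C * \<rho> ^ m)"
    using grassmann_slab_unit[OF \<gamma> n] by blast
  show thesis
  proof (rule that[OF C(1)])
    fix x :: "real ^ 'n" and \<rho> :: real assume rho: "0 < \<rho>"
    show "emeasure \<gamma> {V \<in> space \<gamma>. norm (orth_proj V x) \<le> \<rho>} \<le> ennreal (C * kernel_phi m \<rho> x)"
    proof (cases "x = 0 \<or> norm x \<le> \<rho>")
      case True
      then have "kernel_phi m \<rho> x = 1" using rho
        by (cases "x = 0") (simp_all add: kernel_phi_def min_absorb1 ge_one_powr_ge_zero)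
      moreover have "emeasure \<gamma> {V \<in> space \<gamma>. norm (orth_proj V x) \<le> \<rho>} \<le> 1"
        using emeasure_le_1 .
      ultimately show ?thesis using C(1) 
        using ennreal_leI[of 1 C] by (auto intro: order_trans)
    next
      case False
      then have x: "x \<noteq> 0" "\<rho> / norm x \<le> 1" "0 < \<rho> / norm x" using rho by (auto simp: field_simps)
      have "{V \<in> space \<gamma>. norm (orth_proj V x) \<le> \<rho>}
          = {V \<in> space \<gamma>. norm (orth_proj V (x /\<^sub>R norm x)) \<le> \<rho> / norm x}"
        using x by (auto simp: space_grassmann_measure[OF \<gamma>] grassmannian_def orth_proj_scaleR field_simps)
      then have "emeasure \<gamma> {V \<in> space \<gamma>. norm (orth_proj V x) \<le> \<rho>} \<le> ennreal (C * (\<rho> / norm x) ^ m)"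
        using C(2)[of "x /\<^sub>R norm x" "\<rho> / norm x"] x by simp
      moreover have "kernel_phi m \<rho> x = (\<rho> / norm x) ^ m"
        using x rho by (simp add: kernel_phi_def powr_realpow power_le_one min_absorb2)
      ultimately show ?thesis by simp
    qed
  qed
qed


section \<open>Covering numbers and capacities\<close>

text \<open>Covering numbers count sets of diameter exactly \<open>r\<close>, while constructions
  yield diameter at most \<open>r\<close>. In a Euclidean space the union of the closed balls of
  radius \<rho> about the points of a set has diameter larger by exactly 2 \<rho>: two points can be
  pushed apart along the line through them.\<close>

lemma thicken_diameter:
  fixes U :: "'a::euclidean_space set"
  assumes U: "bounded U" "diameter U \<le> r" and r: "0 < r"
  obtains U' where "U \<subseteq> U'" "bounded U'" "diameter U' = r"
proof -
  have *: "\<exists>U'. U \<subseteq> U' \<and> bounded U' \<and> diameter U' = r"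
    if U: "bounded U" "diameter U \<le> r" "U \<noteq> {}" for U :: "'a set"
  proof -
    define \<rho> where "\<rho> = (r - diameter U) / 2"
    have rho: "0 \<le> \<rho>" using U by (simp add: \<rho>_def)
    define U' where "U' = (\<Union>u\<in>U. cball u \<rho>)"
    have sub: "U \<subseteq> U'" using rho by (auto simp: U'_def)
    have d: "norm (x - y) \<le> r" if xy: "x \<in> U'" "y \<in> U'" for x y
    proof -
      obtain u v where uv: "u \<in> U" "v \<in> U" "dist u x \<le> \<rho>" "dist v y \<le> \<rho>"
        using xy by (auto simp: U'_def)
      have "dist u v \<le> diameter U" using diameter_bounded_bound[OF U(1)] uv by blast
      moreover have "dist x y \<le> dist u x + dist u v + dist v y"
        using dist_triangle[of x y u] dist_triangle[of u y v] by (simp add: dist_commute)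
      ultimately show ?thesis using uv by (simp add: dist_norm \<rho>_def)
    qed
    have le: "diameter U' \<le> r" using r d by (intro diameter_le) auto
    obtain a where a: "a \<in> U'" using sub U(3) by blast
    have bd: "bounded U'" unfolding bounded_def using d a by (metis dist_norm)
    have "diameter U \<le> diameter U' - 2 * \<rho>"
    proof (rule diameter_le)
      show "U \<noteq> {} \<or> 0 \<le> diameter U' - 2 * \<rho>" using U by simp
      fix u v assume uv: "u \<in> U" "v \<in> U"
      \<comment> \<open>The direction in which to push apart; for u = v any unit vector serves,
        which covers singletons.\<close>
      define e where "e = (if u = v then SOME b. b \<in> Basis else (u - v) /\<^sub>R norm (u - v))"
      have e: "norm e = 1" using someI_ex[of "\<lambda>b. b \<in> (Basis :: 'a set)"] nonempty_Basis
        by (auto simp: e_def norm_Basis)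
      have "norm ((u + \<rho> *\<^sub>R e) - (v - \<rho> *\<^sub>R e)) = norm (u - v) + 2 * \<rho>"
      proof (cases "u = v")
        case True
        have "(u + \<rho> *\<^sub>R e) - (v - \<rho> *\<^sub>R e) = (\<rho> + \<rho>) *\<^sub>R e"
          unfolding scaleR_add_left using True by simp
        then show ?thesis using True e rho by simp
      next
        case False
        then have "u - v = norm (u - v) *\<^sub>R e" by (simp add: e_def)
        then have "(u + \<rho> *\<^sub>R e) - (v - \<rho> *\<^sub>R e) = (norm (u - v) + (\<rho> + \<rho>)) *\<^sub>R e"
          unfolding scaleR_add_left by (metis add.assoc add_diff_eq diff_diff_eq2 add.commute)
        then show ?thesis using e rho by simp
      qed
      moreover have "u + \<rho> *\<^sub>R e \<in> U'" "v - \<rho> *\<^sub>R e \<in> U'"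
      proof -
        have "u + \<rho> *\<^sub>R e \<in> cball u \<rho>" "v - \<rho> *\<^sub>R e \<in> cball v \<rho>"
          using e rho by (simp_all add: dist_norm)
        then show "u + \<rho> *\<^sub>R e \<in> U'" "v - \<rho> *\<^sub>R e \<in> U'" unfolding U'_def using uv by blast+
      qed
      then have "dist (u + \<rho> *\<^sub>R e) (v - \<rho> *\<^sub>R e) \<le> diameter U'"
        using diameter_bounded_bound[OF bd] by blast
      ultimately show "norm (u - v) \<le> diameter U' - 2 * \<rho>" by (simp add: dist_norm)
    qed
    moreover have "2 * \<rho> = r - diameter U" by (simp add: \<rho>_def)
    ultimately have "diameter U' = r" using le by linarith
    then show ?thesis using sub bd by blast
  qed
  show thesis
  proof (cases "U = {}")
    case True
    \<comment> \<open>The empty set has only empty neighbourhoods, so a thickened singleton replaces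
      it.\<close>
    have "diameter {0 :: 'a} \<le> r" using r by (simp add: diameter_def)
    then have "\<exists>U'. {0 :: 'a} \<subseteq> U' \<and> bounded U' \<and> diameter U' = r" by (intro *) auto
    then obtain U' :: "'a set" where "bounded U'" "diameter U' = r" by metis
    then show thesis using that[of U'] True by simp
  next
    case False
    then obtain U' where "U \<subseteq> U'" "bounded U'" "diameter U' = r" using *[OF U False] by blast
    then show thesis by (rule that)
  qed
qed

lemma covering_number_le:
  fixes E :: "'a::euclidean_space set"
  assumes F: "finite F" "\<And>U. U \<in> F \<Longrightarrow> bounded U \<and> diameter U \<le> r" "E \<subseteq> \<Union>F" and r: "0 < r"
  shows "covering_number r E \<le> card F"
proof -
  have "\<exists>U'. U \<subseteq> U' \<and> bounded U' \<and> diameter U' = r" if "U \<in> F" for U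
  proof -
    have "bounded U" "diameter U \<le> r" using F(2)[OF that] by auto
    then obtain U' where "U \<subseteq> U'" "bounded U'" "diameter U' = r" using r by (rule thicken_diameter)
    then show ?thesis by blast
  qed
  then obtain g where g: "\<And>U. U \<in> F \<Longrightarrow> U \<subseteq> g U \<and> bounded (g U) \<and> diameter (g U) = r" by metis
  have g1: "U \<subseteq> g U" if "U \<in> F" for U using g[OF that] by simp
  have "covering_number r E \<le> card (g ` F)"
    unfolding covering_number_def
  proof (rule Least_le, intro exI[of _ "g ` F"] conjI ballI)
    show "E \<subseteq> \<Union> (g ` F)" using F(3) g1 by blast
  qed (use F(1) g in auto)
  also have "\<dots> \<le> card F" using F(1) by (rule card_image_le)
  finally show ?thesis .
qed

lemma bounded_subset_cball_ge:
  fixes E :: "'a::real_normed_vector set"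
  assumes "bounded E"
  obtains D where "d \<le> D" "E \<subseteq> cball 0 D"
proof -
  obtain D where "\<forall>x\<in>E. norm x \<le> D" using assms by (auto simp: bounded_iff)
  then show thesis by (intro that[of "max d D"]) (auto simp: le_max_iff_disj)
qed

text \<open>A \<open>LEAST\<close> has its defining property only once a witness exists; balls about
  an r / 2-net are a finite cover by sets of diameter exactly \<open>r\<close>.\<close>

lemma covering_number_obtain:
  fixes E :: "'a::euclidean_space set"
  assumes E: "bounded E" and r: "0 < r"
  obtains F where "finite F" "card F = covering_number r E"
    "\<And>U. U \<in> F \<Longrightarrow> bounded U" "\<And>U. U \<in> F \<Longrightarrow> diameter U = r" "E \<subseteq> \<Union>F"
proof -
  let ?Q = "\<lambda>k. \<exists>F. finite F \<and> card F = k \<and> (\<forall>U \<in> F. bounded U \<and> diameter U = r) \<and> E \<subseteq> \<Union>F"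
  obtain D where D: "r / 2 \<le> D" "E \<subseteq> cball 0 D" using bounded_subset_cball_ge[OF E] .
  obtain P where P: "P \<subseteq> E" "finite P" "\<And>x. x \<in> E \<Longrightarrow> \<exists>p\<in>P. dist x p < r / 2"
    using maximal_separated_subspace[OF subspace_UNIV refl _ D(1) subset_UNIV D(2)] r by (metis half_gt_zero)
  have "?Q (card ((\<lambda>p. cball p (r / 2)) ` P))"
  proof (intro exI[of _ "(\<lambda>p. cball p (r / 2)) ` P"] conjI ballI)
    show "E \<subseteq> \<Union> ((\<lambda>p. cball p (r / 2)) ` P)" using P(3) by (force simp: dist_commute)
  qed (use r P(2) in \<open>auto simp: diameter_cball\<close>)
  then have "?Q (covering_number r E)" unfolding covering_number_def by (rule LeastI)
  then obtain F where F: "finite F" "card F = covering_number r E"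
    "\<forall>U \<in> F. bounded U \<and> diameter U = r" "E \<subseteq> \<Union>F" by blast
  show thesis by (rule that[of F]) (use F in auto)
qed

lemma covering_number_antimono:
  fixes E :: "'a::euclidean_space set"
  assumes E: "bounded E" and r: "0 < r" "r \<le> r'"
  shows "covering_number r' E \<le> covering_number r E"
proof -
  obtain F where F: "finite F" "card F = covering_number r E"
    "\<And>U. U \<in> F \<Longrightarrow> bounded U" "\<And>U. U \<in> F \<Longrightarrow> diameter U = r" "E \<subseteq> \<Union>F"
    using covering_number_obtain[OF E r(1)] by metis
  have "covering_number r' E \<le> card F"
    using F r by (intro covering_number_le) auto
  then show ?thesis using F by simp
qed

lemma covering_number_pos:
  fixes E :: "'a::euclidean_space set"
  assumes E: "bounded E" "E \<noteq> {}" and r: "0 < r"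
  shows "0 < covering_number r E"
proof -
  obtain F where F: "finite F" "card F = covering_number r E" "E \<subseteq> \<Union>F"
    using covering_number_obtain[OF E(1) r] by metis
  have "F \<noteq> {}" using F E by auto
  then show ?thesis using F by (metis card_gt_0_iff)
qed

section \<open>Energies of measures and capacities\<close>

definition energy :: "real \<Rightarrow> real \<Rightarrow> 'a::euclidean_space measure \<Rightarrow> real"
  where "energy s r \<mu> = (\<integral>x. \<integral>y. kernel_phi s r (x - y) \<partial>\<mu> \<partial>\<mu>)"

lemma kernel_phi_nonneg [simp]: "0 \<le> kernel_phi s r x"
  and kernel_phi_le_1 [simp]: "kernel_phi s r x \<le> 1"
  by (auto simp: kernel_phi_def)

lemma kernel_phi_measurable [measurable]: "kernel_phi s r \<in> borel_measurable borel"
  unfolding kernel_phi_def by measurable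

lemma kernel_phi_mono:
  assumes "0 \<le> r" "r \<le> r'" "norm y \<le> norm x" "0 \<le> s"
  shows "kernel_phi s r x \<le> kernel_phi s r' y"
proof (cases "y = 0")
  case True
  then have "kernel_phi s r' y = 1" by (simp add: kernel_phi_def)
  then show ?thesis by simp
next
  case False
  then have x: "x \<noteq> 0" using assms by auto
  have "(r / norm x) powr s \<le> (r' / norm y) powr s"
    using assms False by (intro powr_mono2 frac_le) auto
  then show ?thesis using False x by (simp add: kernel_phi_def min.coboundedI2 min_le_iff_disj)
qed

lemma kernel_phi_double:
  assumes "0 < r" "0 \<le> s"
  shows "kernel_phi s (2 * r) x \<le> 2 powr s * kernel_phi s r x"
proof (cases "x = 0")
  case False
  have "(2 * r / norm x) powr s = 2 powr s * (r / norm x) powr s"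
    using assms by (simp add: powr_mult flip: times_divide_eq_right)
  moreover have "1 \<le> 2 powr s" using assms by (simp add: ge_one_powr_ge_zero)
  ultimately show ?thesis using False by (simp add: kernel_phi_def min_mult_distrib_left min_le_iff_disj min.coboundedI1)
qed (use assms in \<open>simp add: kernel_phi_def ge_one_powr_ge_zero\<close>)

lemma prob_measures_onD:
  assumes "\<mu> \<in> prob_measures_on K"
  shows "prob_space \<mu>" "sets \<mu> = sets borel" "emeasure \<mu> (- K) = 0"
  using assms by (auto simp: prob_measures_on_def)

text \<open>Joins the Bochner integrals of \<open>capacity\<close> to the nonnegative integrals on
  which Fubini's theorem operates.\<close>

lemma energy_nn_integral:
  assumes \<mu>: "prob_space \<mu>" "sets \<mu> = sets borel"
  shows "ennreal (energy s r \<mu>) = (\<integral>\<^sup>+x. \<integral>\<^sup>+y. ennreal (kernel_phi s r (x - y)) \<partial>\<mu> \<partial>\<mu>)"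
    and "integrable \<mu> (\<lambda>y. kernel_phi s r (x - y))"
    and "integrable \<mu> (\<lambda>x. \<integral>y. kernel_phi s r (x - y) \<partial>\<mu>)"
proof -
  interpret prob_space \<mu> by fact
  note \<mu>(2)[measurable_cong]
  have 1: "integrable \<mu> (\<lambda>y. kernel_phi s r (x - y))" for x
    by (rule integrable_const_bound[where B = 1]) auto
  then show "integrable \<mu> (\<lambda>y. kernel_phi s r (x - y))" .
  have le: "(\<integral>y. kernel_phi s r (x - y) \<partial>\<mu>) \<le> 1" for x
    using integral_mono[OF 1 integrable_const[of 1]] by (simp add: prob_space)
  have nn: "0 \<le> (\<integral>y. kernel_phi s r (x - y) \<partial>\<mu>)" for x
    by (rule integral_nonneg_AE) simp
  show 2: "integrable \<mu> (\<lambda>x. \<integral>y. kernel_phi s r (x - y) \<partial>\<mu>)"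
    by (rule integrable_const_bound[where B = 1]) (use le nn in auto)
  have "ennreal (energy s r \<mu>) = (\<integral>\<^sup>+x. ennreal (\<integral>y. kernel_phi s r (x - y) \<partial>\<mu>) \<partial>\<mu>)"
    unfolding energy_def using 2 nn by (intro nn_integral_eq_integral[symmetric]) auto
  also have "\<dots> = (\<integral>\<^sup>+x. \<integral>\<^sup>+y. ennreal (kernel_phi s r (x - y)) \<partial>\<mu> \<partial>\<mu>)"
    by (intro nn_integral_cong nn_integral_eq_integral[symmetric] 1) auto
  finally show "ennreal (energy s r \<mu>) = (\<integral>\<^sup>+x. \<integral>\<^sup>+y. ennreal (kernel_phi s r (x - y)) \<partial>\<mu> \<partial>\<mu>)" .
qed

lemma energy_mono:
  fixes \<mu> :: "'a::euclidean_space measure"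
  assumes \<mu>: "prob_space \<mu>" "sets \<mu> = sets borel"
    and le: "\<And>x y :: 'a. kernel_phi s r (x - y) \<le> c * kernel_phi s' r' (x - y)"
  shows "energy s r \<mu> \<le> c * energy s' r' \<mu>"
proof -
  have "energy s r \<mu> \<le> (\<integral>x. \<integral>y. c * kernel_phi s' r' (x - y) \<partial>\<mu> \<partial>\<mu>)"
    unfolding energy_def using energy_nn_integral(2,3)[OF \<mu>]
    by (intro integral_mono) (auto intro: le)
  then show ?thesis by (simp add: energy_def)
qed

lemma energy_nonneg: "0 \<le> energy s r \<mu>"
  unfolding energy_def by (intro integral_nonneg_AE AE_I2) simp

lemma energy_le_1:
  assumes \<mu>: "prob_space \<mu>" "sets \<mu> = sets borel"
  shows "energy s r \<mu> \<le> 1"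
proof -
  interpret prob_space \<mu> by fact
  have "(\<integral>y. kernel_phi s r (x - y) \<partial>\<mu>) \<le> 1" for x
    using integral_mono[OF energy_nn_integral(2)[OF \<mu>] integrable_const[of 1]] by (simp add: prob_space)
  then show ?thesis unfolding energy_def
    using integral_mono[OF energy_nn_integral(3)[OF \<mu>] integrable_const[of 1]] by (simp add: prob_space)
qed

lemma capacity_eq: "capacity s r E = 1 / (INF \<mu> \<in> prob_measures_on (closure E). energy s r \<mu>)"
  by (simp add: capacity_def energy_def)

lemma bdd_below_energy: "bdd_below (energy s r ` X)"
  by (rule bdd_belowI2[of _ 0]) (rule energy_nonneg)

lemma prob_measures_on_finite:
  fixes P :: "'a::euclidean_space set" and w :: "'b \<Rightarrow> 'a"
  assumes P: "finite I" "I \<noteq> {}" "w ` I \<subseteq> K" and K: "closed K"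
  shows "distr (measure_pmf (pmf_of_set I)) borel w \<in> prob_measures_on K"
    and "energy s r (distr (measure_pmf (pmf_of_set I)) borel w)
      = (\<Sum>i\<in>I. \<Sum>j\<in>I. kernel_phi s r (w i - w j)) / (real (card I))\<^sup>2"
proof -
  let ?p = "measure_pmf (pmf_of_set I)"
  have m: "w \<in> measurable ?p borel" by simp
  have "emeasure (distr ?p borel w) (- K) = emeasure ?p (w -` (- K) \<inter> space ?p)"
    using K by (intro emeasure_distr m) auto
  also have "\<dots> = 0"
    using P by (auto simp: emeasure_pmf_of_set Int_def)
  finally show "distr ?p borel w \<in> prob_measures_on K"
    using measure_pmf.prob_space_distr[OF m] by (simp add: prob_measures_on_def)
  have "(\<integral>y. kernel_phi s r (x - y) \<partial>distr ?p borel w) = (\<Sum>j\<in>I. kernel_phi s r (x - w j)) / real (card I)" for x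
    using P by (simp add: integral_distr integral_pmf_of_set)
  then have "energy s r (distr ?p borel w) = (\<integral>x. (\<Sum>j\<in>I. kernel_phi s r (x - w j)) / real (card I) \<partial>distr ?p borel w)"
    unfolding energy_def by simp
  also have "\<dots> = (\<Sum>i\<in>I. (\<Sum>j\<in>I. kernel_phi s r (w i - w j)) / real (card I)) / real (card I)"
    using P by (subst integral_distr) (auto simp: integral_pmf_of_set sum_divide_distrib)
  also have "\<dots> = (\<Sum>i\<in>I. \<Sum>j\<in>I. kernel_phi s r (w i - w j)) / (real (card I))\<^sup>2"
    by (simp add: sum_divide_distrib[symmetric] power2_eq_square)
  finally show "energy s r (distr ?p borel w)
      = (\<Sum>i\<in>I. \<Sum>j\<in>I. kernel_phi s r (w i - w j)) / (real (card I))\<^sup>2" .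
qed

lemma prob_measures_on_nonempty:
  fixes K :: "'a::euclidean_space set"
  assumes "closed K" "K \<noteq> {}"
  shows "prob_measures_on K \<noteq> {}"
proof -
  obtain a where "a \<in> K" using assms by blast
  then show ?thesis using prob_measures_on_finite(1)[of "{a}" "\<lambda>x. x" K] assms by blast
qed

text \<open>The reciprocal in \<open>capacity\<close> is meaningful only if the infimum is positive.
  Distances within the closure are at most 2 \<open>D\<close>, so the kernel has a positive lower
  bound there.\<close>

lemma INF_energy_pos:
  fixes E :: "'a::euclidean_space set"
  assumes E: "bounded E" "E \<noteq> {}" and r: "0 < r" and s: "0 \<le> s"
  shows "0 < (INF \<mu> \<in> prob_measures_on (closure E). energy s r \<mu>)"
    and "(INF \<mu> \<in> prob_measures_on (closure E). energy s r \<mu>) \<le> 1"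
proof -
  obtain D where D: "1 \<le> D" "closure E \<subseteq> cball 0 D"
    using bounded_subset_cball_ge[OF bounded_closure[OF E(1)]] .
  have ne: "prob_measures_on (closure E) \<noteq> {}" using E by (intro prob_measures_on_nonempty) auto
  define c where "c = min 1 ((r / (2 * D)) powr s)"
  have c: "0 < c" using r D by (simp add: c_def)
  have low: "c \<le> kernel_phi s r (x - y)" if "x \<in> closure E" "y \<in> closure E" for x y
  proof (cases "x = y")
    case False
    have "norm (x - y) \<le> 2 * D" 
    proof -
      have "norm x \<le> D" "norm y \<le> D" using that D(2) by auto
      then show ?thesis using norm_triangle_ineq4[of x y] by linarith
    qed
    then have "(r / (2 * D)) powr s \<le> (r / norm (x - y)) powr s"
      using r s False D by (intro powr_mono2 divide_left_mono) auto
    then show ?thesis using False by (simp add: kernel_phi_def c_def min_le_iff_disj)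
  qed (simp add: kernel_phi_def c_def)
  have "c \<le> energy s r \<mu>" if \<mu>: "\<mu> \<in> prob_measures_on (closure E)" for \<mu>
  proof -
    note \<mu>D = prob_measures_onD[OF \<mu>]
    interpret prob_space \<mu> by (rule \<mu>D)
    have ae: "AE x in \<mu>. x \<in> closure E"
      by (rule AE_I[where N = "- closure E"]) (use \<mu>D in auto)
    have "c \<le> (\<integral>y. kernel_phi s r (x - y) \<partial>\<mu>)" if x: "x \<in> closure E" for x
    proof -
      have "(\<integral>y. c \<partial>\<mu>) \<le> (\<integral>y. kernel_phi s r (x - y) \<partial>\<mu>)"
        using ae energy_nn_integral(2)[OF \<mu>D(1,2)] by (intro integral_mono_AE) (auto intro: low x)
      then show ?thesis by (simp add: prob_space)
    qed
    then have "(\<integral>x. c \<partial>\<mu>) \<le> energy s r \<mu>"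
      unfolding energy_def using ae energy_nn_integral(3)[OF \<mu>D(1,2)]
      by (intro integral_mono_AE) auto
    then show ?thesis by (simp add: prob_space)
  qed
  then have "c \<le> (INF \<mu> \<in> prob_measures_on (closure E). energy s r \<mu>)"
    by (intro cINF_greatest ne)
  with c show "0 < (INF \<mu> \<in> prob_measures_on (closure E). energy s r \<mu>)" by linarith
  obtain \<mu> where \<mu>: "\<mu> \<in> prob_measures_on (closure E)" using ne by blast
  show "(INF \<mu> \<in> prob_measures_on (closure E). energy s r \<mu>) \<le> 1"
    using cINF_lower[OF bdd_below_energy \<mu>] energy_le_1[OF prob_measures_onD(1,2)[OF \<mu>]] by (rule order_trans)
qed

context
  fixes E :: "'a::euclidean_space set" and s r :: real
  assumes E: "bounded E" "E \<noteq> {}" and r: "0 < r" and s: "0 \<le> s"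
begin

lemma capacity_ge_1: "1 \<le> capacity s r E"
  using INF_energy_pos[OF E r s] by (simp add: capacity_eq)

text \<open>A factor 2 stands in for attainment of the infimum; logarithmic limits do not see
  it.\<close>

lemma near_optimal_energy:
  obtains \<mu> where "\<mu> \<in> prob_measures_on (closure E)" "energy s r \<mu> \<le> 2 / capacity s r E"
proof -
  let ?I = "INF \<mu> \<in> prob_measures_on (closure E). energy s r \<mu>"
  have "?I < 2 * ?I" using INF_energy_pos(1)[OF E r s] by simp
  then obtain \<mu> where "\<mu> \<in> prob_measures_on (closure E)" "energy s r \<mu> < 2 * ?I"
    using cINF_less_iff[OF prob_measures_on_nonempty bdd_below_energy, of "closure E"] E by auto
  then show thesis using that[of \<mu>] by (simp add: capacity_eq)
qed

lemma capacity_antimono: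
  assumes "r \<le> r'"
  shows "capacity s r' E \<le> capacity s r E"
  unfolding capacity_eq
proof (intro divide_left_mono mult_pos_pos INF_energy_pos E s)
  show "(INF \<mu> \<in> prob_measures_on (closure E). energy s r \<mu>)
     \<le> (INF \<mu> \<in> prob_measures_on (closure E). energy s r' \<mu>)"
  proof (rule cINF_mono[OF prob_measures_on_nonempty bdd_below_energy])
    fix \<mu> :: "'a measure" assume \<mu>: "\<mu> \<in> prob_measures_on (closure E)"
    have "energy s r \<mu> \<le> 1 * energy s r' \<mu>"
      using prob_measures_onD[OF \<mu>] kernel_phi_mono[OF _ assms order_refl s] r by (intro energy_mono) auto
    then show "\<exists>n\<in>prob_measures_on (closure E). energy s r n \<le> energy s r' \<mu>" using \<mu> by auto
  qed (use E in auto)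
qed (use r assms in auto)

text \<open>Makes dyadic scales sufficient: together with monotonicity it controls the capacity
  between two consecutive ones.\<close>

lemma capacity_double: "capacity s r E \<le> 2 powr s * capacity s (2 * r) E"
proof -
  let ?I = "\<lambda>r. INF \<mu> \<in> prob_measures_on (closure E). energy s r \<mu>"
  have pos: "0 < ?I r" "0 < ?I (2 * r)" using INF_energy_pos[OF E _ s] r by auto
  have "?I (2 * r) / 2 powr s \<le> ?I r"
  proof (rule cINF_greatest[OF prob_measures_on_nonempty])
    fix \<mu> :: "'a measure" assume \<mu>: "\<mu> \<in> prob_measures_on (closure E)"
    have "?I (2 * r) \<le> energy s (2 * r) \<mu>" by (rule cINF_lower[OF bdd_below_energy \<mu>])
    also have "\<dots> \<le> 2 powr s * energy s r \<mu>"
      using prob_measures_onD[OF \<mu>] kernel_phi_double[OF r s] by (intro energy_mono) auto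
    finally show "?I (2 * r) / 2 powr s \<le> energy s r \<mu>" by (simp add: field_simps)
  qed (use E in auto)
  then show ?thesis using pos unfolding capacity_eq by (simp add: field_simps)
qed

end


section \<open>Box dimensions of projections\<close>

lemma Liminf_Limsup_le_of_le_add:
  fixes u v e :: "'b \<Rightarrow> real"
  assumes le: "\<forall>\<^sub>F x in F. u x \<le> v x + e x" and e: "(e \<longlongrightarrow> 0) F"
  shows "Liminf F (\<lambda>x. ereal (u x)) \<le> Liminf F (\<lambda>x. ereal (v x))"
    and "Limsup F (\<lambda>x. ereal (u x)) \<le> Limsup F (\<lambda>x. ereal (v x))"
proof -
  show "Liminf F (\<lambda>x. ereal (u x)) \<le> Liminf F (\<lambda>x. ereal (v x))"
    unfolding le_Liminf_iff
  proof (intro allI impI)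
    fix y assume y: "y < Liminf F (\<lambda>x. ereal (u x))"
    show "\<forall>\<^sub>F x in F. y < ereal (v x)"
    proof (cases y)
      case (real y')
      obtain z where z: "y < ereal z" "ereal z < Liminf F (\<lambda>x. ereal (u x))"
        using ereal_dense2[OF y] by blast
      have "\<forall>\<^sub>F x in F. ereal z < ereal (u x)" using z(2) by (rule less_LiminfD)
      moreover have "\<forall>\<^sub>F x in F. e x < z - y'" using e z real by (intro order_tendstoD) auto
      ultimately show ?thesis using le by eventually_elim (use real in auto)
    qed (use y in auto)
  qed
  show "Limsup F (\<lambda>x. ereal (u x)) \<le> Limsup F (\<lambda>x. ereal (v x))"
    unfolding Limsup_le_iff[of F _ "Limsup F (\<lambda>x. ereal (v x))"]
  proof (intro allI impI)
    fix y assume y: "Limsup F (\<lambda>x. ereal (v x)) < y"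
    show "\<forall>\<^sub>F x in F. ereal (u x) < y"
    proof (cases y)
      case (real y')
      obtain z where z: "Limsup F (\<lambda>x. ereal (v x)) < ereal z" "ereal z < y"
        using ereal_dense2[OF y] by blast
      have "\<forall>\<^sub>F x in F. ereal (v x) < ereal z" using z(1) by (rule Limsup_lessD)
      moreover have "\<forall>\<^sub>F x in F. e x < y' - z" using e z real by (intro order_tendstoD) auto
      ultimately show ?thesis using le by eventually_elim (use real in auto)
    qed (use y in auto)
  qed
qed

text \<open>A factor \<open>h\<close> with ln h = o(ln (1 / r)) shifts the quotients by a quantity
  tending to 0; it will be a polynomial in ln (1 / r). Below r = 1 / 2 the denominators are
  positive.\<close>

lemma Liminf_Limsup_log_ratio_le:
  fixes f g h :: "real \<Rightarrow> real"
  assumes ev: "\<And>r. 0 < r \<Longrightarrow> r \<le> 1 / 2 \<Longrightarrow> 0 < f r \<and> 0 < g r \<and> 0 < h r \<and> f r \<le> h r * g r"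
    and h: "((\<lambda>r. ln (h r) / - ln r) \<longlongrightarrow> 0) (at_right 0)"
  shows "Liminf (at_right 0) (\<lambda>r. ereal (ln (f r) / - ln r)) \<le> Liminf (at_right 0) (\<lambda>r. ereal (ln (g r) / - ln r))"
    and "Limsup (at_right 0) (\<lambda>r. ereal (ln (f r) / - ln r)) \<le> Limsup (at_right 0) (\<lambda>r. ereal (ln (g r) / - ln r))"
proof -
  have "\<forall>\<^sub>F r in at_right (0 :: real). r \<in> {0<..<1 / 2}"
    by (rule eventually_at_right_real) simp
  then have "\<forall>\<^sub>F r in at_right 0. ln (f r) / - ln r \<le> ln (g r) / - ln r + ln (h r) / - ln r"
  proof eventually_elim
    case (elim r)
    then have r: "0 < r" "r \<le> 1 / 2" "- ln r > 0" by auto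
    have "ln (f r) \<le> ln (h r * g r)" using ev[OF r(1,2)] by simp
    also have "\<dots> = ln (g r) + ln (h r)" using ev[OF r(1,2)] by (simp add: ln_mult)
    finally have "ln (f r) / - ln r \<le> (ln (g r) + ln (h r)) / - ln r"
      by (rule divide_right_mono) (use r in simp)
    then show ?case by (simp only: add_divide_distrib)
  qed
  from Liminf_Limsup_le_of_le_add[OF this h] show
    "Liminf (at_right 0) (\<lambda>r. ereal (ln (f r) / - ln r)) \<le> Liminf (at_right 0) (\<lambda>r. ereal (ln (g r) / - ln r))"
    "Limsup (at_right 0) (\<lambda>r. ereal (ln (f r) / - ln r)) \<le> Limsup (at_right 0) (\<lambda>r. ereal (ln (g r) / - ln r))"
    by simp_all
qed

lemma capacity_energy_ge_1:
  fixes E :: "'a::euclidean_space set"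
  assumes E: "bounded E" "E \<noteq> {}" and r: "0 < r" and s: "0 \<le> s"
    and \<mu>: "\<mu> \<in> prob_measures_on (closure E)"
  shows "1 \<le> capacity s r E * energy s r \<mu>"
  unfolding capacity_eq using cINF_lower[OF bdd_below_energy \<mu>, of s r] INF_energy_pos[OF E r s]
  by (simp add: field_simps)

lemma kernel_phi_power:
  assumes "0 < r"
  shows "kernel_phi (real m) r x = (if x = 0 then 1 else min 1 ((r / norm x) ^ m))"
  using assms by (simp add: kernel_phi_def powr_realpow)

text \<open>By separation, of order 2^(j m) points lie within 2^j r of \<open>p\<close>, and at
  distance about 2^j r the kernel is of order 2^(-j m). So each of the \<open>J + 1\<close> dyadic
  distances contributes a constant.\<close>

lemma sum_kernel_separated:
  fixes V :: "'a::euclidean_space set"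
  assumes V: "subspace V" "dim V = m" and r: "0 < r"
    and P: "finite P" "P \<subseteq> V" "P \<subseteq> cball 0 D" "separated (r / 2) P" and D: "2 * D \<le> 2 ^ J * r" and p: "p \<in> P"
  shows "(\<Sum>q\<in>P. kernel_phi m r (p - q)) \<le> real (J + 1) * (4 * (2 * real m + 4)) ^ m"
proof -
  \<comment> \<open>A point outside the ball of radius 2^(j - 1) r has kernel value at most 2^m /
    2^(j m); whole balls stand in for the annuli.\<close>
  let ?c = "\<lambda>j q. 2 ^ m / (2 ^ j) ^ m * indicator (cball p (2 ^ j * r)) q :: real"
  have "(\<Sum>q\<in>P. kernel_phi m r (p - q)) \<le> (\<Sum>q\<in>P. \<Sum>j\<le>J. ?c j q)"
  proof (rule sum_mono)
    fix q assume q: "q \<in> P"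
    have "dist p q \<le> 2 * D"
    proof -
      have "norm p \<le> D" "norm q \<le> D" using p q P(3) by auto
      then show ?thesis using norm_triangle_ineq4[of p q] by (simp add: dist_norm)
    qed
    then have J: "dist p q \<le> 2 ^ J * r" using D by linarith
    define j where "j = (LEAST j. dist p q \<le> 2 ^ j * r)"
    have j: "dist p q \<le> 2 ^ j * r" unfolding j_def by (rule LeastI[of _ J]) (rule J)
    have jJ: "j \<le> J" unfolding j_def by (rule Least_le) (rule J)
    have "kernel_phi m r (p - q) \<le> 2 ^ m / (2 ^ j) ^ m"
    proof (cases j)
      case 0
      have "kernel_phi m r (p - q) \<le> 1" by simp
      also have "(1 :: real) \<le> 2 ^ m" by simp
      finally show ?thesis using 0 by simp
    next
      case (Suc i)
      then have "\<not> dist p q \<le> 2 ^ i * r" unfolding j_def by (metis lessI not_less_Least)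
      then have i: "2 ^ i * r < norm (p - q)" by (simp add: dist_norm)
      then have ne: "0 < norm (p - q)" using r by (smt (verit) mult_pos_pos zero_less_power)
      have "kernel_phi m r (p - q) \<le> (r / norm (p - q)) ^ m"
        using r ne by (simp add: kernel_phi_power)
      also have "\<dots> \<le> (1 / 2 ^ i) ^ m"
        using i r ne by (intro power_mono) (auto simp: field_simps)
      also have "\<dots> = 2 ^ m / (2 ^ j) ^ m" by (simp add: Suc power_divide power_mult_distrib)
      finally show ?thesis .
    qed
    also have "\<dots> = ?c j q" using j by simp
    also have "\<dots> \<le> (\<Sum>j\<le>J. ?c j q)" by (rule member_le_sum) (use jJ in auto)
    finally show "kernel_phi m r (p - q) \<le> (\<Sum>j\<le>J. ?c j q)" .
  qed
  also have "\<dots> = (\<Sum>j\<le>J. \<Sum>q\<in>P. ?c j q)" by (rule sum.swap)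
  also have "\<dots> \<le> (\<Sum>j\<le>J. (4 * (2 * real m + 4)) ^ m)"
  proof (rule sum_mono)
    fix j
    let ?Pj = "P \<inter> cball p (2 ^ j * r)"
    have "real (card ?Pj) \<le> (2 * real m + 4) ^ m * (2 ^ j * r / (r / 2)) ^ m"
    proof (rule card_separated_subspace(2)[OF V, where x = p])
      have "1 * r \<le> 2 ^ j * r" using r by (intro mult_right_mono) auto
      then show "r / 2 \<le> 2 ^ j * r" using r by linarith
      show "separated (r / 2) ?Pj" using P(4) by (auto simp: separated_def)
    qed (use P r in auto)
    also have "\<dots> = (2 * real m + 4) ^ m * (2 ^ j) ^ m * 2 ^ m"
      using r by (simp add: power_mult_distrib)
    finally have 1: "real (card ?Pj) \<le> (2 * real m + 4) ^ m * (2 ^ j) ^ m * 2 ^ m" .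
    have "(\<Sum>q\<in>P. ?c j q) = 2 ^ m / (2 ^ j) ^ m * real (card ?Pj)"
      unfolding sum_mult_indicator[OF P(1)] by (simp add: cball_def Int_def)
    also have "\<dots> \<le> 2 ^ m / (2 ^ j) ^ m * ((2 * real m + 4) ^ m * (2 ^ j) ^ m * 2 ^ m)"
      by (intro mult_left_mono 1) simp
    also have "\<dots> = (2 * 2 * (2 * real m + 4)) ^ m" unfolding power_mult_distrib by simp
    finally show "(\<Sum>q\<in>P. ?c j q) \<le> (4 * (2 * real m + 4)) ^ m" by simp
  qed
  also have "\<dots> = real (J + 1) * (4 * (2 * real m + 4)) ^ m" by simp
  finally show ?thesis .
qed

text \<open>
  A separated set in the projection is lifted to \<open>E\<close>; the uniform measure on the lift has small
  energy, the logarithm counting the dyadic annuli around a point.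
\<close>
lemma covering_number_proj_le_capacity:
  fixes E V :: "'a::euclidean_space set"
  assumes V: "V \<in> grassmannian m" and E: "bounded E" "E \<noteq> {}"
  obtains C where "0 < C" "\<And>r. 0 < r \<Longrightarrow> r \<le> 1 / 2 \<Longrightarrow>
    real (covering_number r (orth_proj V ` E)) \<le> C * (ln (1 / r) + 1) * capacity m r E"
proof -
  have V: "subspace V" "dim V = m" using V by (auto simp: grassmannian_def)
  obtain D where D: "1 \<le> D" "E \<subseteq> cball 0 D" using bounded_subset_cball_ge[OF E(1)] .
  define K where "K = (4 * (2 * real m + 4)) ^ m"
  \<comment> \<open>Chosen so that \<open>J + 1\<close>, which is at most log 2 (2 D / r) + 2, is
    bounded by L (ln (1 / r) + 1).\<close>
  define L where "L = log 2 (2 * D) + 2 + 1 / ln 2"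
  have K: "K > 0" by (simp add: K_def add_nonneg_pos)
  have logD: "log 2 (2 * D) \<ge> 0" using D by (intro zero_le_log_cancel_iff[THEN iffD2]) auto
  then have L: "L > 0" unfolding L_def by (smt (verit) ln_gt_zero zero_less_divide_1_iff)
  show thesis
  proof (rule that[of "L * K"])
    fix r :: real assume r: "0 < r" "r \<le> 1 / 2"
    define J where "J = nat \<lceil>log 2 (2 * D / r)\<rceil>"
    have arg: "2 * D / r > 0" using D r by simp
    have "log 2 (2 * D / r) \<le> real J" unfolding J_def by linarith
    then have "2 * D / r \<le> 2 ^ J" using arg by (simp add: log_le_iff powr_realpow)
    then have DJ: "2 * D \<le> 2 ^ J * r" using r by (simp add: field_simps)
    have eqlog: "log 2 (2 * D / r) = log 2 (2 * D) + ln (1 / r) / ln 2"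
      using D r by (simp add: log_divide log_def ln_div diff_divide_distrib)
    have lnr: "0 \<le> ln (1 / r)" using r by (intro ln_ge_zero) (simp add: field_simps)
    have "0 \<le> log 2 (2 * D / r)" using eqlog logD lnr by simp
    then have "real J \<le> log 2 (2 * D / r) + 1" unfolding J_def by linarith
    then have "real (J + 1) \<le> log 2 (2 * D) + 2 + ln (1 / r) / ln 2" using eqlog by simp
    also have "\<dots> \<le> L * (ln (1 / r) + 1)"
    proof -
      have "a + y * l \<le> (a + l) * (y + 1)" if "0 \<le> a" "0 \<le> l" "0 \<le> y" for a l y :: real
        using mult_nonneg_nonneg[of a y] that by (simp add: algebra_simps)
      from this[of "log 2 (2 * D) + 2" "1 / ln 2" "ln (1 / r)"] logD lnr
      show ?thesis by (simp add: L_def)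
    qed
    finally have JL: "real (J + 1) \<le> L * (ln (1 / r) + 1)" .
    have sub: "orth_proj V ` E \<subseteq> V" using orth_proj_decomp(1)[OF V(1)] by blast
    have sub': "orth_proj V ` E \<subseteq> cball 0 D"
      using D(2) norm_orth_proj_le(1)[OF V(1)] by (force intro: order_trans)
    obtain P where P: "P \<subseteq> orth_proj V ` E" "finite P" "separated (r / 2) P"
      "\<And>x. x \<in> orth_proj V ` E \<Longrightarrow> \<exists>p\<in>P. dist x p < r / 2"
      using maximal_separated_subspace[OF V _ _ sub sub', of "r / 2"] r D
      by (smt (verit, best) field_sum_of_halves)
    have Pne: "P \<noteq> {}" using P(4) E by blast
    have "covering_number r (orth_proj V ` E) \<le> card ((\<lambda>p. cball p (r / 2)) ` P)"
    proof (rule covering_number_le)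
      show "orth_proj V ` E \<subseteq> \<Union> ((\<lambda>p. cball p (r / 2)) ` P)"
      proof
        fix x assume "x \<in> orth_proj V ` E"
        then obtain p where "p \<in> P" "dist x p < r / 2" using P(4) by blast
        then show "x \<in> \<Union> ((\<lambda>p. cball p (r / 2)) ` P)" by (auto simp: dist_commute intro!: bexI[of _ p])
      qed
    qed (use P r in \<open>auto simp: diameter_cball\<close>)
    also have "\<dots> \<le> card P" using P(2) by (rule card_image_le)
    finally have cov: "covering_number r (orth_proj V ` E) \<le> card P" .
    \<comment> \<open>Projection contracts, so lifting neither decreases distances nor increases the
      kernel: the energy bound for separated points of \<open>V\<close> passes to the lifted
      points.\<close>
    have "\<forall>p\<in>P. \<exists>x. x \<in> E \<and> orth_proj V x = p" using P(1) by auto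
    from bchoice[OF this] obtain e where e: "\<And>p. p \<in> P \<Longrightarrow> e p \<in> E \<and> orth_proj V (e p) = p" by auto
    let ?\<mu> = "distr (measure_pmf (pmf_of_set P)) borel e"
    have "e ` P \<subseteq> closure E" using e closure_subset by blast
    note \<mu> = prob_measures_on_finite[OF P(2) Pne this closed_closure]
    have "(\<Sum>p\<in>P. \<Sum>q\<in>P. kernel_phi m r (e p - e q)) \<le> (\<Sum>p\<in>P. \<Sum>q\<in>P. kernel_phi m r (p - q))"
    proof (intro sum_mono kernel_phi_mono)
      fix p q assume "p \<in> P" "q \<in> P"
      then show "norm (p - q) \<le> norm (e p - e q)"
        using dist_orth_proj_le[OF V(1), of "e p" "e q"] e by (simp add: dist_norm)
    qed (use r in auto)
    also have "\<dots> \<le> (\<Sum>p\<in>P. real (J + 1) * K)"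
      unfolding K_def using P sub sub' r by (intro sum_mono sum_kernel_separated[OF V r(1) _ _ _ _ DJ]) auto
    also have "\<dots> = real (card P) * (real (J + 1) * K)" by simp
    finally have "energy m r ?\<mu> \<le> real (card P) * (real (J + 1) * K) / (real (card P))\<^sup>2"
      unfolding \<mu>(2) by (rule divide_right_mono) simp
    also have "\<dots> = real (J + 1) * K / real (card P)"
      by (simp add: power2_eq_square)
    finally have en: "energy m r ?\<mu> \<le> real (J + 1) * K / real (card P)" .
    have cap: "1 \<le> capacity m r E" by (rule capacity_ge_1[OF E r(1)]) simp
    have cP: "0 < real (card P)" using P Pne by (simp add: card_gt_0_iff)
    have "1 \<le> capacity m r E * energy m r ?\<mu>"
      by (rule capacity_energy_ge_1[OF E r(1) _ \<mu>(1)]) simp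
    also have "\<dots> \<le> capacity m r E * (real (J + 1) * K / real (card P))"
      using en cap by (intro mult_left_mono) auto
    finally have "real (card P) \<le> real (J + 1) * K * capacity m r E" using cP by (simp add: field_simps)
    also have "\<dots> \<le> L * (ln (1 / r) + 1) * K * capacity m r E"
      using JL K cap by (intro mult_right_mono) auto
    finally show "real (covering_number r (orth_proj V ` E)) \<le> L * K * (ln (1 / r) + 1) * capacity m r E"
      using cov by (simp add: mult_ac)
  qed (use K L in simp)
qed

lemma box_dims_proj_le:
  fixes E V :: "'a::euclidean_space set"
  assumes V: "V \<in> grassmannian m" and E: "bounded E" "E \<noteq> {}"
  shows "lower_box_dim (orth_proj V ` E) \<le> lower_box_profile m E"
    and "upper_box_dim (orth_proj V ` E) \<le> upper_box_profile m E"
proof -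
  obtain C where C: "0 < C" "\<And>r. 0 < r \<Longrightarrow> r \<le> 1 / 2 \<Longrightarrow>
    real (covering_number r (orth_proj V ` E)) \<le> C * (ln (1 / r) + 1) * capacity m r E"
    using covering_number_proj_le_capacity[OF V E] by blast
  have bd: "bounded (orth_proj V ` E)"
    using V by (intro bounded_linear_image E bounded_linear_orth_proj) (simp add: grassmannian_def)
  have ev: "0 < real (covering_number r (orth_proj V ` E)) \<and> 0 < capacity m r E \<and> 0 < C * (ln (1 / r) + 1) \<and>
      real (covering_number r (orth_proj V ` E)) \<le> C * (ln (1 / r) + 1) * capacity m r E"
    if r: "0 < r" "r \<le> 1 / 2" for r
  proof -
    have "0 \<le> ln (1 / r)" using r by (intro ln_ge_zero) (simp add: field_simps)
    moreover have "1 \<le> capacity m r E" by (rule capacity_ge_1[OF E r(1)]) simp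
    ultimately show ?thesis using C(1) C(2)[OF r] covering_number_pos[OF bd _ r(1)] E(2) by auto
  qed
  have lim: "((\<lambda>r. ln (C * (ln (1 / r) + 1)) / - ln r) \<longlongrightarrow> 0) (at_right 0)"
    using C(1) by real_asymp
  show "lower_box_dim (orth_proj V ` E) \<le> lower_box_profile m E"
    "upper_box_dim (orth_proj V ` E) \<le> upper_box_profile m E"
    unfolding lower_box_dim_def lower_box_profile_def upper_box_dim_def upper_box_profile_def
    using Liminf_Limsup_log_ratio_le[OF ev lim] by blast+
qed

text \<open>The cover splits the unit mass of \<mu> into \<open>card F\<close> parts, so by
  Cauchy--Schwarz the squares of the parts sum to at least 1 / \<open>card F\<close>. These squares
  are the masses of disjoint sets of pairs whose projections are at most \<open>r\<close>
  apart.\<close>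

lemma card_cover_proj_ge:
  fixes E V :: "'a::euclidean_space set"
  assumes V: "subspace V" and \<mu>: "\<mu> \<in> prob_measures_on (closure E)"
    and F: "finite F" "\<And>U. U \<in> F \<Longrightarrow> bounded U" "\<And>U. U \<in> F \<Longrightarrow> diameter U \<le> r" "orth_proj V ` E \<subseteq> \<Union>F"
  shows "1 \<le> real (card F) * measure (\<mu> \<Otimes>\<^sub>M \<mu>) {z. norm (orth_proj V (fst z - snd z)) \<le> r}"
proof -
  note \<mu>D = prob_measures_onD[OF \<mu>]
  interpret M: prob_space \<mu> by (rule \<mu>D)
  interpret MM: pair_prob_space \<mu> \<mu> ..
  let ?S = "{z :: 'a \<times> 'a. norm (orth_proj V (fst z - snd z)) \<le> r}"
  have sets2: "sets (\<mu> \<Otimes>\<^sub>M \<mu>) = sets borel"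
    using sets_pair_measure_cong[OF \<mu>D(2) \<mu>D(2)] unfolding borel_prod .
  have "continuous_on UNIV (\<lambda>z :: 'a \<times> 'a. norm (orth_proj V (fst z - snd z)))"
    by (intro continuous_on_norm continuous_on_compose2[OF continuous_orth_proj[OF V, of UNIV]] continuous_intros) auto
  then have "closed ?S" by (intro closed_Collect_le) auto
  then have S: "?S \<in> sets (\<mu> \<Otimes>\<^sub>M \<mu>)" by (simp add: sets2)
  define N where "N = card F"
  obtain A where A: "bij_betw A {0..<N} F" using ex_bij_betw_nat_finite[OF F(1)] unfolding N_def by blast
  have AF: "A i \<in> F" if "i < N" for i using A that by (auto simp: bij_betw_def)
  \<comment> \<open>\<mu> lives on the closure of \<open>E\<close>, hence the closures of the
    covering sets, which keep their diameters; \<open>disjointed\<close> then separates the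
    parts.\<close>
  define B where "B i = (if i < N then orth_proj V -` closure (A i) else {})" for i
  have Bcl: "closed (B i)" for i
    using continuous_closed_vimage[OF closed_closure, of "orth_proj V"] continuous_orth_proj[OF V, of UNIV]
    by (simp add: B_def continuous_on_eq_continuous_at)
  have "range B \<subseteq> sets \<mu>" using Bcl by (auto simp: \<mu>D(2))
  then have Dsets: "range (disjointed B) \<subseteq> sets \<mu>" by (rule sets.range_disjointed_sets)
  then have Ds: "disjointed B i \<in> sets \<mu>" for i by blast
  have disj: "disjoint_family_on (disjointed B) {..<N}"
    using disjoint_family_disjointed by (rule disjoint_family_on_mono[rotated]) simp
  have Usub: "closure E \<subseteq> (\<Union>i<N. disjointed B i)"
  proof -
    have "E \<subseteq> (\<Union>i<N. B i)"
    proof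
      fix x assume "x \<in> E"
      then obtain U where U: "U \<in> F" "orth_proj V x \<in> U" using F(4) by blast
      then obtain i where "i < N" "A i = U" using A unfolding bij_betw_def by (metis atLeastLessThan_iff imageE)
      then show "x \<in> (\<Union>i<N. B i)" using U closure_subset[of U] by (auto simp: B_def)
    qed
    then have "closure E \<subseteq> (\<Union>i<N. B i)" by (rule closure_minimal) (simp add: Bcl closed_UN)
    then show ?thesis using finite_UN_disjointed_eq[of B N]
      by (simp add: lessThan_atLeast0)
  qed
  have "1 = measure \<mu> (\<Union>i<N. disjointed B i)"
  proof -
    have "measure \<mu> (closure E) = 1"
    proof -
      have "closure E \<in> sets \<mu>" by (simp add: \<mu>D(2))
      moreover have "space \<mu> - closure E = - closure E" using sets_eq_imp_space_eq[OF \<mu>D(2)] by auto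
      then have "measure \<mu> (space \<mu> - closure E) = 0" using \<mu>D(3) by (simp add: measure_def)
      ultimately show ?thesis using M.prob_compl[of "closure E"] by simp
    qed
    moreover have "measure \<mu> (closure E) \<le> measure \<mu> (\<Union>i<N. disjointed B i)"
      using Usub Ds by (intro M.finite_measure_mono) auto
    moreover have "measure \<mu> (\<Union>i<N. disjointed B i) \<le> 1" by (rule M.prob_le_1)
    ultimately show ?thesis by linarith
  qed
  also have "\<dots> = (\<Sum>i<N. measure \<mu> (disjointed B i))"
    using Dsets disj by (intro M.finite_measure_finite_Union) auto
  finally have sum1: "(\<Sum>i<N. measure \<mu> (disjointed B i)) = 1" by simp
  have "(\<Sum>i<N. (measure \<mu> (disjointed B i))\<^sup>2) = (\<Sum>i<N. measure (\<mu> \<Otimes>\<^sub>M \<mu>) (disjointed B i \<times> disjointed B i))"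
    by (intro sum.cong refl)
      (simp add: measure_def M.emeasure_pair_measure_Times Ds enn2real_mult power2_eq_square)
  also have "\<dots> = measure (\<mu> \<Otimes>\<^sub>M \<mu>) (\<Union>i<N. disjointed B i \<times> disjointed B i)"
  proof (rule MM.P.finite_measure_finite_Union[symmetric])
    show "disjoint_family_on (\<lambda>i. disjointed B i \<times> disjointed B i) {..<N}"
      using disj unfolding disjoint_family_on_def by blast
  qed (use Ds in auto)
  also have "\<dots> \<le> measure (\<mu> \<Otimes>\<^sub>M \<mu>) ?S"
  proof (rule MM.P.finite_measure_mono[OF _ S], clarsimp)
    fix x y i assume i: "i < N" "x \<in> disjointed B i" "y \<in> disjointed B i"
    then have xy: "orth_proj V x \<in> closure (A i)" "orth_proj V y \<in> closure (A i)"
      using disjointed_subset[of B i] by (auto simp: B_def split: if_splits)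
    have "dist (orth_proj V x) (orth_proj V y) \<le> diameter (closure (A i))"
      using F(2)[OF AF[OF i(1)]] xy by (intro diameter_bounded_bound bounded_closure) auto
    also have "\<dots> = diameter (A i)" using F(2)[OF AF[OF i(1)]] by (rule diameter_closure)
    also have "\<dots> \<le> r" using F(3)[OF AF[OF i(1)]] .
    finally show "norm (orth_proj V (x - y)) \<le> r" by (simp add: dist_orth_proj[OF V])
  qed
  finally have le: "(\<Sum>i<N. (measure \<mu> (disjointed B i))\<^sup>2) \<le> measure (\<mu> \<Otimes>\<^sub>M \<mu>) ?S" .
  have "1 = (\<Sum>i<N. measure \<mu> (disjointed B i))\<^sup>2" using sum1 by simp
  also have "\<dots> \<le> (\<Sum>i<N. (measure \<mu> (disjointed B i))\<^sup>2) * real (card {..<N})"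
    by (rule sum_squared_le_sum_of_squares)
  also have "\<dots> \<le> measure (\<mu> \<Otimes>\<^sub>M \<mu>) ?S * real N"
    using le by (intro mult_mono) auto
  finally show ?thesis by (simp add: N_def mult.commute)
qed

lemma measurable_slab_indicator:
  assumes \<gamma>: "grassmann_measure m \<gamma>" and P: "sets P = sets (borel \<Otimes>\<^sub>M borel)"
  shows "(\<lambda>(V, z). indicator {z. norm (orth_proj V (fst z - snd z)) \<le> r} z :: ennreal) \<in> borel_measurable (\<gamma> \<Otimes>\<^sub>M P)"
proof -
  note P[measurable_cong]
  let ?f = "\<lambda>w. norm (orth_proj (fst w) (fst (snd w) - snd (snd w)))"
  have "(\<lambda>w. (fst w, fst (snd w) - snd (snd w))) \<in> measurable (\<gamma> \<Otimes>\<^sub>M P) (\<gamma> \<Otimes>\<^sub>M borel)"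
    by measurable
  from measurable_compose[OF this measurable_orth_proj_pair[OF \<gamma>]]
  have "?f \<in> borel_measurable (\<gamma> \<Otimes>\<^sub>M P)" by simp
  then have "{w \<in> space (\<gamma> \<Otimes>\<^sub>M P). ?f w \<le> r} \<in> sets (\<gamma> \<Otimes>\<^sub>M P)"
    by (rule borel_measurable_le) simp
  then have "indicator {w \<in> space (\<gamma> \<Otimes>\<^sub>M P). ?f w \<le> r} \<in> borel_measurable (\<gamma> \<Otimes>\<^sub>M P)"
    by (rule borel_measurable_indicator)
  then show ?thesis
    by (rule measurable_cong[THEN iffD1, rotated]) (auto simp: indicator_def)
qed

text \<open>Fubini's theorem: for a fixed pair of points the integral over \<open>V\<close> is the
  measure of a slab, which the hypothesis bounds by the kernel of their difference.\<close>

lemma slab_measure_average: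
  fixes \<gamma> :: "(real ^ 'n) set measure" and \<mu> :: "(real ^ 'n) measure"
  assumes \<gamma>: "grassmann_measure m \<gamma>" and \<mu>: "prob_space \<mu>" "sets \<mu> = sets borel"
    and C: "\<And>x. emeasure \<gamma> {V \<in> space \<gamma>. norm (orth_proj V x) \<le> r} \<le> ennreal (C * kernel_phi m r x)"
    and C0: "0 \<le> C"
  defines "G \<equiv> \<lambda>V. emeasure (\<mu> \<Otimes>\<^sub>M \<mu>) {z. norm (orth_proj V (fst z - snd z)) \<le> r}"
  shows "G \<in> borel_measurable \<gamma>" and "(\<integral>\<^sup>+V. G V \<partial>\<gamma>) \<le> ennreal (C * energy m r \<mu>)"
proof -
  interpret G: prob_space \<gamma> using \<gamma> by (simp add: grassmann_measure_def)
  interpret M: prob_space \<mu> by fact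
  interpret MM: pair_prob_space \<mu> \<mu> ..
  interpret GM: pair_sigma_finite \<gamma> "\<mu> \<Otimes>\<^sub>M \<mu>" ..
  have sets: "sets (\<mu> \<Otimes>\<^sub>M \<mu>) = sets (borel \<Otimes>\<^sub>M borel)"
    by (intro sets_pair_measure_cong \<mu>)
  note ind = measurable_slab_indicator[OF \<gamma> sets, of r]
  have space2: "space (\<mu> \<Otimes>\<^sub>M \<mu>) = UNIV"
    using sets_eq_imp_space_eq[OF sets] by (simp add: space_pair_measure)
  have S: "{z. norm (orth_proj V (fst z - snd z)) \<le> r} \<in> sets (\<mu> \<Otimes>\<^sub>M \<mu>)" if V: "V \<in> space \<gamma>" for V
  proof -
    have "(indicator {z. norm (orth_proj V (fst z - snd z)) \<le> r} :: _ \<Rightarrow> ennreal) \<in> borel_measurable (\<mu> \<Otimes>\<^sub>M \<mu>)"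
      using measurable_Pair2[OF ind V] by simp
    then show ?thesis unfolding borel_measurable_indicator_iff space2 by simp
  qed
  have Geq: "G V = (\<integral>\<^sup>+z. indicator {z. norm (orth_proj V (fst z - snd z)) \<le> r} z \<partial>(\<mu> \<Otimes>\<^sub>M \<mu>))"
    if "V \<in> space \<gamma>" for V unfolding G_def by (rule nn_integral_indicator[symmetric]) (rule S[OF that])
  have "(\<lambda>V. \<integral>\<^sup>+z. indicator {z. norm (orth_proj V (fst z - snd z)) \<le> r} z \<partial>(\<mu> \<Otimes>\<^sub>M \<mu>)) \<in> borel_measurable \<gamma>"
    using MM.P.borel_measurable_nn_integral[OF ind] .
  then show "G \<in> borel_measurable \<gamma>" by (subst measurable_cong[OF Geq])
  have "(\<integral>\<^sup>+V. G V \<partial>\<gamma>) = (\<integral>\<^sup>+V. \<integral>\<^sup>+z. indicator {z. norm (orth_proj V (fst z - snd z)) \<le> r} z \<partial>(\<mu> \<Otimes>\<^sub>M \<mu>) \<partial>\<gamma>)"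
    by (rule nn_integral_cong) (rule Geq)
  also have "\<dots> = (\<integral>\<^sup>+z. \<integral>\<^sup>+V. indicator {z. norm (orth_proj V (fst z - snd z)) \<le> r} z \<partial>\<gamma> \<partial>(\<mu> \<Otimes>\<^sub>M \<mu>))"
    by (rule GM.Fubini'[OF ind, symmetric])
  also have "\<dots> \<le> (\<integral>\<^sup>+z. ennreal (C * kernel_phi m r (fst z - snd z)) \<partial>(\<mu> \<Otimes>\<^sub>M \<mu>))"
  proof (rule nn_integral_mono)
    fix z :: "(real ^ 'n) \<times> (real ^ 'n)"
    have [measurable]: "(\<lambda>V. orth_proj V (fst z - snd z)) \<in> borel_measurable \<gamma>" by (rule measurable_orth_proj[OF \<gamma>])
    have "(\<integral>\<^sup>+V. indicator {z. norm (orth_proj V (fst z - snd z)) \<le> r} z \<partial>\<gamma>)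
        = (\<integral>\<^sup>+V. indicator {V \<in> space \<gamma>. norm (orth_proj V (fst z - snd z)) \<le> r} V \<partial>\<gamma>)"
      by (rule nn_integral_cong) (auto simp: indicator_def)
    also have "\<dots> = emeasure \<gamma> {V \<in> space \<gamma>. norm (orth_proj V (fst z - snd z)) \<le> r}"
      by (rule nn_integral_indicator) measurable
    also have "\<dots> \<le> ennreal (C * kernel_phi m r (fst z - snd z))" by (rule C)
    finally show "(\<integral>\<^sup>+V. indicator {z. norm (orth_proj V (fst z - snd z)) \<le> r} z \<partial>\<gamma>)
      \<le> ennreal (C * kernel_phi m r (fst z - snd z))" .
  qed
  also have "\<dots> = ennreal C * (\<integral>\<^sup>+z. ennreal (kernel_phi m r (fst z - snd z)) \<partial>(\<mu> \<Otimes>\<^sub>M \<mu>))"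
  proof -
    note sets[measurable_cong]
    show ?thesis using C0 by (simp add: ennreal_mult nn_integral_cmult)
  qed
  also have "(\<integral>\<^sup>+z. ennreal (kernel_phi m r (fst z - snd z)) \<partial>(\<mu> \<Otimes>\<^sub>M \<mu>))
      = (\<integral>\<^sup>+x. \<integral>\<^sup>+y. ennreal (kernel_phi m r (x - y)) \<partial>\<mu> \<partial>\<mu>)"
  proof -
    note sets[measurable_cong]
    have "(\<lambda>z. ennreal (kernel_phi m r (fst z - snd z))) \<in> borel_measurable (\<mu> \<Otimes>\<^sub>M \<mu>)" by measurable
    from M.nn_integral_fst[OF this] show ?thesis by simp
  qed
  also have "\<dots> = ennreal (energy m r \<mu>)" by (rule energy_nn_integral(1)[OF \<mu>, symmetric])
  also have "ennreal C * ennreal (energy m r \<mu>) = ennreal (C * energy m r \<mu>)"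
    using C0 energy_nonneg[of "real m" r \<mu>] by (simp add: ennreal_mult)
  finally show "(\<integral>\<^sup>+V. G V \<partial>\<gamma>) \<le> ennreal (C * energy m r \<mu>)" .
qed

text \<open>Borel--Cantelli in integrated form. As \<open>\<mu> k\<close> is nearly optimal at its
  scale, \<open>c k * G k\<close> has integral at most 2 \<open>C\<close>, so the weighted sum
  \<open>H\<close> has finite integral. Where \<open>H V\<close> is finite,
  \<open>c k * G k V\<close> is at most a constant times (k + 1)^2 at all scales at once, and the
  covering number is at least 1 / \<open>G k V\<close>. Counting from \<open>Suc k\<close> keeps the
  weights finite.\<close>

lemma capacity_le_covering_number_AE:
  fixes \<gamma> :: "(real ^ 'n) set measure" and E :: "(real ^ 'n) set"
  assumes \<gamma>: "grassmann_measure m \<gamma>" and n: "2 \<le> CARD('n)" and E: "bounded E" "E \<noteq> {}"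
  shows "AE V in \<gamma>. \<exists>S>0. \<forall>k. capacity m ((1 / 2) ^ Suc k) E
    \<le> S * (real (Suc k))\<^sup>2 * real (covering_number ((1 / 2) ^ Suc k) (orth_proj V ` E))"
proof -
  define r where "r k = (1 / 2 :: real) ^ Suc k" for k
  have r: "0 < r k" for k by (simp add: r_def)
  define c where "c k = capacity m (r k) E" for k
  have c: "1 \<le> c k" for k unfolding c_def by (rule capacity_ge_1[OF E r]) simp
  obtain C where C: "1 \<le> C" "\<And>x \<rho>. 0 < \<rho> \<Longrightarrow>
      emeasure \<gamma> {V \<in> space \<gamma>. norm (orth_proj V x) \<le> \<rho>} \<le> ennreal (C * kernel_phi m \<rho> x)"
    using grassmann_slab[OF \<gamma> n] by blast
  have "\<exists>\<mu>. \<mu> \<in> prob_measures_on (closure E) \<and> energy m (r k) \<mu> \<le> 2 / c k" for k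
    using near_optimal_energy[OF E r[of k], of m] unfolding c_def by (metis of_nat_0_le_iff)
  then obtain \<mu> where \<mu>: "\<And>k. \<mu> k \<in> prob_measures_on (closure E)" "\<And>k. energy m (r k) (\<mu> k) \<le> 2 / c k"
    by metis
  define G where "G k V = emeasure (\<mu> k \<Otimes>\<^sub>M \<mu> k) {z. norm (orth_proj V (fst z - snd z)) \<le> r k}" for k V
  have Gm: "G k \<in> borel_measurable \<gamma>" and Gi: "(\<integral>\<^sup>+V. G k V \<partial>\<gamma>) \<le> ennreal (C * energy m (r k) (\<mu> k))" for k
    unfolding G_def using slab_measure_average[OF \<gamma> prob_measures_onD(1,2)[OF \<mu>(1)[of k]] C(2)[OF r[of k]]] C(1)
    by simp_all
  define H where "H V = (\<Sum>k. ennreal (c k / (real (Suc k))\<^sup>2) * G k V)" for V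
  have Hm: "H \<in> borel_measurable \<gamma>" unfolding H_def using Gm by measurable
  have "(\<integral>\<^sup>+V. H V \<partial>\<gamma>) = (\<Sum>k. \<integral>\<^sup>+V. ennreal (c k / (real (Suc k))\<^sup>2) * G k V \<partial>\<gamma>)"
    unfolding H_def using Gm by (intro nn_integral_suminf) measurable
  also have "\<dots> = (\<Sum>k. ennreal (c k / (real (Suc k))\<^sup>2) * (\<integral>\<^sup>+V. G k V \<partial>\<gamma>))"
    using Gm by (simp add: nn_integral_cmult)
  also have "\<dots> \<le> (\<Sum>k. ennreal (2 * C * (1 / (real (Suc k))\<^sup>2)))"
  proof (intro suminf_le allI)
    fix k
    have "ennreal (c k / (real (Suc k))\<^sup>2) * (\<integral>\<^sup>+V. G k V \<partial>\<gamma>)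
      \<le> ennreal (c k / (real (Suc k))\<^sup>2) * ennreal (C * energy m (r k) (\<mu> k))"
      by (intro mult_left_mono Gi) simp
    also have "\<dots> = ennreal (c k / (real (Suc k))\<^sup>2 * (C * energy m (r k) (\<mu> k)))"
      using c[of k] by (intro ennreal_mult[symmetric]) (auto intro!: mult_nonneg_nonneg energy_nonneg simp: C(1) order_trans[OF zero_le_one C(1)])
    also have "\<dots> \<le> ennreal (c k / (real (Suc k))\<^sup>2 * (C * (2 / c k)))"
      using c[of k] C(1) \<mu>(2)[of k] by (intro ennreal_leI mult_left_mono) auto
    also have "c k / (real (Suc k))\<^sup>2 * (C * (2 / c k)) = 2 * C * (1 / (real (Suc k))\<^sup>2)"
      using c[of k] by (simp add: field_simps)
    finally show "ennreal (c k / (real (Suc k))\<^sup>2) * (\<integral>\<^sup>+V. G k V \<partial>\<gamma>) \<le> ennreal (2 * C * (1 / (real (Suc k))\<^sup>2))" .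
  qed auto
  also have "\<dots> < \<infinity>"
  proof -
    have "summable (\<lambda>k. 1 / (real (Suc k))\<^sup>2)"
      using inverse_power_summable[of 2, where 'a = real] unfolding summable_Suc_iff[symmetric, of "\<lambda>n. inverse (real n ^ 2)"]
      by (simp add: inverse_eq_divide)
    then have "summable (\<lambda>k. 2 * C * (1 / (real (Suc k))\<^sup>2))" by (rule summable_mult)
    then show ?thesis using C(1) by (subst suminf_ennreal2) auto
  qed
  finally have "(\<integral>\<^sup>+V. H V \<partial>\<gamma>) \<noteq> \<infinity>" by simp
  then have "AE V in \<gamma>. H V \<noteq> \<infinity>" by (rule nn_integral_PInf_AE[OF Hm])
  moreover have "AE V in \<gamma>. V \<in> space \<gamma>" by simp
  ultimately show ?thesis
  proof eventually_elim
    case (elim V)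
    then have V: "subspace V" by (simp add: space_grassmann_measure[OF \<gamma>] grassmannian_def)
    have bd: "bounded (orth_proj V ` E)" by (intro bounded_linear_image E bounded_linear_orth_proj V)
    \<comment> \<open>The summand 1 keeps \<open>S\<close> positive, since its logarithm will be
      taken.\<close>
    define S where "S = enn2real (H V) + 1"
    have S: "0 < S" by (simp add: S_def add_nonneg_pos)
    have "c k \<le> S * (real (Suc k))\<^sup>2 * real (covering_number (r k) (orth_proj V ` E))" for k
    proof -
      note \<mu>D = prob_measures_onD[OF \<mu>(1)[of k]]
      interpret M: prob_space "\<mu> k" by (rule \<mu>D)
      interpret MM: pair_prob_space "\<mu> k" "\<mu> k" ..
      let ?g = "measure (\<mu> k \<Otimes>\<^sub>M \<mu> k) {z. norm (orth_proj V (fst z - snd z)) \<le> r k}"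
      let ?N = "real (covering_number (r k) (orth_proj V ` E))"
      have Gg: "G k V = ennreal ?g" unfolding G_def by (rule MM.P.emeasure_eq_measure)
      have "ennreal (c k / (real (Suc k))\<^sup>2) * G k V \<le> H V"
        unfolding H_def using sum_le_suminf[of "\<lambda>k. ennreal (c k / (real (Suc k))\<^sup>2) * G k V" "{k}"] by simp
      also have "H V \<le> ennreal S"
      proof -
        have "H V = ennreal (enn2real (H V))" using elim(1) by (simp add: less_top)
        also have "\<dots> \<le> ennreal S" by (intro ennreal_leI) (simp add: S_def)
        finally show ?thesis .
      qed
      finally have "ennreal (c k / (real (Suc k))\<^sup>2 * ?g) \<le> ennreal S"
        using c[of k] unfolding Gg by (subst ennreal_mult) auto
      then have 1: "c k / (real (Suc k))\<^sup>2 * ?g \<le> S" using S by (simp add: ennreal_le_iff)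
      obtain F where F: "finite F" "card F = covering_number (r k) (orth_proj V ` E)"
        "\<And>U. U \<in> F \<Longrightarrow> bounded U" "\<And>U. U \<in> F \<Longrightarrow> diameter U = r k" "orth_proj V ` E \<subseteq> \<Union>F"
        using covering_number_obtain[OF bd r[of k]] by metis
      have 2: "1 \<le> ?N * ?g"
        using card_cover_proj_ge[OF V \<mu>(1)[of k] F(1,3) _ F(5), of "r k"] F(2,4) by simp
      have "c k / (real (Suc k))\<^sup>2 * 1 \<le> c k / (real (Suc k))\<^sup>2 * (?N * ?g)"
        using 2 c[of k] by (intro mult_left_mono) auto
      also have "\<dots> = (c k / (real (Suc k))\<^sup>2 * ?g) * ?N" by simp
      also have "\<dots> \<le> S * ?N" using 1 by (intro mult_right_mono) auto
      finally show ?thesis by (simp add: field_simps)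
    qed
    then show ?case using S unfolding c_def r_def by blast
  qed
qed

lemma box_dims_proj_ge_AE:
  fixes \<gamma> :: "(real ^ 'n) set measure" and E :: "(real ^ 'n) set"
  assumes \<gamma>: "grassmann_measure m \<gamma>" and n: "2 \<le> CARD('n)" and E: "bounded E" "E \<noteq> {}"
  shows "AE V in \<gamma>. lower_box_profile m E \<le> lower_box_dim (orth_proj V ` E)
    \<and> upper_box_profile m E \<le> upper_box_dim (orth_proj V ` E)"
proof -
  have "AE V in \<gamma>. V \<in> space \<gamma>" by simp
  with capacity_le_covering_number_AE[OF assms] show ?thesis
  proof eventually_elim
    case (elim V)
    then have V: "subspace V" by (simp add: space_grassmann_measure[OF \<gamma>] grassmannian_def)
    have bd: "bounded (orth_proj V ` E)" by (intro bounded_linear_image E bounded_linear_orth_proj V)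
    have ne: "orth_proj V ` E \<noteq> {}" using E by simp
    obtain S where S: "0 < S" "\<And>k. capacity m ((1 / 2) ^ Suc k) E
      \<le> S * (real (Suc k))\<^sup>2 * real (covering_number ((1 / 2) ^ Suc k) (orth_proj V ` E))"
      using elim(1) by blast
    define L where "L = 2 ^ m * S / (ln 2)\<^sup>2"
    have L: "0 < L" using S by (simp add: L_def)
    have ev: "0 < capacity m r E \<and> 0 < real (covering_number r (orth_proj V ` E)) \<and> 0 < L * (1 + (ln (1 / r))\<^sup>2) \<and>
      capacity m r E \<le> L * (1 + (ln (1 / r))\<^sup>2) * real (covering_number r (orth_proj V ` E))"
      if r: "0 < r" "r \<le> 1 / 2" for r
    proof -
      \<comment> \<open>2^-(j + 1) \<le> r \<le> 2^-j: the capacity is estimated at the finer scale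
        and doubled back, the covering number by monotonicity. \<open>r \<le> 1 / 2\<close> ensures
        j \<ge> 1, where the dyadic estimate starts.\<close>
      define j where "j = nat \<lfloor>log 2 (1 / r)\<rfloor>"
      have "1 = log 2 (1 / (1 / 2))" by simp
      also have "\<dots> \<le> log 2 (1 / r)" using r by (intro log_mono) (auto simp: field_simps)
      finally have lg: "1 \<le> log 2 (1 / r)" .
      then have j: "1 \<le> j" "real j \<le> log 2 (1 / r)" "log 2 (1 / r) \<le> real (Suc j)" unfolding j_def by linarith+
      obtain k where k: "j = Suc k" using j(1) by (cases j) auto
      have "2 ^ j \<le> 1 / r" using j(2) r by (simp add: le_log_iff powr_realpow)
      then have up: "r \<le> (1 / 2) ^ j" using r by (simp add: field_simps power_one_over)
      have "1 / r \<le> 2 ^ Suc j" using j(3) r by (simp add: log_le_iff powr_realpow del: of_nat_Suc power_Suc)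
      then have low: "(1 / 2) ^ Suc j \<le> r" using r by (simp add: field_simps power_one_over)
      let ?N = "\<lambda>r. real (covering_number r (orth_proj V ` E))"
      have "capacity m r E \<le> capacity m ((1 / 2) ^ Suc j) E"
        using low by (intro capacity_antimono[OF E]) auto
      also have "\<dots> \<le> 2 powr m * capacity m (2 * (1 / 2) ^ Suc j) E"
        by (intro capacity_double[OF E]) auto
      also have "\<dots> = 2 ^ m * capacity m ((1 / 2) ^ j) E" by (simp add: powr_realpow)
      also have "\<dots> \<le> 2 ^ m * (S * (real j)\<^sup>2 * ?N ((1 / 2) ^ j))"
        using S(2)[of k] unfolding k by (intro mult_left_mono) auto
      also have "\<dots> \<le> 2 ^ m * (S * ((ln (1 / r))\<^sup>2 / (ln 2)\<^sup>2) * ?N r)"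
      proof (intro mult_left_mono mult_mono)
        show "?N ((1 / 2) ^ j) \<le> ?N r" using covering_number_antimono[OF bd r(1) up] by simp
        have "(real j)\<^sup>2 \<le> (log 2 (1 / r))\<^sup>2" using j(2) by (intro power_mono) auto
        then show "(real j)\<^sup>2 \<le> (ln (1 / r))\<^sup>2 / (ln 2)\<^sup>2" by (simp add: log_def power_divide)
      qed (use S in auto)
      also have "\<dots> = L * (ln (1 / r))\<^sup>2 * ?N r" by (simp add: L_def)
      also have "\<dots> \<le> L * (1 + (ln (1 / r))\<^sup>2) * ?N r" using L by (intro mult_right_mono mult_left_mono) auto
      finally have "capacity m r E \<le> L * (1 + (ln (1 / r))\<^sup>2) * ?N r" .
      moreover have "1 \<le> capacity m r E" by (rule capacity_ge_1[OF E r(1)]) simp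
      moreover have "0 < L * (1 + (ln (1 / r))\<^sup>2)" using L by (intro mult_pos_pos) (auto simp: add_pos_nonneg)
      ultimately show ?thesis using covering_number_pos[OF bd ne r(1)] by simp
    qed
    have lim: "((\<lambda>r. ln (L * (1 + (ln (1 / r))\<^sup>2)) / - ln r) \<longlongrightarrow> 0) (at_right 0)"
      using L by real_asymp
    show ?case
      unfolding lower_box_dim_def lower_box_profile_def upper_box_dim_def upper_box_profile_def
      using Liminf_Limsup_log_ratio_le[OF ev lim] by blast
  qed
qed

lemma upper_box_dim_mono:
  fixes E F :: "'a::euclidean_space set"
  assumes "E \<subseteq> F" "bounded F" "E \<noteq> {}"
  shows "upper_box_dim E \<le> upper_box_dim F"
proof -
  have "\<forall>\<^sub>F r in at_right (0 :: real). r \<in> {0<..<1}" by (rule eventually_at_right_real) simp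
  then have "\<forall>\<^sub>F r in at_right 0. ereal (ln (real (covering_number r E)) / - ln r)
      \<le> ereal (ln (real (covering_number r F)) / - ln r)"
  proof eventually_elim
    case (elim r)
    then have r: "0 < r" "- ln r > 0" by auto
    obtain G where G: "finite G" "card G = covering_number r F"
      "\<And>U. U \<in> G \<Longrightarrow> bounded U" "\<And>U. U \<in> G \<Longrightarrow> diameter U = r" "F \<subseteq> \<Union>G"
      using covering_number_obtain[OF assms(2) r(1)] by metis
    have "covering_number r E \<le> card G" using G assms(1) r by (intro covering_number_le) auto
    moreover have "0 < covering_number r E"
      using assms r by (intro covering_number_pos) (auto intro: bounded_subset)
    ultimately have "ln (real (covering_number r E)) \<le> ln (real (covering_number r F))" using G(2) by simp
    then have "ln (real (covering_number r E)) / - ln r \<le> ln (real (covering_number r F)) / - ln r"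
      by (rule divide_right_mono) (use r in simp)
    then show ?case by simp
  qed
  then show ?thesis unfolding upper_box_dim_def by (rule Limsup_mono)
qed

text \<open>Taking closures of the covering sets keeps their diameters. The Baire argument places
  projections only in the closures of the members of a cover.\<close>

lemma upper_box_dim_closure:
  fixes F :: "'a::euclidean_space set"
  assumes F: "bounded F"
  shows "upper_box_dim (closure F) = upper_box_dim F"
proof -
  have "covering_number r (closure F) = covering_number r F" if r: "0 < r" for r
  proof (rule antisym)
    obtain G where G: "finite G" "card G = covering_number r F"
      "\<And>U. U \<in> G \<Longrightarrow> bounded U" "\<And>U. U \<in> G \<Longrightarrow> diameter U = r" "F \<subseteq> \<Union>G"
      using covering_number_obtain[OF F r] by metis
    have "covering_number r (closure F) \<le> card (closure ` G)"
    proof (rule covering_number_le[OF _ _ _ r])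
      have "F \<subseteq> \<Union>(closure ` G)"
      proof
        fix x assume "x \<in> F"
        then obtain U where "U \<in> G" "x \<in> U" using G(5) by blast
        then show "x \<in> \<Union>(closure ` G)" using closure_subset[of U] by blast
      qed
      then show "closure F \<subseteq> \<Union>(closure ` G)"
        by (rule closure_minimal) (use G(1) in auto)
      fix U assume "U \<in> closure ` G"
      then show "bounded U \<and> diameter U \<le> r" using G(3,4) by (auto simp: diameter_closure)
    qed (use G in auto)
    also have "\<dots> \<le> card G" using G(1) by (rule card_image_le)
    finally show "covering_number r (closure F) \<le> covering_number r F" using G(2) by simp
    obtain G where G: "finite G" "card G = covering_number r (closure F)"
      "\<And>U. U \<in> G \<Longrightarrow> bounded U" "\<And>U. U \<in> G \<Longrightarrow> diameter U = r" "closure F \<subseteq> \<Union>G"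
      using covering_number_obtain[OF bounded_closure[OF F] r] by metis
    have "covering_number r F \<le> card G"
      using G closure_subset[of F] r by (intro covering_number_le) auto
    then show "covering_number r F \<le> covering_number r (closure F)" using G(2) by simp
  qed
  then have "\<forall>\<^sub>F r in at_right (0 :: real). covering_number r (closure F) = covering_number r F"
    using eventually_at_right_less[of "0 :: real"] by (auto elim: eventually_mono)
  then show ?thesis unfolding upper_box_dim_def by (intro Limsup_eq) (auto elim: eventually_mono)
qed


section \<open>Analytic sets and packing dimension\<close>

text \<open>
  Real instead of natural sequences serve as parameters, which makes the product a complete metric
  space.
\<close>
definition analytic :: "'a::topological_space set \<Rightarrow> bool"
  where "analytic A \<longleftrightarrow> (\<exists>D :: ('a \<times> (nat \<Rightarrow> real)) set. closed D \<and> A = fst ` D)"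

lemma analytic_closed:
  assumes "closed C" shows "analytic C"
  unfolding analytic_def
proof (intro exI conjI)
  show "closed (C \<times> (UNIV :: (nat \<Rightarrow> real) set))" using assms by (intro closed_Times) auto
qed simp

lemma continuous_on_snd_coordinate:
  "continuous_on S (\<lambda>z :: 'a::topological_space \<times> (nat \<Rightarrow> real). snd z k)"
  by (rule continuous_on_compose2[OF continuous_on_product_coordinates[of k] continuous_on_snd[OF continuous_on_id]]) simp

lemma continuous_on_reindex:
  "continuous_on UNIV (\<lambda>z :: 'a::topological_space \<times> (nat \<Rightarrow> real). (fst z, \<lambda>k. snd z (h k)))"
proof (intro continuous_on_Pair continuous_on_fst continuous_on_id continuous_on_coordinatewise_then_product)
  fix k
  show "continuous_on UNIV (\<lambda>z :: 'a \<times> (nat \<Rightarrow> real). snd z (h k))"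
    by (rule continuous_on_snd_coordinate)
qed

lemma closed_reindex:
  assumes "closed D"
  shows "closed {z :: 'a::topological_space \<times> (nat \<Rightarrow> real). (fst z, \<lambda>k. snd z (h k)) \<in> D}"
  using closed_vimage[OF assms continuous_on_reindex[of h]] by (simp add: vimage_def)

text \<open>Countably many witnessing sequences are coded into one by the pairing function.\<close>

lemma analytic_INT:
  fixes A :: "nat \<Rightarrow> 'a::topological_space set"
  assumes "\<And>i. analytic (A i)"
  shows "analytic (\<Inter>i. A i)"
proof -
  obtain D where D: "\<And>i. closed (D i :: ('a \<times> (nat \<Rightarrow> real)) set)" "\<And>i. A i = fst ` D i"
    using assms unfolding analytic_def by metis
  define D' where "D' = (\<Inter>i. {z :: 'a \<times> (nat \<Rightarrow> real). (fst z, \<lambda>k. snd z (prod_encode (i, k))) \<in> D i})"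
  have "closed D'" unfolding D'_def by (intro closed_INT ballI closed_reindex D)
  moreover have "(\<Inter>i. A i) = fst ` D'"
  proof (intro equalityI subsetI)
    fix x assume "x \<in> (\<Inter>i. A i)"
    then have "\<forall>i. \<exists>\<sigma>. (x, \<sigma>) \<in> D i" using D(2) by force
    then obtain s where s: "\<And>i. (x, s i) \<in> D i" by metis
    then have "(x, \<lambda>n. s (fst (prod_decode n)) (snd (prod_decode n))) \<in> D'" by (simp add: D'_def)
    then show "x \<in> fst ` D'" by force
  next
    fix x assume "x \<in> fst ` D'"
    then show "x \<in> (\<Inter>i. A i)" unfolding D'_def D(2) by force
  qed
  ultimately show ?thesis unfolding analytic_def by blast
qed

lemma analytic_UN:
  fixes A :: "nat \<Rightarrow> 'a::topological_space set"
  assumes "\<And>i. analytic (A i)"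
  shows "analytic (\<Union>i. A i)"
proof -
  obtain D where D: "\<And>i. closed (D i :: ('a \<times> (nat \<Rightarrow> real)) set)" "\<And>i. A i = fst ` D i"
    using assms unfolding analytic_def by metis
  have c0: "continuous_on UNIV (\<lambda>z :: 'a \<times> (nat \<Rightarrow> real). snd z 0)"
    by (rule continuous_on_snd_coordinate)
  \<comment> \<open>Coordinate 0 names the member \<open>i\<close> of the family. That it differs
    from \<open>i\<close> is an open condition; as it is a natural number, this is the same as
    differing by at least 1 / 2, which is closed.\<close>
  define D' where "D' = {z :: 'a \<times> (nat \<Rightarrow> real). snd z 0 \<in> range real}
    \<inter> (\<Inter>i. {z. snd z 0 \<le> real i - 1 / 2} \<union> {z. real i + 1 / 2 \<le> snd z 0}
        \<union> {z. (fst z, \<lambda>k. snd z (Suc k)) \<in> D i})"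
  have "closed {z :: 'a \<times> (nat \<Rightarrow> real). snd z 0 \<in> range real}"
    using closed_vimage[OF closed_of_nat_image c0, of UNIV] by (simp add: vimage_def)
  then have "closed D'" unfolding D'_def
    by (intro closed_Int closed_INT ballI closed_Un closed_Collect_le c0 continuous_on_const closed_reindex D)
  moreover have "(\<Union>i. A i) = fst ` D'"
  proof (intro equalityI subsetI)
    fix x assume "x \<in> (\<Union>i. A i)"
    then obtain i \<sigma> where s: "(x, \<sigma>) \<in> D i" using D(2) by force
    have "(x, case_nat (real i) \<sigma>) \<in> D'"
      unfolding D'_def
    proof (intro IntI INT_I)
      fix j :: nat
      show "(x, case_nat (real i) \<sigma>) \<in> {z. snd z 0 \<le> real j - 1 / 2} \<union> {z. real j + 1 / 2 \<le> snd z 0}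
        \<union> {z. (fst z, \<lambda>k. snd z (Suc k)) \<in> D j}"
        using s by (cases i j rule: linorder_cases) auto
    qed simp
    then show "x \<in> fst ` D'" by force
  next
    fix x assume "x \<in> fst ` D'"
    then obtain \<sigma> where s: "(x, \<sigma>) \<in> D'" by force
    then obtain i where "\<sigma> 0 = real i" unfolding D'_def by auto
    moreover have "\<sigma> 0 \<le> real i - 1 / 2 \<or> real i + 1 / 2 \<le> \<sigma> 0 \<or> (x, \<lambda>k. \<sigma> (Suc k)) \<in> D i"
      using s unfolding D'_def by auto
    ultimately have "(x, \<lambda>k. \<sigma> (Suc k)) \<in> D i" by linarith
    then show "x \<in> (\<Union>i. A i)" using D(2) by force
  qed
  ultimately show ?thesis unfolding analytic_def by blast
qed

lemma analytic_open:
  fixes U :: "'a::metric_space set"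
  assumes U: "open U" shows "analytic U"
\<comment> \<open>\<open>infdist\<close> to the empty set is 0 by convention, so the whole space is
  treated apart.\<close>
proof (cases "U = UNIV")
  case True
  then show ?thesis by (simp add: analytic_closed)
next
  case False
  then have ne: "- U \<noteq> {}" by blast
  have cl: "closed (- U)" using U by blast
  have eq: "U = (\<Union>n. {x. 1 / real (Suc n) \<le> infdist x (- U)})"
  proof (intro equalityI subsetI)
    fix x assume "x \<in> U"
    then have "infdist x (- U) \<noteq> 0" using in_closed_iff_infdist_zero[OF cl ne, of x] by simp
    then have "0 < infdist x (- U)" using infdist_nonneg[of x "- U"] by linarith
    then obtain n where "1 / real (Suc n) < infdist x (- U)" using nat_approx_posE by blast
    then have "1 / real (Suc n) \<le> infdist x (- U)" by linarith
    then show "x \<in> (\<Union>n. {x. 1 / real (Suc n) \<le> infdist x (- U)})" by blast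
  next
    fix x assume "x \<in> (\<Union>n. {x. 1 / real (Suc n) \<le> infdist x (- U)})"
    then obtain n where "1 / real (Suc n) \<le> infdist x (- U)" by blast
    then have "infdist x (- U) \<noteq> 0" by (smt (verit) of_nat_0_less_iff zero_less_Suc zero_less_divide_1_iff)
    then show "x \<in> U" using in_closed_iff_infdist_zero[OF cl ne, of x] by simp
  qed
  have "analytic (\<Union>n. {x. 1 / real (Suc n) \<le> infdist x (- U)})"
    by (intro analytic_UN analytic_closed closed_Collect_le continuous_intros)
  then show ?thesis using eq by simp
qed

text \<open>Analytic sets need not be stable under complements, so the induction carries
  \<open>A\<close> and its complement together: unions for the one become intersections for the
  other.\<close>

lemma analytic_borel:
  fixes A :: "'a::metric_space set"
  assumes "A \<in> sets borel"
  shows "analytic A"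
proof -
  have "A \<in> sigma_sets UNIV {S. open S}" using assms by (simp add: borel_def)
  then have "analytic A \<and> analytic (- A)"
  proof induction
    case (Basic a)
    then show ?case by (simp add: analytic_open analytic_closed closed_Compl)
  next
    case Empty
    then show ?case by (simp add: analytic_closed)
  next
    case (Compl a)
    then show ?case by (simp add: Compl_eq_Diff_UNIV[symmetric])
  next
    case (Union a)
    then show ?case using analytic_UN[of a] analytic_INT[of "\<lambda>i. - a i"] by simp
  qed
  then show ?thesis by simp
qed

text \<open>A closed subset of a complete space is itself a Baire space; were all relative interiors
  of the \<open>C i\<close> empty, \<open>D\<close> would have empty interior in itself.\<close>

lemma Baire_closed_cover:
  fixes D :: "'b::complete_space set" and C :: "nat \<Rightarrow> 'b set"
  assumes D: "closed D" "D \<noteq> {}" and C: "\<And>i. closed (C i)" "D \<subseteq> (\<Union>i. C i)"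
  obtains i U where "open U" "U \<inter> D \<noteq> {}" "U \<inter> D \<subseteq> C i"
proof -
  let ?X = "top_of_set D"
  have cm: "completely_metrizable_space ?X"
    using completely_metrizable_space_closedin[OF completely_metrizable_space_euclidean] D(1) by auto
  have "\<exists>i. ?X interior_of (D \<inter> C i) \<noteq> {}"
  proof (rule ccontr)
    assume no: "\<not> (\<exists>i. ?X interior_of (D \<inter> C i) \<noteq> {})"
    have "?X interior_of \<Union> (range (\<lambda>i. D \<inter> C i)) = {}"
    proof (rule Baire_category_alt[OF disjI1[OF cm]])
      fix T assume "T \<in> range (\<lambda>i. D \<inter> C i)"
      then show "closedin ?X T \<and> ?X interior_of T = {}"
        using no C(1) by (auto simp: closedin_closed)
    qed simp
    moreover have "\<Union> (range (\<lambda>i. D \<inter> C i)) = topspace ?X" using C(2) by auto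
    ultimately have "topspace ?X = {}" by (metis interior_of_topspace)
    then show False using D by simp
  qed
  then obtain i where i: "?X interior_of (D \<inter> C i) \<noteq> {}" by blast
  obtain U where U: "open U" "?X interior_of (D \<inter> C i) = D \<inter> U"
    by (metis openin_interior_of openin_open)
  show thesis
  proof (rule that[OF U(1)])
    show "U \<inter> D \<noteq> {}" using i U by auto
    show "U \<inter> D \<subseteq> C i" using interior_of_subset[of ?X "D \<inter> C i"] U by auto
  qed
qed

section \<open>Packing dimension of projections\<close>

lemma packing_dim_proj_le:
  fixes E V :: "'a::euclidean_space set"
  assumes V: "V \<in> grassmannian m"
  shows "packing_dim (orth_proj V ` E) \<le> packing_profile m E"
  unfolding packing_profile_def
proof (rule INF_greatest)
  have bl: "bounded_linear (orth_proj V)"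
    using V by (intro bounded_linear_orth_proj) (simp add: grassmannian_def)
  fix F :: "nat \<Rightarrow> 'a set" assume "F \<in> {F. (\<forall>i. F i \<noteq> {} \<and> compact (F i)) \<and> E \<subseteq> (\<Union>i. F i)}"
  then have F: "\<And>i. F i \<noteq> {}" "\<And>i. bounded (F i)" "E \<subseteq> (\<Union>i. F i)" by (auto intro: compact_imp_bounded)
  have "packing_dim (orth_proj V ` E) \<le> (SUP i. upper_box_dim (orth_proj V ` F i))"
    unfolding packing_dim_def
  proof (rule INF_lower, intro CollectI conjI allI)
    show "orth_proj V ` E \<subseteq> (\<Union>i. orth_proj V ` F i)" using F(3) by blast
  qed (use F bl in \<open>auto intro: bounded_linear_image\<close>)
  also have "\<dots> \<le> (SUP i. upper_box_profile m (F i))"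
    by (intro SUP_mono) (use box_dims_proj_le(2)[OF V F(2,1)] in auto)
  finally show "packing_dim (orth_proj V ` E) \<le> (SUP i. upper_box_profile m (F i))" .
qed

text \<open>Each \<open>t\<close> brings its own null set; restricting to rational \<open>t\<close>
  leaves countably many.\<close>

lemma AE_ereal_le:
  fixes f :: "'b \<Rightarrow> ereal"
  assumes "\<And>t. ereal t < a \<Longrightarrow> AE x in M. ereal t \<le> f x"
  shows "AE x in M. a \<le> f x"
proof -
  have "AE x in M. \<forall>q :: rat. ereal (real_of_rat q) < a \<longrightarrow> ereal (real_of_rat q) \<le> f x"
    unfolding AE_all_countable using assms by (auto simp: AE_impI)
  then show ?thesis
  proof eventually_elim
    case (elim x)
    show ?case
    proof (rule ccontr)
      assume "\<not> a \<le> f x"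
      then have "f x < a" by simp
      then obtain q where "f x < ereal (real_of_rat q)" "ereal (real_of_rat q) < a"
        using ereal_dense3 by blast
      then show False using elim by (meson leD)
    qed
  qed
qed

text \<open>These sets form a \<sigma>-ideal, and their packing profile is at most \<open>t\<close>.
  Unlike a bound on the infimum itself, this condition is visibly stable under countable
  unions.\<close>

definition profile_null :: "real \<Rightarrow> ereal \<Rightarrow> 'a::euclidean_space set \<Rightarrow> bool"
  where "profile_null s t X \<longleftrightarrow> (\<exists>F :: nat \<Rightarrow> 'a set. (\<forall>i. F i \<noteq> {} \<and> compact (F i)) \<and> X \<subseteq> (\<Union>i. F i)
    \<and> (\<forall>i. upper_box_profile s (F i) \<le> t))"

lemma profile_null_subset: "profile_null s t Y \<Longrightarrow> X \<subseteq> Y \<Longrightarrow> profile_null s t X"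
  unfolding profile_null_def by (meson order_trans)

lemma profile_null_UN:
  assumes I: "countable I" "I \<noteq> {}" and X: "\<And>i. i \<in> I \<Longrightarrow> profile_null s t (X i)"
  shows "profile_null s t (\<Union>i\<in>I. X i)"
proof -
  have "\<forall>i\<in>I. \<exists>F. (\<forall>k :: nat. F k \<noteq> {} \<and> compact (F k)) \<and> X i \<subseteq> (\<Union>k. F k) \<and> (\<forall>k. upper_box_profile s (F k) \<le> t)"
    using X unfolding profile_null_def by blast
  from bchoice[OF this] obtain G where G0: "\<forall>i\<in>I. (\<forall>k :: nat. G i k \<noteq> {} \<and> compact (G i k)) \<and> X i \<subseteq> (\<Union>k. G i k)
    \<and> (\<forall>k. upper_box_profile s (G i k) \<le> t)" ..
  have G: "G i k \<noteq> {}" "compact (G i k)" "X i \<subseteq> (\<Union>k. G i k)" "upper_box_profile s (G i k) \<le> t"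
    if "i \<in> I" for i k using G0 that by blast+
  let ?F = "\<lambda>n. G (from_nat_into I (fst (prod_decode n))) (snd (prod_decode n))"
  have mem: "from_nat_into I k \<in> I" for k by (rule from_nat_into[OF I(2)])
  have "(\<Union>i\<in>I. X i) \<subseteq> (\<Union>n. ?F n)"
  proof
    fix x assume "x \<in> (\<Union>i\<in>I. X i)"
    then obtain i k where ik: "i \<in> I" "x \<in> G i k" using G(3) by blast
    obtain j where "from_nat_into I j = i" using from_nat_into_surj[OF I(1) ik(1)] by blast
    then have "x \<in> ?F (prod_encode (j, k))" using ik by simp
    then show "x \<in> (\<Union>n. ?F n)" by blast
  qed
  then show ?thesis unfolding profile_null_def using G mem by (intro exI[of _ ?F]) auto
qed

lemma upper_box_profile_closure: "upper_box_profile s (closure X) = upper_box_profile s X"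
  by (simp add: upper_box_profile_def capacity_def)

lemma profile_null_bounded:
  assumes "bounded X" "X \<noteq> {}" "upper_box_profile s X \<le> t"
  shows "profile_null s t X"
  unfolding profile_null_def
  by (rule exI[of _ "\<lambda>_. closure X"]) (use assms closure_subset in \<open>auto simp: upper_box_profile_closure\<close>)

text \<open>
  Write \<open>E\<close> as the projection of a closed set \<open>D\<close> and discard the relatively open parts of \<open>D\<close> with
  small packing profile. For any cover of the projected set, the Baire category theorem in the rest
  of \<open>D\<close> yields a basic open part whose projection lies in the closure of one member.
\<close>
lemma packing_dim_proj_ge_AE:
  fixes \<gamma> :: "(real ^ 'n) set measure" and E :: "(real ^ 'n) set"
  assumes \<gamma>: "grassmann_measure m \<gamma>" and n: "2 \<le> CARD('n)" and E: "E \<noteq> {}" "E \<in> sets borel"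
  shows "AE V in \<gamma>. packing_profile m E \<le> packing_dim (orth_proj V ` E)"
proof (rule AE_ereal_le)
  fix t assume t: "ereal t < packing_profile m E"
  have notnull: "\<not> profile_null m (ereal t) E"
  proof
    assume "profile_null m (ereal t) E"
    then obtain F :: "nat \<Rightarrow> (real ^ 'n) set" where F: "\<forall>i. F i \<noteq> {} \<and> compact (F i)" "E \<subseteq> (\<Union>i. F i)"
      "\<forall>i. upper_box_profile m (F i) \<le> ereal t" unfolding profile_null_def by blast
    have "packing_profile m E \<le> (SUP i. upper_box_profile m (F i))"
      unfolding packing_profile_def by (rule INF_lower) (use F in auto)
    also have "\<dots> \<le> ereal t" by (rule SUP_least) (use F in auto)
    finally show False using t by simp
  qed
  obtain D :: "((real ^ 'n) \<times> (nat \<Rightarrow> real)) set" where D: "closed D" "E = fst ` D"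
    using analytic_borel[OF E(2)] unfolding analytic_def by blast
  obtain B :: "((real ^ 'n) \<times> (nat \<Rightarrow> real)) set set" where B: "countable B" "topological_basis B"
    using ex_countable_basis by blast
  \<comment> \<open>Box dimensions concern bounded sets, hence basic open sets with bounded first
    projection; by \<open>refine\<close> they still form a basis.\<close>
  define B' where "B' = {U \<in> B. bounded (fst ` U)}"
  have B'c: "countable B'" unfolding B'_def by (rule countable_subset[OF _ B(1)]) auto
  have refine: "\<exists>U\<in>B'. z \<in> U \<and> U \<subseteq> W" if "open W" "z \<in> W" for W z
  proof -
    have "open (W \<inter> ball (fst z) 1 \<times> UNIV)" using that by (intro open_Int open_Times) auto
    moreover have "z \<in> W \<inter> ball (fst z) 1 \<times> UNIV" using that by (auto simp: mem_Times_iff)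
    ultimately obtain U where U: "U \<in> B" "z \<in> U" "U \<subseteq> W \<inter> ball (fst z) 1 \<times> UNIV"
      using topological_basisE[OF B(2)] by metis
    have "fst ` U \<subseteq> ball (fst z) 1" using U(3) by auto
    then have "bounded (fst ` U)" by (rule bounded_subset[OF bounded_ball])
    then show ?thesis using U by (auto simp: B'_def)
  qed
  have B'open: "open U" if "U \<in> B'" for U using that topological_basis_open[OF B(2)] by (simp add: B'_def)
  define N where "N = {U \<in> B'. profile_null m (ereal t) (fst ` (U \<inter> D))}"
  define D' where "D' = D - \<Union>N"
  have Nc: "countable N" unfolding N_def by (rule countable_subset[OF _ B'c]) auto
  have "closed D'" unfolding D'_def using D(1) B'open by (intro closed_Diff open_Union) (auto simp: N_def)
  have D'ne: "D' \<noteq> {}"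
  proof
    assume "D' = {}"
    then have "D \<subseteq> \<Union>N" by (auto simp: D'_def)
    then have sub: "E \<subseteq> (\<Union>U\<in>N. fst ` (U \<inter> D))" unfolding D(2) by blast
    then have "N \<noteq> {}" using E(1) by auto
    then have "profile_null m (ereal t) (\<Union>U\<in>N. fst ` (U \<inter> D))"
      by (intro profile_null_UN Nc) (auto simp: N_def)
    then show False using profile_null_subset[OF _ sub] notnull by blast
  qed
  \<comment> \<open>Otherwise the projection of \<open>U \<inter> D\<close> would be covered by that
    of \<open>U \<inter> D'\<close> and by those of the discarded parts, all of them null, and
    \<open>U\<close> would have been discarded itself.\<close>
  have big: "ereal t < upper_box_profile m (fst ` (U \<inter> D'))" if U: "U \<in> B'" "U \<inter> D' \<noteq> {}" for U
  proof (rule ccontr)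
    assume "\<not> ereal t < upper_box_profile m (fst ` (U \<inter> D'))"
    moreover have "bounded (fst ` (U \<inter> D'))" using U(1) by (auto simp: B'_def intro: bounded_subset)
    ultimately have null: "profile_null m (ereal t) (fst ` (U \<inter> D'))"
      using U by (intro profile_null_bounded) auto
    let ?X = "\<lambda>W. if W = U then fst ` (U \<inter> D') else fst ` (W \<inter> D)"
    have "U \<notin> N" using U(2) by (auto simp: D'_def)
    have "profile_null m (ereal t) (\<Union>W\<in>insert U N. ?X W)"
      using Nc null by (intro profile_null_UN) (auto simp: N_def)
    moreover have "fst ` (U \<inter> D) \<subseteq> (\<Union>W\<in>insert U N. ?X W)"
    proof
      fix x assume "x \<in> fst ` (U \<inter> D)"
      then obtain z where z: "z \<in> U" "z \<in> D" "x = fst z" by blast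
      show "x \<in> (\<Union>W\<in>insert U N. ?X W)"
      proof (cases "z \<in> \<Union>N")
        case True
        then obtain W where "W \<in> N" "z \<in> W" by blast
        then show ?thesis using z \<open>U \<notin> N\<close> by (intro UN_I[of W]) auto
      next
        case False
        then show ?thesis using z by (intro UN_I[of U]) (auto simp: D'_def)
      qed
    qed
    ultimately have "profile_null m (ereal t) (fst ` (U \<inter> D))" by (rule profile_null_subset)
    then show False using U(1) \<open>U \<notin> N\<close> by (simp add: N_def)
  qed
  \<comment> \<open>This countable family is fixed before \<open>V\<close> and before any cover of
    the projection, so one null set serves all covers.\<close>
  have "AE V in \<gamma>. \<forall>U\<in>{U \<in> B'. U \<inter> D' \<noteq> {}}. ereal t \<le> upper_box_dim (orth_proj V ` fst ` (U \<inter> D'))"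
  proof (rule AE_ball_countable[THEN iffD2, OF _ ballI])
    show "countable {U \<in> B'. U \<inter> D' \<noteq> {}}" by (rule countable_subset[OF _ B'c]) auto
    fix U assume U: "U \<in> {U \<in> B'. U \<inter> D' \<noteq> {}}"
    have "bounded (fst ` (U \<inter> D'))" using U by (auto simp: B'_def intro: bounded_subset)
    then have "AE V in \<gamma>. lower_box_profile m (fst ` (U \<inter> D')) \<le> lower_box_dim (orth_proj V ` fst ` (U \<inter> D'))
      \<and> upper_box_profile m (fst ` (U \<inter> D')) \<le> upper_box_dim (orth_proj V ` fst ` (U \<inter> D'))"
      using U by (intro box_dims_proj_ge_AE[OF \<gamma> n]) auto
    then show "AE V in \<gamma>. ereal t \<le> upper_box_dim (orth_proj V ` fst ` (U \<inter> D'))"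
      by eventually_elim (use big[of U] U in auto)
  qed
  moreover have "AE V in \<gamma>. V \<in> space \<gamma>" by simp
  ultimately show "AE V in \<gamma>. ereal t \<le> packing_dim (orth_proj V ` E)"
  proof eventually_elim
    case (elim V)
    then have V: "subspace V" by (simp add: space_grassmann_measure[OF \<gamma>] grassmannian_def)
    show ?case unfolding packing_dim_def
    proof (rule INF_greatest)
      fix F :: "nat \<Rightarrow> (real ^ 'n) set" assume "F \<in> {F. (\<forall>i. F i \<noteq> {} \<and> bounded (F i)) \<and> orth_proj V ` E \<subseteq> (\<Union>i. F i)}"
      then have F: "\<And>i. F i \<noteq> {}" "\<And>i. bounded (F i)" "orth_proj V ` E \<subseteq> (\<Union>i. F i)" by auto
      let ?C = "\<lambda>i. (\<lambda>z :: (real ^ 'n) \<times> (nat \<Rightarrow> real). orth_proj V (fst z)) -` closure (F i)"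
      have "continuous_on UNIV (\<lambda>z :: (real ^ 'n) \<times> (nat \<Rightarrow> real). orth_proj V (fst z))"
        by (intro continuous_on_compose2[OF continuous_orth_proj[OF V, of UNIV]] continuous_intros) auto
      then have "closed (?C i)" for i by (intro closed_vimage closed_closure)
      moreover have "D' \<subseteq> (\<Union>i. ?C i)"
      proof
        fix z assume "z \<in> D'"
        then have "orth_proj V (fst z) \<in> (\<Union>i. F i)" using F(3) unfolding D(2) by (auto simp: D'_def)
        then show "z \<in> (\<Union>i. ?C i)" using closure_subset by fastforce
      qed
      ultimately obtain i W where W: "open W" "W \<inter> D' \<noteq> {}" "W \<inter> D' \<subseteq> ?C i"
        using Baire_closed_cover[OF \<open>closed D'\<close> D'ne, of ?C] by metis
      then obtain z where z: "z \<in> W" "z \<in> D'" by blast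
      obtain U where U: "U \<in> B'" "z \<in> U" "U \<subseteq> W" using refine[OF W(1) z(1)] by blast
      have ne: "U \<inter> D' \<noteq> {}" using U z by blast
      have "ereal t \<le> upper_box_dim (orth_proj V ` fst ` (U \<inter> D'))" using elim(1) U ne by blast
      also have "\<dots> \<le> upper_box_dim (closure (F i))"
        using W(3) U(3) ne F(2) by (intro upper_box_dim_mono bounded_closure) auto
      also have "\<dots> = upper_box_dim (F i)" using F(2) by (rule upper_box_dim_closure)
      also have "\<dots> \<le> (SUP i. upper_box_dim (F i))" by (rule SUP_upper) simp
      finally show "ereal t \<le> (SUP i. upper_box_dim (F i))" .
    qed
  qed
qed


section \<open>Covering contents and Hausdorff measure\<close>

text \<open>Serves Hausdorff and dyadic contents alike. Indices are kept apart from sets so that a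
  cost may depend on the index, such as the level of a cell, and not only on the set.\<close>

definition cover_content :: "'b set \<Rightarrow> ('b \<Rightarrow> 'a set) \<Rightarrow> ('b \<Rightarrow> ennreal) \<Rightarrow> 'a set \<Rightarrow> ennreal"
  where "cover_content B S c A =
    (INF f \<in> {f :: nat \<Rightarrow> 'b. (\<forall>i. f i \<in> B) \<and> A \<subseteq> (\<Union>i. S (f i))}. \<Sum>i. c (f i))"

lemma cover_content_le:
  assumes "\<And>i. f i \<in> B" "A \<subseteq> (\<Union>i. S (f i))"
  shows "cover_content B S c A \<le> (\<Sum>i. c (f i))"
  unfolding cover_content_def by (rule INF_lower) (use assms in auto)

lemma cover_content_lessE:
  assumes "cover_content B S c A < y"
  obtains f where "\<And>i. f i \<in> B" "A \<subseteq> (\<Union>i. S (f i))" "(\<Sum>i. c (f i)) < y"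
  using assms unfolding cover_content_def INF_less_iff by auto

lemma cover_content_mono: "A \<subseteq> A' \<Longrightarrow> cover_content B S c A \<le> cover_content B S c A'"
  unfolding cover_content_def by (rule INF_superset_mono) auto

lemma cover_content_UN_le:
  fixes A :: "nat \<Rightarrow> 'a set"
  shows "cover_content B S c (\<Union>i. A i) \<le> (\<Sum>i. cover_content B S c (A i))"
proof (rule ennreal_le_epsilon)
  fix e :: real assume fin: "(\<Sum>i. cover_content B S c (A i)) < top" and e: "0 < e"
  have "\<exists>f. (\<forall>j. f j \<in> B) \<and> A i \<subseteq> (\<Union>j. S (f j)) \<and>
      (\<Sum>j. c (f j)) \<le> cover_content B S c (A i) + ennreal (e * (1 / 2) ^ Suc i)" for i
  proof -
    have "cover_content B S c (A i) < top" using ennreal_suminf_lessD[OF fin] .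
    then have "cover_content B S c (A i) < cover_content B S c (A i) + ennreal (e * (1 / 2) ^ Suc i)"
      using e by (simp add: ennreal_add_left_cancel_less[where b = 0, simplified])
    then show ?thesis by (rule cover_content_lessE) (auto intro: less_imp_le)
  qed
  then obtain f where f: "\<And>i j. f i j \<in> B" "\<And>i. A i \<subseteq> (\<Union>j. S (f i j))"
      "\<And>i. (\<Sum>j. c (f i j)) \<le> cover_content B S c (A i) + ennreal (e * (1 / 2) ^ Suc i)"
    by metis
  let ?g = "\<lambda>n. f (fst (prod_decode n)) (snd (prod_decode n))"
  have cov: "(\<Union>i. A i) \<subseteq> (\<Union>n. S (?g n))"
  proof
    fix x assume "x \<in> (\<Union>i. A i)"
    then obtain i j where "x \<in> S (f i j)" using f(2) by blast
    then have "x \<in> S (?g (prod_encode (i, j)))" by simp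
    then show "x \<in> (\<Union>n. S (?g n))" by blast
  qed
  have "cover_content B S c (\<Union>i. A i) \<le> (\<Sum>n. c (?g n))" by (rule cover_content_le[OF f(1) cov])
  also have "\<dots> = (\<Sum>i. \<Sum>j. c (f i j))"
    using suminf_ennreal_2dimen[of "\<lambda>i. \<Sum>j. c (f i j)" "\<lambda>(i, j). c (f i j)"] by (simp add: case_prod_beta)
  also have "\<dots> \<le> (\<Sum>i. cover_content B S c (A i) + ennreal (e * (1 / 2) ^ Suc i))"
    by (intro suminf_le allI f(3)) auto
  also have "\<dots> = (\<Sum>i. cover_content B S c (A i)) + (\<Sum>i. ennreal (e * (1 / 2) ^ Suc i))"
    by (rule suminf_add[symmetric]) auto
  also have "(\<Sum>i. ennreal (e * (1 / 2) ^ Suc i)) = ennreal e"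
    using e sums_mult[OF power_half_series, of e] by (intro suminf_ennreal_eq) auto
  finally show "cover_content B S c (\<Union>i. A i) \<le> (\<Sum>i. cover_content B S c (A i)) + ennreal e" .
qed

text \<open>The index \<open>z\<close> of cost 0 pads a finite cover to a sequence.\<close>

lemma cover_content_le_finite:
  assumes z: "z \<in> B" "c z = 0" and I: "finite I" "\<And>i. i \<in> I \<Longrightarrow> g i \<in> B" "A \<subseteq> (\<Union>i\<in>I. S (g i))"
  shows "cover_content B S c A \<le> (\<Sum>i\<in>I. c (g i))"
proof -
  obtain h where h: "bij_betw h {0..<card I} I" using ex_bij_betw_nat_finite[OF I(1)] by blast
  let ?f = "\<lambda>n. if n < card I then g (h n) else z"
  have hI: "n < card I \<Longrightarrow> h n \<in> I" for n using h by (auto simp: bij_betw_def)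
  have "A \<subseteq> (\<Union>n. S (?f n))"
  proof
    fix x assume "x \<in> A"
    then obtain i where i: "i \<in> I" "x \<in> S (g i)" using I(3) by blast
    then have "i \<in> h ` {0..<card I}" using h by (simp add: bij_betw_def)
    then obtain n where "n < card I" "h n = i" by auto
    then have "x \<in> S (?f n)" using i by simp
    then show "x \<in> (\<Union>n. S (?f n))" by blast
  qed
  then have "cover_content B S c A \<le> (\<Sum>n. c (?f n))"
    using z I(2) hI by (intro cover_content_le) auto
  also have "\<dots> = (\<Sum>n\<in>{0..<card I}. c (?f n))"
    by (rule suminf_finite) (use z in auto)
  also have "\<dots> = (\<Sum>n\<in>{0..<card I}. c (g (h n)))" by (rule sum.cong) auto
  also have "\<dots> = (\<Sum>i\<in>I. c (g i))" using h by (rule sum.reindex_bij_betw)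
  finally show ?thesis .
qed

lemma hausdorff_content_eq:
  "hausdorff_content \<delta> s = cover_content {U. bounded U \<and> diameter U \<le> \<delta>} (\<lambda>U. U) (diam_pow s)"
  by (simp add: hausdorff_content_def cover_content_def fun_eq_iff)

lemma hausdorff_measure_eq_0_iff:
  "hausdorff_measure s X = 0 \<longleftrightarrow> (\<forall>\<delta>>0. hausdorff_content \<delta> s X = 0)"
  by (auto simp: hausdorff_measure_def SUP_eq_iff bot_ennreal[symmetric])

lemma hausdorff_measure_UN_eq_0:
  fixes X :: "nat \<Rightarrow> 'a::metric_space set"
  assumes "\<And>i. hausdorff_measure s (X i) = 0"
  shows "hausdorff_measure s (\<Union>i. X i) = 0"
  unfolding hausdorff_measure_eq_0_iff
proof (intro allI impI)
  fix \<delta> :: real assume "0 < \<delta>"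
  then have "hausdorff_content \<delta> s (X i) = 0" for i using assms by (simp add: hausdorff_measure_eq_0_iff)
  then show "hausdorff_content \<delta> s (\<Union>i. X i) = 0"
    using cover_content_UN_le[of _ _ _ X] unfolding hausdorff_content_eq
    by (metis (no_types, lifting) le_zero_eq suminf_zero suminf_cong)
qed

lemma hausdorff_measure_mono: "X \<subseteq> Y \<Longrightarrow> hausdorff_measure s X \<le> hausdorff_measure s Y"
  unfolding hausdorff_measure_def hausdorff_content_eq by (intro SUP_mono) (auto intro: cover_content_mono)

lemma hausdorff_content_antimono:
  "\<delta> \<le> \<delta>' \<Longrightarrow> hausdorff_content \<delta>' s X \<le> hausdorff_content \<delta> s X"
  unfolding hausdorff_content_def by (rule INF_superset_mono) (auto intro: order_trans)

lemma hausdorff_measure_exponent_mono: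
  assumes "hausdorff_measure s X = 0" "0 \<le> s" "s \<le> t"
  shows "hausdorff_measure t X = 0"
  unfolding hausdorff_measure_eq_0_iff
proof (intro allI impI)
  fix \<delta> :: real assume d: "0 < \<delta>"
  \<comment> \<open>Powers decrease in the exponent only for diameters at most 1. Passing to a finer
    mesh is safe, the content being antitone in \<delta>.\<close>
  let ?d = "min \<delta> 1"
  have "hausdorff_content \<delta> t X \<le> hausdorff_content ?d t X" by (rule hausdorff_content_antimono) simp
  also have "\<dots> \<le> hausdorff_content ?d s X"
    unfolding hausdorff_content_def
  proof (rule INF_mono)
    fix U :: "nat \<Rightarrow> 'a set" assume U: "U \<in> {U. (\<forall>i. bounded (U i) \<and> diameter (U i) \<le> ?d) \<and> X \<subseteq> (\<Union>i. U i)}"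
    have "diam_pow t (U i) \<le> diam_pow s (U i)" for i
    proof -
      have "0 \<le> diameter (U i)" "diameter (U i) \<le> 1" using U by (auto simp: diameter_ge_0)
      then have "diameter (U i) powr t \<le> diameter (U i) powr s" "diameter (U i) powr t \<le> 1"
        using assms by (auto intro: powr_mono' powr_le1)
      then show ?thesis using assms by (auto simp: diam_pow_def intro: ennreal_leI ennreal_le_1[THEN iffD2])
    qed
    then have "(\<Sum>i. diam_pow t (U i)) \<le> (\<Sum>i. diam_pow s (U i))" by (intro suminf_le) auto
    then show "\<exists>U'\<in>{U. (\<forall>i. bounded (U i) \<and> diameter (U i) \<le> ?d) \<and> X \<subseteq> (\<Union>i. U i)}.
        (\<Sum>i. diam_pow t (U' i)) \<le> (\<Sum>i. diam_pow s (U i))" using U by blast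
  qed
  also have "\<dots> = 0" using assms(1) d by (simp add: hausdorff_measure_eq_0_iff)
  finally show "hausdorff_content \<delta> t X = 0" by simp
qed

lemma hausdorff_measure_0_less_dim:
  assumes "ereal s < hausdorff_dim X" "0 \<le> s"
  shows "hausdorff_measure s X \<noteq> 0"
proof
  assume "hausdorff_measure s X = 0"
  then have "hausdorff_dim X \<le> ereal s" unfolding hausdorff_dim_def by (intro INF_lower) (use assms in auto)
  then show False using assms by simp
qed

lemma hausdorff_dim_geI:
  assumes "hausdorff_measure t X \<noteq> 0"
  shows "ereal t \<le> hausdorff_dim X"
  unfolding hausdorff_dim_def
proof (rule INF_greatest)
  fix s assume "s \<in> {s. 0 \<le> s \<and> hausdorff_measure s X = 0}"
  then show "ereal t \<le> ereal s" using hausdorff_measure_exponent_mono[of s X t] assms by force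
qed

lemma hausdorff_dim_nonneg: "0 \<le> hausdorff_dim X"
  unfolding hausdorff_dim_def by (rule INF_greatest) auto

section \<open>The upper bound for the Hausdorff dimension of projections\<close>

lemma hausdorff_measure_proj_le:
  fixes E V :: "'a::euclidean_space set"
  assumes V: "subspace V" and s: "0 \<le> s"
  shows "hausdorff_measure s (orth_proj V ` E) \<le> hausdorff_measure s E"
  unfolding hausdorff_measure_def
proof (intro SUP_mono bexI)
  fix \<delta> :: real assume d: "\<delta> \<in> {0<..}"
  show "hausdorff_content \<delta> s (orth_proj V ` E) \<le> hausdorff_content \<delta> s E"
    unfolding hausdorff_content_def
  proof (rule INF_mono)
    fix U :: "nat \<Rightarrow> 'a set" assume U: "U \<in> {U. (\<forall>i. bounded (U i) \<and> diameter (U i) \<le> \<delta>) \<and> E \<subseteq> (\<Union>i. U i)}"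
    let ?U = "\<lambda>i. orth_proj V ` U i"
    have diam: "diameter (?U i) \<le> diameter (U i)" for i
    proof (rule diameter_le)
      show "?U i \<noteq> {} \<or> 0 \<le> diameter (U i)" using U by (auto simp: diameter_ge_0)
      fix x y assume "x \<in> ?U i" "y \<in> ?U i"
      then obtain u v where uv: "u \<in> U i" "v \<in> U i" "x = orth_proj V u" "y = orth_proj V v" by blast
      have "dist u v \<le> diameter (U i)" using U uv by (intro diameter_bounded_bound) auto
      then show "norm (x - y) \<le> diameter (U i)"
        using dist_orth_proj_le[OF V, of u v] uv by (simp add: dist_norm)
    qed
    have bd: "bounded (?U i)" for i using U by (auto intro: bounded_linear_image bounded_linear_orth_proj V)
    have "diam_pow s (?U i) \<le> diam_pow s (U i)" for i
      using diam[of i] bd[of i] s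
      by (auto simp: diam_pow_def diameter_ge_0 intro!: ennreal_leI powr_mono2)
    then have "(\<Sum>i. diam_pow s (?U i)) \<le> (\<Sum>i. diam_pow s (U i))" by (intro suminf_le) auto
    moreover have "orth_proj V ` E \<subseteq> (\<Union>i. ?U i)" using U by blast
    then have "?U \<in> {U. (\<forall>i. bounded (U i) \<and> diameter (U i) \<le> \<delta>) \<and> orth_proj V ` E \<subseteq> (\<Union>i. U i)}"
      using bd order_trans[OF diam] U by simp
    ultimately show "\<exists>U'\<in>{U. (\<forall>i. bounded (U i) \<and> diameter (U i) \<le> \<delta>) \<and> orth_proj V ` E \<subseteq> (\<Union>i. U i)}.
        (\<Sum>i. diam_pow s (U' i)) \<le> (\<Sum>i. diam_pow s (U i))" by (intro bexI[of _ ?U])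
  qed
qed

text \<open>Of order \<epsilon>^-m balls of diameter \<epsilon> cover \<open>X\<close>, at a cost of
  order \<epsilon>^(s - m), which tends to 0.\<close>

lemma hausdorff_measure_bounded_subspace:
  fixes V :: "'a::euclidean_space set"
  assumes V: "subspace V" "dim V = m" and s: "real m < s" and X: "X \<subseteq> V" "X \<subseteq> cball 0 R"
  shows "hausdorff_measure s X = 0"
  unfolding hausdorff_measure_eq_0_iff
proof (intro allI impI)
  fix \<delta> :: real assume d: "0 < \<delta>"
  define R' where "R' = max R 1"
  have X': "X \<subseteq> cball 0 R'" using X(2) by (auto simp: R'_def)
  define K where "K = (2 * real m + 4) ^ m * (2 * R') ^ m"
  have bound: "hausdorff_content \<delta> s X \<le> ennreal (K * \<epsilon> powr (s - real m))"
    if e: "0 < \<epsilon>" "\<epsilon> \<le> \<delta>" "\<epsilon> \<le> 1" for \<epsilon>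
  proof -
    have "\<epsilon> / 2 \<le> R'" using e by (simp add: R'_def)
    then obtain P where P: "finite P" "\<And>x. x \<in> X \<Longrightarrow> \<exists>p\<in>P. dist x p < \<epsilon> / 2"
      "real (card P) \<le> (2 * real m + 4) ^ m * (R' / (\<epsilon> / 2)) ^ m"
      using maximal_separated_subspace[OF V _ _ X(1) X', of "\<epsilon> / 2"] e by (metis half_gt_zero)
    have "hausdorff_content \<delta> s X \<le> (\<Sum>p\<in>P. diam_pow s (cball p (\<epsilon> / 2)))"
      unfolding hausdorff_content_eq
    proof (rule cover_content_le_finite[where z = "{}"])
      show "X \<subseteq> (\<Union>p\<in>P. cball p (\<epsilon> / 2))" using P(2) by (force simp: dist_commute)
    qed (use P e d in \<open>auto simp: diam_pow_def diameter_cball\<close>)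
    also have "\<dots> = of_nat (card P) * ennreal (\<epsilon> powr s)"
      using e s by (simp add: diam_pow_def diameter_cball)
    also have "\<dots> = ennreal (real (card P) * \<epsilon> powr s)"
      by (simp add: ennreal_of_nat_eq_real_of_nat ennreal_mult)
    also have "\<dots> \<le> ennreal ((2 * real m + 4) ^ m * (R' / (\<epsilon> / 2)) ^ m * \<epsilon> powr s)"
      by (intro ennreal_leI mult_right_mono P(3)) simp
    also have "(2 * real m + 4) ^ m * (R' / (\<epsilon> / 2)) ^ m * \<epsilon> powr s = K * \<epsilon> powr (s - real m)"
      using e by (simp add: K_def powr_diff powr_realpow power_divide mult.commute)
    finally show ?thesis .
  qed
  have "((\<lambda>\<epsilon>. \<epsilon> powr a) \<longlongrightarrow> 0) (at_right 0)" if "0 < a" for a :: real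
    using that by real_asymp
  then have "((\<lambda>\<epsilon>. K * \<epsilon> powr (s - real m)) \<longlongrightarrow> K * 0) (at_right 0)"
    using s by (intro tendsto_mult tendsto_const) simp
  then have "((\<lambda>\<epsilon>. ennreal (K * \<epsilon> powr (s - real m))) \<longlongrightarrow> ennreal (K * 0)) (at_right 0)"
    by (rule tendsto_ennrealI)
  moreover have "\<forall>\<^sub>F \<epsilon> in at_right 0. hausdorff_content \<delta> s X \<le> ennreal (K * \<epsilon> powr (s - real m))"
    using eventually_at_right_real[of 0 "min \<delta> 1"] d by (auto elim!: eventually_mono intro!: bound)
  ultimately have "hausdorff_content \<delta> s X \<le> ennreal (K * 0)"
    by (intro tendsto_lowerbound) auto
  then show "hausdorff_content \<delta> s X = 0" by simp
qed

lemma hausdorff_dim_subspace_le: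
  fixes V :: "'a::euclidean_space set"
  assumes V: "subspace V" "dim V = m" and X: "X \<subseteq> V"
  shows "hausdorff_dim X \<le> ereal (real m)"
proof (rule ereal_le_epsilon2)
  fix e :: real assume e: "0 < e"
  have "hausdorff_measure (real m + e) (\<Union>i. X \<inter> cball 0 (real i)) = 0"
    using V X e by (intro hausdorff_measure_UN_eq_0 hausdorff_measure_bounded_subspace[OF V]) auto
  moreover have "X = (\<Union>i. X \<inter> cball 0 (real i))"
    using real_arch_simple by (auto simp: mem_cball_0)
  ultimately have "hausdorff_measure (real m + e) X = 0" by simp
  then have "hausdorff_dim X \<le> ereal (real m + e)"
    unfolding hausdorff_dim_def by (intro INF_lower) (use e in auto)
  then show "hausdorff_dim X \<le> ereal (real m) + ereal e" by simp
qed

lemma hausdorff_dim_proj_le: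
  fixes E V :: "'a::euclidean_space set"
  assumes V: "V \<in> grassmannian m"
  shows "hausdorff_dim (orth_proj V ` E) \<le> hausdorff_profile m E"
proof -
  have V: "subspace V" "dim V = m" using V by (auto simp: grassmannian_def)
  have "hausdorff_dim (orth_proj V ` E) \<le> hausdorff_dim E"
    unfolding hausdorff_dim_def
    by (rule INF_superset_mono) (use hausdorff_measure_proj_le[OF V(1), of _ E] in \<open>auto simp: le_zero_eq[symmetric] simp del: le_zero_eq intro: order_trans\<close>)
  moreover have "hausdorff_dim (orth_proj V ` E) \<le> ereal (real m)"
    using orth_proj_decomp(1)[OF V(1)] by (intro hausdorff_dim_subspace_le[OF V]) auto
  ultimately show ?thesis by (simp add: hausdorff_profile_def)
qed


section \<open>Dyadic content\<close>

text \<open>Half-open dyadic cubes of side 2^-k, each named by any of its points. The partitions are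
  nested, so two cells are disjoint or one contains the other.\<close>

definition dcell :: "nat \<Rightarrow> 'a::euclidean_space \<Rightarrow> 'a set"
  where "dcell k x = {y. \<forall>b\<in>Basis. \<lfloor>2 ^ k * (y \<bullet> b)\<rfloor> = \<lfloor>2 ^ k * (x \<bullet> b)\<rfloor>}"

lemma dcell_self [simp]: "x \<in> dcell k x"
  by (simp add: dcell_def)

lemma dcell_eq: "y \<in> dcell k x \<Longrightarrow> dcell k y = dcell k x"
  by (auto simp: dcell_def)

lemma dcell_eqI: "z \<in> dcell k x \<Longrightarrow> z \<in> dcell k y \<Longrightarrow> dcell k x = dcell k y"
  using dcell_eq by metis

lemma floor_double: "\<lfloor>2 ^ Suc k * t\<rfloor> div 2 = \<lfloor>2 ^ k * t\<rfloor>" for t :: real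
  using floor_divide_real_eq_div[of 2 "2 ^ Suc k * t"] by simp

lemma dcell_Suc_subset: "dcell (Suc k) x \<subseteq> dcell k x"
proof
  fix y assume y: "y \<in> dcell (Suc k) x"
  have "\<lfloor>2 ^ k * (y \<bullet> b)\<rfloor> = \<lfloor>2 ^ k * (x \<bullet> b)\<rfloor>" if "b \<in> Basis" for b
    using y that unfolding dcell_def mem_Collect_eq by (metis floor_double)
  then show "y \<in> dcell k x" by (simp add: dcell_def)
qed

lemma dcell_antimono: "j \<le> k \<Longrightarrow> dcell k x \<subseteq> dcell j x"
  by (rule lift_Suc_antimono_le[of "\<lambda>k. dcell k x"]) (rule dcell_Suc_subset)

lemma dist_dcell:
  fixes x y :: "'a::euclidean_space"
  assumes "y \<in> dcell k x"
  shows "dist x y \<le> DIM('a) * (1 / 2) ^ k"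
proof -
  have "\<bar>(x - y) \<bullet> b\<bar> \<le> (1 / 2) ^ k" if b: "b \<in> Basis" for b
  proof -
    have "\<lfloor>2 ^ k * (y \<bullet> b)\<rfloor> = \<lfloor>2 ^ k * (x \<bullet> b)\<rfloor>" using assms b by (simp add: dcell_def)
    then have "\<bar>2 ^ k * (x \<bullet> b) - 2 ^ k * (y \<bullet> b)\<bar> \<le> 1" by linarith
    moreover have "2 ^ k * (x \<bullet> b) - 2 ^ k * (y \<bullet> b) = 2 ^ k * ((x - y) \<bullet> b)"
      by (simp add: inner_diff_left right_diff_distrib)
    ultimately show ?thesis by (simp add: abs_mult power_one_over field_simps)
  qed
  then have "(\<Sum>b\<in>Basis. \<bar>(x - y) \<bullet> b\<bar>) \<le> of_nat DIM('a) * (1 / 2) ^ k" by (intro sum_bounded_above)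
  then show ?thesis using norm_le_l1[of "x - y"] by (simp add: dist_norm)
qed

lemma card_dcell_image:
  fixes B :: "'a::euclidean_space set"
  assumes "\<And>y b. y \<in> B \<Longrightarrow> b \<in> Basis \<Longrightarrow> \<lfloor>2 ^ k * (y \<bullet> b)\<rfloor> \<in> I b"
    and I: "\<And>b. b \<in> Basis \<Longrightarrow> finite (I b)" "\<And>b. b \<in> Basis \<Longrightarrow> card (I b) \<le> N"
  shows "finite (dcell k ` B)" and "card (dcell k ` B) \<le> N ^ DIM('a)"
proof -
  let ?g = "\<lambda>c. {y :: 'a. \<forall>b\<in>Basis. \<lfloor>2 ^ k * (y \<bullet> b)\<rfloor> = c b}"
  let ?c = "\<lambda>y :: 'a. restrict (\<lambda>b. \<lfloor>2 ^ k * (y \<bullet> b)\<rfloor>) Basis"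
  have sub: "dcell k ` B \<subseteq> ?g ` PiE Basis I"
  proof
    fix Q assume "Q \<in> dcell k ` B"
    then obtain y where y: "y \<in> B" "Q = dcell k y" by blast
    have "?c y \<in> PiE Basis I" using assms(1) y by auto
    moreover have "Q = ?g (?c y)" using y by (auto simp: dcell_def)
    ultimately show "Q \<in> ?g ` PiE Basis I" by blast
  qed
  have fin: "finite (PiE (Basis :: 'a set) I)" using I by (intro finite_PiE) auto
  then show "finite (dcell k ` B)" using sub by (meson finite_imageI finite_subset)
  have "card (dcell k ` B) \<le> card (PiE (Basis :: 'a set) I)"
    using card_mono[OF finite_imageI[OF fin] sub] card_image_le[OF fin, of ?g] by linarith
  also have "\<dots> = (\<Prod>b\<in>Basis. card (I b))" by (simp add: card_PiE)
  also have "\<dots> \<le> (\<Prod>b\<in>(Basis :: 'a set). N)" by (rule prod_mono) (use I in auto)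
  finally show "card (dcell k ` B) \<le> N ^ DIM('a)" by simp
qed

text \<open>Moving by at most one side length changes each floor by at most 1, which leaves 3 values
  per coordinate.\<close>

lemma card_dcell_cball:
  fixes p :: "'a::euclidean_space"
  shows "finite (dcell k ` cball p ((1 / 2) ^ k))" and "card (dcell k ` cball p ((1 / 2) ^ k)) \<le> 3 ^ DIM('a)"
proof -
  let ?I = "\<lambda>b. {\<lfloor>2 ^ k * (p \<bullet> b)\<rfloor> - 1..\<lfloor>2 ^ k * (p \<bullet> b)\<rfloor> + 1}"
  have mem: "\<lfloor>2 ^ k * (y \<bullet> b)\<rfloor> \<in> ?I b" if y: "y \<in> cball p ((1 / 2) ^ k)" and b: "b \<in> Basis" for y b
  proof -
    have "\<bar>(p - y) \<bullet> b\<bar> \<le> (1 / 2) ^ k" using Basis_le_norm[OF b, of "p - y"] y by (simp add: dist_norm)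
    then have "2 ^ k * \<bar>(p - y) \<bullet> b\<bar> \<le> 1" by (simp add: power_one_over field_simps)
    moreover have "2 ^ k * (p \<bullet> b) - 2 ^ k * (y \<bullet> b) = 2 ^ k * ((p - y) \<bullet> b)"
      by (simp add: inner_diff_left right_diff_distrib)
    ultimately have "\<bar>2 ^ k * (p \<bullet> b) - 2 ^ k * (y \<bullet> b)\<bar> \<le> 1" by (simp add: abs_mult)
    then show ?thesis by (simp, linarith)
  qed
  show "finite (dcell k ` cball p ((1 / 2) ^ k))" by (rule card_dcell_image(1)[OF mem, where N = 3]) auto
  show "card (dcell k ` cball p ((1 / 2) ^ k)) \<le> 3 ^ DIM('a)" by (rule card_dcell_image(2)[OF mem]) auto
qed

lemma finite_dcell_children: "finite (dcell (Suc k) ` dcell k (x :: 'a::euclidean_space))"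
proof (rule card_dcell_image(1))
  fix y b :: 'a assume "y \<in> dcell k x" "b \<in> Basis"
  then have "\<lfloor>2 ^ Suc k * (y \<bullet> b)\<rfloor> div 2 = \<lfloor>2 ^ k * (x \<bullet> b)\<rfloor>" unfolding floor_double by (simp add: dcell_def)
  then show "\<lfloor>2 ^ Suc k * (y \<bullet> b)\<rfloor> \<in> {2 * \<lfloor>2 ^ k * (x \<bullet> b)\<rfloor>..2 * \<lfloor>2 ^ k * (x \<bullet> b)\<rfloor> + 1}" by simp linarith
qed auto

lemma countable_dcell: "countable (range (dcell k :: 'a::euclidean_space \<Rightarrow> 'a set))"
proof -
  let ?g = "\<lambda>c. {y :: 'a. \<forall>b\<in>Basis. \<lfloor>2 ^ k * (y \<bullet> b)\<rfloor> = c b}"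
  let ?c = "\<lambda>y :: 'a. restrict (\<lambda>b. \<lfloor>2 ^ k * (y \<bullet> b)\<rfloor>) Basis"
  have "range (dcell k) \<subseteq> ?g ` PiE Basis (\<lambda>_. UNIV)"
  proof
    fix Q :: "'a set" assume "Q \<in> range (dcell k)"
    then obtain y where y: "Q = dcell k y" by blast
    have "?c y \<in> PiE Basis (\<lambda>_. UNIV)" by auto
    moreover have "Q = ?g (?c y)" using y by (auto simp: dcell_def)
    ultimately show "Q \<in> ?g ` PiE Basis (\<lambda>_. UNIV)" by blast
  qed
  moreover have "countable (PiE (Basis :: 'a set) (\<lambda>_. UNIV :: int set))" by (intro countable_PiE) auto
  ultimately show ?thesis by (meson countable_image countable_subset)
qed

text \<open>An option type serves as index set of covers so that \<^const>\<open>None\<close> stands for an unused slot.\<close>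
definition dset :: "(nat \<times> 'a::euclidean_space) option \<Rightarrow> 'a set"
  where "dset u = (case u of None \<Rightarrow> {} | Some (k, x) \<Rightarrow> dcell k x)"

text \<open>With \<theta> = 2^-s the cost of a cell is its side length to the power
  \<open>s\<close>.\<close>

definition dcost :: "real \<Rightarrow> (nat \<times> 'a) option \<Rightarrow> ennreal"
  where "dcost \<theta> u = (case u of None \<Rightarrow> 0 | Some (k, x) \<Rightarrow> ennreal (\<theta> ^ k))"

definition dcontent :: "real \<Rightarrow> 'a::euclidean_space set \<Rightarrow> ennreal"
  where "dcontent \<theta> = cover_content UNIV dset (dcost \<theta>)"

lemma dset_simps [simp]: "dset None = {}" "dset (Some (k, x)) = dcell k x"
  and dcost_simps [simp]: "dcost \<theta> None = 0" "dcost \<theta> (Some (k, x)) = ennreal (\<theta> ^ k)"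
  by (auto simp: dset_def dcost_def)

lemma dcontent_mono: "A \<subseteq> B \<Longrightarrow> dcontent \<theta> A \<le> dcontent \<theta> B"
  unfolding dcontent_def by (rule cover_content_mono)

lemma dcontent_UN_le: "dcontent \<theta> (\<Union>i. A i) \<le> (\<Sum>i. dcontent \<theta> (A i))" for A :: "nat \<Rightarrow> _"
  unfolding dcontent_def by (rule cover_content_UN_le)

lemma dcontent_finite_le:
  "finite I \<Longrightarrow> A \<subseteq> (\<Union>i\<in>I. dset (g i)) \<Longrightarrow> dcontent \<theta> A \<le> (\<Sum>i\<in>I. dcost \<theta> (g i))"
  unfolding dcontent_def by (rule cover_content_le_finite[of None]) auto

lemma dcontent_empty [simp]: "dcontent \<theta> {} = 0"
  using dcontent_finite_le[of "{}" "{}"] by simp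

lemma dcontent_Un_le: "dcontent \<theta> (A \<union> B) \<le> dcontent \<theta> A + dcontent \<theta> B"
proof -
  let ?X = "\<lambda>i :: nat. if i = 0 then A else if i = 1 then B else {}"
  have "A \<union> B \<subseteq> (\<Union>i. ?X i)" by (auto split: if_splits intro: exI[of _ "0 :: nat"] exI[of _ "1 :: nat"])
  then have "dcontent \<theta> (A \<union> B) \<le> dcontent \<theta> (\<Union>i. ?X i)" by (rule dcontent_mono)
  also have "\<dots> \<le> (\<Sum>i. dcontent \<theta> (?X i))" by (rule dcontent_UN_le)
  also have "\<dots> = (\<Sum>i\<in>{0, 1}. dcontent \<theta> (?X i))" by (rule suminf_finite) auto
  also have "\<dots> = dcontent \<theta> A + dcontent \<theta> B" by simp
  finally show ?thesis .
qed

lemma dcontent_finite_UN_le: "finite I \<Longrightarrow> dcontent \<theta> (\<Union>i\<in>I. X i) \<le> (\<Sum>i\<in>I. dcontent \<theta> (X i))"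
proof (induction I rule: finite_induct)
  case (insert i I)
  have "dcontent \<theta> (\<Union>i\<in>insert i I. X i) \<le> dcontent \<theta> (X i) + dcontent \<theta> (\<Union>i\<in>I. X i)"
    using dcontent_Un_le[of \<theta> "X i"] by simp
  also have "\<dots> \<le> dcontent \<theta> (X i) + (\<Sum>i\<in>I. dcontent \<theta> (X i))"
    using insert by (intro add_left_mono)
  finally show ?case using insert by simp
qed simp

lemma dcontent_dcell_le: "A \<subseteq> dcell k x \<Longrightarrow> dcontent \<theta> A \<le> ennreal (\<theta> ^ k)"
  using dcontent_finite_le[of "{()}" A "\<lambda>_. Some (k, x)"] by simp

lemma dcontent_lessE:
  assumes "dcontent \<theta> A < y"
  obtains f :: "nat \<Rightarrow> (nat \<times> 'a::euclidean_space) option"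
  where "A \<subseteq> (\<Union>i. dset (f i))" "(\<Sum>i. dcost \<theta> (f i)) < y"
  using assms unfolding dcontent_def by (rule cover_content_lessE)

lemma dcell_subset_unique:
  assumes "y \<in> dset u" "dset u \<subseteq> Q" "dset u \<subseteq> Q'" "Q \<in> range (dcell k)" "Q' \<in> range (dcell k)"
  shows "Q = Q'"
  using assms dcell_eqI[of y k] by blast

text \<open>The converse of subadditivity in an unsaturated cell. A nearly optimal cover costs less
  than \<theta>^k, so it contains only cells of level above \<open>k\<close>; those that meet
  \<open>dcell k x\<close> lie in a single child, and sorting them by child splits the
  cover.\<close>

lemma sum_dcontent_children_le:
  fixes A :: "'a::euclidean_space set"
  assumes \<theta>: "0 < \<theta>" "\<theta> < 1" and small: "dcontent \<theta> (A \<inter> dcell k x) < ennreal (\<theta> ^ k)"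
  shows "(\<Sum>Q\<in>dcell (Suc k) ` dcell k x. dcontent \<theta> (A \<inter> Q)) \<le> dcontent \<theta> (A \<inter> dcell k x)"
proof (rule ennreal_le_epsilon)
  fix e :: real assume fin: "dcontent \<theta> (A \<inter> dcell k x) < top" and e: "0 < e"
  let ?C = "dcell (Suc k) ` dcell k x"
  have finC: "finite ?C" by (rule finite_dcell_children)
  have "dcontent \<theta> (A \<inter> dcell k x) < min (ennreal (\<theta> ^ k)) (dcontent \<theta> (A \<inter> dcell k x) + ennreal e)"
    using small fin e by (simp add: ennreal_add_left_cancel_less[where b = 0, simplified])
  then obtain f where f: "A \<inter> dcell k x \<subseteq> (\<Union>i. dset (f i))"
     "(\<Sum>i. dcost \<theta> (f i)) < min (ennreal (\<theta> ^ k)) (dcontent \<theta> (A \<inter> dcell k x) + ennreal e)"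
    by (rule dcontent_lessE)
  \<comment> \<open>A single cell of level at most \<open>k\<close> would already cost
    \<theta>^k.\<close>
  have level: "k < j" if fi: "f i = Some (j, y)" for i j y
  proof (rule ccontr)
    assume "\<not> k < j"
    then have "\<theta> ^ k \<le> \<theta> ^ j" using \<theta> by (intro power_decreasing) auto
    then have "ennreal (\<theta> ^ k) \<le> dcost \<theta> (f i)" using fi by (simp add: ennreal_leI)
    also have "\<dots> \<le> (\<Sum>i. dcost \<theta> (f i))"
      using sum_le_suminf[of "\<lambda>i. dcost \<theta> (f i)" "{i}"] by simp
    finally show False using f(2) by (metis leD min_less_iff_conj)
  qed
  let ?g = "\<lambda>Q i. if dset (f i) \<subseteq> Q then f i else None"
  have "dcontent \<theta> (A \<inter> Q) \<le> (\<Sum>i. dcost \<theta> (?g Q i))" if Q: "Q \<in> ?C" for Q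
    unfolding dcontent_def
  proof (rule cover_content_le)
    obtain y where y: "y \<in> dcell k x" "Q = dcell (Suc k) y" using Q by blast
    show "A \<inter> Q \<subseteq> (\<Union>i. dset (?g Q i))"
    proof
      fix z assume z: "z \<in> A \<inter> Q"
      then have "z \<in> dcell k x" using y dcell_Suc_subset[of k y] dcell_eq[OF y(1)] by blast
      then obtain i where i: "z \<in> dset (f i)" using f(1) z by blast
      then obtain j w where fi: "f i = Some (j, w)" by (cases "f i") auto
      have "dset (f i) = dcell j z" using i fi dcell_eq[of z j w] by simp
      also have "\<dots> \<subseteq> dcell (Suc k) z" using level[OF fi] by (intro dcell_antimono) simp
      also have "\<dots> = Q" using z y dcell_eq[of z "Suc k" y] by simp
      finally have "z \<in> dset (?g Q i)" using i by simp
      then show "z \<in> (\<Union>i. dset (?g Q i))" by blast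
    qed
  qed simp
  then have "(\<Sum>Q\<in>?C. dcontent \<theta> (A \<inter> Q)) \<le> (\<Sum>Q\<in>?C. \<Sum>i. dcost \<theta> (?g Q i))" by (rule sum_mono)
  also have "\<dots> = (\<Sum>i. \<Sum>Q\<in>?C. dcost \<theta> (?g Q i))" by (rule suminf_sum[symmetric]) simp
  also have "\<dots> \<le> (\<Sum>i. dcost \<theta> (f i))"
  proof (intro suminf_le allI)
    fix i
    show "(\<Sum>Q\<in>?C. dcost \<theta> (?g Q i)) \<le> dcost \<theta> (f i)"
    proof (cases "\<exists>Q\<in>?C. dset (f i) \<subseteq> Q \<and> f i \<noteq> None")
      case False
      then have "(\<Sum>Q\<in>?C. dcost \<theta> (?g Q i)) = (\<Sum>Q\<in>?C. 0)"
        by (intro sum.cong refl) (cases "f i"; auto)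
      then show ?thesis by simp
    next
      case True
      then obtain Q where Q: "Q \<in> ?C" "dset (f i) \<subseteq> Q" "f i \<noteq> None" by blast
      obtain j w where fi: "f i = Some (j, w)" using Q(3) by auto
      have "(\<Sum>Q'\<in>?C. dcost \<theta> (?g Q' i)) = (\<Sum>Q'\<in>?C. if Q' = Q then dcost \<theta> (f i) else 0)"
      proof (intro sum.cong refl)
        fix Q' assume Q': "Q' \<in> ?C"
        have "w \<in> dset (f i)" using fi by simp
        then have "dset (f i) \<subseteq> Q' \<longleftrightarrow> Q' = Q" using dcell_subset_unique[of w "f i" Q' Q "Suc k"] Q Q' by blast
        then show "dcost \<theta> (?g Q' i) = (if Q' = Q then dcost \<theta> (f i) else 0)" by simp
      qed
      then show ?thesis using Q(1) finC by simp
    qed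
  qed auto
  also have "\<dots> \<le> dcontent \<theta> (A \<inter> dcell k x) + ennreal e" using f(2) by (simp add: less_imp_le)
  finally show "(\<Sum>Q\<in>?C. dcontent \<theta> (A \<inter> Q)) \<le> dcontent \<theta> (A \<inter> dcell k x) + ennreal e" .
qed

text \<open>A cover by cells can be refined inside each cell, which gains the factor \<open>c\<close> again and again.\<close>
lemma dcontent_eq_0_of_unsaturated:
  fixes B :: "'a::euclidean_space set"
  assumes c: "0 < c" "c < 1" and \<theta>: "0 < \<theta>" and fin: "dcontent \<theta> B < top"
    and small: "\<And>k x. dcontent \<theta> (B \<inter> dcell k x) \<le> ennreal (c * \<theta> ^ k)"
  shows "dcontent \<theta> B = 0"
proof -
  have le: "dcontent \<theta> B \<le> ennreal c * dcontent \<theta> B + ennreal e" if e: "0 < e" for e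
  proof -
    have "dcontent \<theta> B < dcontent \<theta> B + ennreal e"
      using fin e by (simp add: ennreal_add_left_cancel_less[where b = 0, simplified])
    then obtain f where f: "B \<subseteq> (\<Union>i. dset (f i))" "(\<Sum>i. dcost \<theta> (f i)) < dcontent \<theta> B + ennreal e"
      by (rule dcontent_lessE)
    have "dcontent \<theta> B \<le> dcontent \<theta> (\<Union>i. B \<inter> dset (f i))" using f(1) by (intro dcontent_mono) blast
    also have "\<dots> \<le> (\<Sum>i. dcontent \<theta> (B \<inter> dset (f i)))" by (rule dcontent_UN_le)
    also have "\<dots> \<le> (\<Sum>i. ennreal c * dcost \<theta> (f i))"
    proof (intro suminf_le allI)
      fix i
      show "dcontent \<theta> (B \<inter> dset (f i)) \<le> ennreal c * dcost \<theta> (f i)"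
      proof (cases "f i")
        case (Some u)
        then show ?thesis using c \<theta> small by (cases u) (simp add: ennreal_mult[symmetric])
      qed simp
    qed auto
    also have "\<dots> = ennreal c * (\<Sum>i. dcost \<theta> (f i))" by simp
    also have "\<dots> \<le> ennreal c * (dcontent \<theta> B + ennreal e)" using f(2) by (intro mult_left_mono) auto
    also have "\<dots> = ennreal c * dcontent \<theta> B + ennreal (c * e)"
      using c e by (simp add: distrib_left ennreal_mult)
    also have "\<dots> \<le> ennreal c * dcontent \<theta> B + ennreal e"
      using c e by (intro add_left_mono ennreal_leI) simp
    finally show ?thesis .
  qed
  then have "dcontent \<theta> B \<le> ennreal c * dcontent \<theta> B" by (rule ennreal_le_epsilon)
  moreover obtain r where r: "dcontent \<theta> B = ennreal r" "0 \<le> r" using fin by (cases "dcontent \<theta> B") auto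
  ultimately have "r \<le> c * r" using c by (simp add: ennreal_mult[symmetric] ennreal_le_iff)
  then have "r * (1 - c) \<le> 0" by (simp add: algebra_simps)
  then have "r = 0" using r c by (simp add: mult_le_0_iff)
  then show ?thesis using r by simp
qed

text \<open>
  A cell is saturated if the limiting content of its part of the sets is nearly maximal. The
  maximal saturated cells are affordable, and what they miss has content zero.
\<close>
lemma dcontent_incseq_UN_le_aux:
  fixes A :: "nat \<Rightarrow> 'a::euclidean_space set"
  assumes \<theta>: "0 < \<theta>" "\<theta> < 1" and A: "incseq A" "(\<Union>j. A j) \<subseteq> dcell 0 x0" and c: "0 < c" "c < 1"
  shows "ennreal c * dcontent \<theta> (\<Union>j. A j) \<le> (SUP j. dcontent \<theta> (A j))"
proof -
  define L where "L Q = (SUP j. dcontent \<theta> (A j \<inter> Q))" for Q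
  have inc: "incseq (\<lambda>j. dcontent \<theta> (A j \<inter> Q))" for Q
    using A(1) by (intro incseq_SucI dcontent_mono) (auto simp: incseq_Suc_iff)
  define sat where "sat n Q \<longleftrightarrow> ennreal (c * \<theta> ^ n) \<le> L Q" for n Q
  \<comment> \<open>A stopping rule: \<open>R n\<close> holds the cells of level \<open>n\<close>
    all of whose proper ancestors from \<open>dcell 0 x0\<close> on are unsaturated, so that
    \<open>S n\<close> consists of maximal saturated cells.\<close>
  define R where "R = rec_nat {dcell 0 x0} (\<lambda>n Rn. dcell (Suc n) ` \<Union>{Q \<in> Rn. \<not> sat n Q})"
  have R0: "R 0 = {dcell 0 x0}" and RS: "R (Suc n) = dcell (Suc n) ` \<Union>{Q \<in> R n. \<not> sat n Q}" for n
    by (simp_all add: R_def)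
  have Rcell: "Q \<in> range (dcell n)" if "Q \<in> R n" for n Q using that by (cases n) (auto simp: R0 RS)
  have RS': "R (Suc n) = (\<Union>Q\<in>{Q \<in> R n. \<not> sat n Q}. dcell (Suc n) ` Q)" for n by (auto simp: RS)
  have finR: "finite (R n)" for n
  proof (induction n)
    case (Suc n)
    have "finite (dcell (Suc n) ` Q)" if "Q \<in> R n" for Q
      using Rcell[OF that] finite_dcell_children by auto
    then show ?case unfolding RS' using Suc by (intro finite_UN_I) auto
  qed (simp add: R0)
  define S where "S n = {Q \<in> R n. sat n Q}" for n
  have finS: "finite (S n)" for n using finR by (simp add: S_def)
  have child: "(\<Sum>Q'\<in>dcell (Suc n) ` Q. L Q') \<le> L Q" if Q: "Q \<in> R n" "\<not> sat n Q" for n Q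
  proof -
    obtain x where x: "Q = dcell n x" using Rcell[OF Q(1)] by blast
    have "(\<Sum>Q'\<in>dcell (Suc n) ` Q. L Q') = (SUP j. \<Sum>Q'\<in>dcell (Suc n) ` Q. dcontent \<theta> (A j \<inter> Q'))"
      unfolding L_def by (rule ennreal_SUP_sum[symmetric]) (rule inc)
    also have "\<dots> \<le> L Q"
    proof (rule SUP_least)
      fix j
      have le: "dcontent \<theta> (A j \<inter> Q) \<le> L Q" unfolding L_def by (rule SUP_upper) simp
      also have "L Q < ennreal (c * \<theta> ^ n)" using Q(2) by (simp add: sat_def)
      also have "\<dots> \<le> ennreal (\<theta> ^ n)" using c \<theta> by (intro ennreal_leI) simp
      finally have "(\<Sum>Q'\<in>dcell (Suc n) ` Q. dcontent \<theta> (A j \<inter> Q')) \<le> dcontent \<theta> (A j \<inter> Q)"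
        unfolding x by (rule sum_dcontent_children_le[OF \<theta>])
      then show "(\<Sum>Q'\<in>dcell (Suc n) ` Q. dcontent \<theta> (A j \<inter> Q')) \<le> L Q" using le by (rule order_trans)
    qed
    finally show ?thesis .
  qed
  \<comment> \<open>Replacing unsaturated cells by their children never increases the sum of
    \<open>L\<close>, so all maximal saturated cells together fit into the value of \<open>L\<close>
    at the top.\<close>
  have conserve: "(\<Sum>n<N. \<Sum>Q\<in>S n. L Q) + (\<Sum>Q\<in>R N. L Q) \<le> L (dcell 0 x0)" for N
  proof (induction N)
    case (Suc N)
    let ?U = "{Q \<in> R N. \<not> sat N Q}"
    have "(\<Sum>Q\<in>R (Suc N). L Q) = (\<Sum>Q\<in>?U. \<Sum>Q'\<in>dcell (Suc N) ` Q. L Q')"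
      unfolding RS'
    proof (rule sum.UNION_disjoint)
      show "finite ?U" using finR by simp
      show "\<forall>Q\<in>?U. finite (dcell (Suc N) ` Q)" using Rcell finite_dcell_children by fastforce
      show "\<forall>Q\<in>?U. \<forall>Q'\<in>?U. Q \<noteq> Q' \<longrightarrow> dcell (Suc N) ` Q \<inter> dcell (Suc N) ` Q' = {}"
      proof (intro ballI impI, rule ccontr)
        fix Q Q' assume Q: "Q \<in> ?U" "Q' \<in> ?U" "Q \<noteq> Q'" "dcell (Suc N) ` Q \<inter> dcell (Suc N) ` Q' \<noteq> {}"
        then obtain y y' where y: "y \<in> Q" "y' \<in> Q'" "dcell (Suc N) y = dcell (Suc N) y'" by blast
        obtain x x' where x: "Q = dcell N x" "Q' = dcell N x'" using Rcell Q by blast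
        have "y \<in> dcell N y'" using y(3) dcell_self[of y "Suc N"] dcell_Suc_subset[of N y'] by blast
        then have "Q = Q'" using x y dcell_eq[of y N y'] dcell_eq[of y N x] dcell_eq[of y' N x'] by simp
        then show False using Q by simp
      qed
    qed
    also have "\<dots> \<le> (\<Sum>Q\<in>?U. L Q)" by (rule sum_mono) (use child in auto)
    finally have 1: "(\<Sum>Q\<in>R (Suc N). L Q) \<le> (\<Sum>Q\<in>?U. L Q)" .
    have "(\<Sum>Q\<in>R N. L Q) = (\<Sum>Q\<in>S N \<union> ?U. L Q)" by (rule sum.cong) (auto simp: S_def)
    also have "\<dots> = (\<Sum>Q\<in>S N. L Q) + (\<Sum>Q\<in>?U. L Q)"
      using finR by (intro sum.union_disjoint) (auto simp: S_def)
    finally have 2: "(\<Sum>Q\<in>R N. L Q) = (\<Sum>Q\<in>S N. L Q) + (\<Sum>Q\<in>?U. L Q)" .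
    have "(\<Sum>n<Suc N. \<Sum>Q\<in>S n. L Q) + (\<Sum>Q\<in>R (Suc N). L Q)
        \<le> (\<Sum>n<N. \<Sum>Q\<in>S n. L Q) + (\<Sum>Q\<in>S N. L Q) + (\<Sum>Q\<in>?U. L Q)"
      using 1 by (simp add: add_left_mono)
    also have "\<dots> \<le> L (dcell 0 x0)" using Suc 2 by (simp add: add.assoc)
    finally show ?case .
  qed (simp add: R0)
  have AL: "L (dcell 0 x0) = (SUP j. dcontent \<theta> (A j))"
  proof -
    have "A j \<inter> dcell 0 x0 = A j" for j using A(2) by blast
    then show ?thesis by (simp add: L_def)
  qed
  let ?S = "\<Union>n. \<Union>(S n)"
  have "ennreal c * dcontent \<theta> ?S \<le> ennreal c * (\<Sum>n. dcontent \<theta> (\<Union>(S n)))"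
    by (intro mult_left_mono dcontent_UN_le) simp
  also have "\<dots> = (\<Sum>n. ennreal c * dcontent \<theta> (\<Union>(S n)))" by simp
  also have "\<dots> \<le> (\<Sum>n. \<Sum>Q\<in>S n. L Q)"
  proof (intro suminf_le allI)
    fix n
    have "\<exists>x. Q = dcell n x" if "Q \<in> S n" for Q using Rcell that by (auto simp: S_def)
    then obtain g where g: "\<And>Q. Q \<in> S n \<Longrightarrow> Q = dcell n (g Q)" by metis
    have "dcontent \<theta> (\<Union>(S n)) \<le> (\<Sum>Q\<in>S n. dcost \<theta> (Some (n, g Q)))"
      by (rule dcontent_finite_le[OF finS]) (use g in auto)
    then have "ennreal c * dcontent \<theta> (\<Union>(S n)) \<le> ennreal c * (\<Sum>Q\<in>S n. ennreal (\<theta> ^ n))"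
      by (intro mult_left_mono) auto
    also have "\<dots> = (\<Sum>Q\<in>S n. ennreal (c * \<theta> ^ n))"
      using c \<theta> by (subst sum_distrib_left, intro sum.cong) (auto simp: ennreal_mult)
    also have "\<dots> \<le> (\<Sum>Q\<in>S n. L Q)" by (rule sum_mono) (auto simp: S_def sat_def)
    finally show "ennreal c * dcontent \<theta> (\<Union>(S n)) \<le> (\<Sum>Q\<in>S n. L Q)" .
  qed auto
  also have "\<dots> \<le> L (dcell 0 x0)"
  proof (rule suminf_le_const)
    fix N show "(\<Sum>n<N. \<Sum>Q\<in>S n. L Q) \<le> L (dcell 0 x0)"
      using conserve[of N] by (rule order_trans[rotated]) simp
  qed simp
  finally have S_le: "ennreal c * dcontent \<theta> ?S \<le> (SUP j. dcontent \<theta> (A j))" unfolding AL .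
  \<comment> \<open>The points in no saturated cell. Every cell that meets \<open>T\<close> is
    unsaturated, so each \<open>T \<inter> A j\<close> satisfies the hypothesis that gains the
    factor \<open>c\<close> repeatedly.\<close>
  define T where "T = {x \<in> \<Union>j. A j. \<forall>n. dcell n x \<in> R n \<and> \<not> sat n (dcell n x)}"
  have cov: "(\<Union>j. A j) \<subseteq> ?S \<union> T"
  proof
    fix x assume x: "x \<in> (\<Union>j. A j)"
    show "x \<in> ?S \<union> T"
    proof (cases "\<exists>n. dcell n x \<in> S n")
      case True
      then obtain n where "dcell n x \<in> S n" by blast
      then show ?thesis using dcell_self[of x n] by blast
    next
      case False
      have "dcell n x \<in> R n" for n
      proof (induction n)
        case 0
        have "x \<in> dcell 0 x0" using x A(2) by blast
        then show ?case by (simp add: R0 dcell_eq)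
      next
        case (Suc n)
        then have "\<not> sat n (dcell n x)" using False by (auto simp: S_def)
        then show ?case unfolding RS' using Suc dcell_self[of x n] by blast
      qed
      then have "x \<in> T" using x False by (auto simp: T_def S_def)
      then show ?thesis by blast
    qed
  qed
  have "dcontent \<theta> (T \<inter> A j) = 0" for j
  proof (rule dcontent_eq_0_of_unsaturated[OF c \<theta>(1)])
    have "dcontent \<theta> (T \<inter> A j) \<le> ennreal (\<theta> ^ 0)" using A(2) by (intro dcontent_dcell_le) blast
    then show "dcontent \<theta> (T \<inter> A j) < top" by (rule le_less_trans) simp
    fix k x
    show "dcontent \<theta> (T \<inter> A j \<inter> dcell k x) \<le> ennreal (c * \<theta> ^ k)"
    proof (cases "T \<inter> A j \<inter> dcell k x = {}")
      case False
      then obtain z where z: "z \<in> T" "z \<in> dcell k x" by blast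
      have "dcontent \<theta> (T \<inter> A j \<inter> dcell k x) \<le> dcontent \<theta> (A j \<inter> dcell k z)"
        using dcell_eq[OF z(2)] by (intro dcontent_mono) blast
      also have "\<dots> \<le> L (dcell k z)" unfolding L_def by (rule SUP_upper) simp
      also have "\<dots> \<le> ennreal (c * \<theta> ^ k)" using z(1) by (auto simp: T_def sat_def not_le intro: less_imp_le)
      finally show ?thesis .
    qed simp
  qed
  then have "(\<Sum>j. dcontent \<theta> (T \<inter> A j)) = 0" by simp
  moreover have "T \<subseteq> (\<Union>j. T \<inter> A j)" by (auto simp: T_def)
  then have "dcontent \<theta> T \<le> (\<Sum>j. dcontent \<theta> (T \<inter> A j))"
    by (rule order_trans[OF dcontent_mono dcontent_UN_le])
  ultimately have T0: "dcontent \<theta> T = 0" by simp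
  have "dcontent \<theta> (\<Union>j. A j) \<le> dcontent \<theta> ?S + dcontent \<theta> T"
    using dcontent_mono[OF cov] dcontent_Un_le by (rule order_trans)
  then have "ennreal c * dcontent \<theta> (\<Union>j. A j) \<le> ennreal c * dcontent \<theta> ?S"
    using T0 by (intro mult_left_mono) auto
  then show ?thesis using S_le by (rule order_trans)
qed

lemma dcontent_incseq_UN_less:
  fixes A :: "nat \<Rightarrow> 'a::euclidean_space set"
  assumes \<theta>: "0 < \<theta>" "\<theta> < 1" and A: "incseq A" "(\<Union>j. A j) \<subseteq> dcell 0 x0"
    and t: "0 \<le> t" "ennreal t < dcontent \<theta> (\<Union>j. A j)"
  obtains j where "ennreal t < dcontent \<theta> (A j)"
proof -
  have "dcontent \<theta> (\<Union>j. A j) \<le> ennreal (\<theta> ^ 0)" using A(2) by (rule dcontent_dcell_le)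
  then obtain M where M: "dcontent \<theta> (\<Union>j. A j) = ennreal M" "0 \<le> M"
    by (cases "dcontent \<theta> (\<Union>j. A j)") (auto simp: top_unique)
  have tM: "t < M" using t M by (simp add: ennreal_less_iff)
  \<comment> \<open>Makes \<open>c * M\<close> the midpoint of \<open>t\<close> and
    \<open>M\<close>.\<close>
  define c where "c = (t + M) / (2 * M)"
  have c: "0 < c" "c < 1" using tM t(1) by (auto simp: c_def field_simps)
  have "t < c * M" using tM t(1) by (simp add: c_def field_simps)
  then have "ennreal t < ennreal c * ennreal M" using c M t by (simp add: ennreal_mult[symmetric] ennreal_less_iff)
  also have "\<dots> \<le> (SUP j. dcontent \<theta> (A j))"
    using dcontent_incseq_UN_le_aux[OF \<theta> A c] M by simp
  finally show thesis using that by (auto simp: less_SUP_iff)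
qed


section \<open>Hausdorff dimension of projections\<close>

text \<open>
  The finite-level form of Frostman's lemma: the mass of a cell is split among its children in
  proportion to the contents of their parts of \<open>A\<close>.
\<close>
lemma dcontent_weights:
  fixes A :: "'a::euclidean_space set"
  assumes \<theta>: "0 < \<theta>" "\<theta> < 1"
  shows "0 \<le> a \<Longrightarrow> ennreal a \<le> dcontent \<theta> (A \<inter> dcell k x) \<Longrightarrow>
    \<exists>w :: 'a \<Rightarrow> real. finite {p. w p \<noteq> 0} \<and> (\<forall>p. 0 \<le> w p) \<and> {p. w p \<noteq> 0} \<subseteq> A \<inter> dcell k x
      \<and> (\<Sum>p | w p \<noteq> 0. w p) = a
      \<and> (\<forall>j y. k \<le> j \<longrightarrow> j \<le> k + N \<longrightarrow> (\<Sum>p\<in>{p. w p \<noteq> 0} \<inter> dcell j y. w p) \<le> \<theta> ^ j)"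
proof (induction N arbitrary: k x a)
  case 0
  have "ennreal a \<le> ennreal (\<theta> ^ k)" using 0(2) dcontent_dcell_le[of "A \<inter> dcell k x" k x \<theta>] by (auto intro: order_trans)
  then have a\<theta>: "a \<le> \<theta> ^ k" using \<theta> by (simp add: ennreal_le_iff)
  show ?case
  proof (cases "a = 0")
    case True
    then show ?thesis using \<theta> by (intro exI[of _ "\<lambda>_. 0"]) auto
  next
    case False
    \<comment> \<open>At the last level all mass is put on one point, which exists for a > 0 because
      the empty set has content 0.\<close>
    have "A \<inter> dcell k x \<noteq> {}"
    proof
      assume "A \<inter> dcell k x = {}"
      then have "ennreal a \<le> 0" using 0(2) by simp
      then show False using False 0(1) by simp
    qed
    then obtain p where p: "p \<in> A \<inter> dcell k x" by blast
    let ?w = "\<lambda>q. if q = p then a else 0"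
    have supp: "{q. ?w q \<noteq> 0} = {p}" using False by auto
    have "(\<Sum>q\<in>{p} \<inter> dcell j y. ?w q) \<le> \<theta> ^ j" if "k \<le> j" "j \<le> k + 0" for j y
    proof (cases "p \<in> dcell j y")
      case True
      then show ?thesis using that a\<theta> by simp
    next
      case False
      then show ?thesis using \<theta> by simp
    qed
    then show ?thesis using p 0(1) supp by (intro exI[of _ ?w]) (auto simp del: le_add_same_cancel1 add_0_right)
  qed
next
  case (Suc N)
  let ?C = "dcell (Suc k) ` dcell k x"
  have finC: "finite ?C" by (rule finite_dcell_children)
  have Qsub: "Q \<subseteq> dcell k x" if Q: "Q \<in> ?C" for Q
  proof -
    obtain y where y: "y \<in> dcell k x" "Q = dcell (Suc k) y" using Q by blast
    then show ?thesis using dcell_Suc_subset[of k y] dcell_eq[OF y(1)] by simp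
  qed
  have Qeq: "dcell (Suc k) p = Q" if "Q \<in> ?C" "p \<in> Q" for p Q
    using that dcell_eq by blast
  define m where "m Q = enn2real (dcontent \<theta> (A \<inter> Q))" for Q
  have m: "ennreal (m Q) = dcontent \<theta> (A \<inter> Q)" if Q: "Q \<in> ?C" for Q
  proof -
    obtain y where y: "Q = dcell (Suc k) y" using Q by blast
    have "dcontent \<theta> (A \<inter> Q) \<le> ennreal (\<theta> ^ Suc k)" unfolding y by (rule dcontent_dcell_le[OF Int_lower2])
    then have "dcontent \<theta> (A \<inter> Q) < top" by (rule le_less_trans) simp
    then show ?thesis by (simp add: m_def)
  qed
  have m0: "0 \<le> m Q" for Q by (simp add: m_def)
  define M where "M = (\<Sum>Q\<in>?C. m Q)"
  have "ennreal a \<le> dcontent \<theta> (A \<inter> dcell k x)" by (rule Suc.prems)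
  also have "\<dots> \<le> dcontent \<theta> (\<Union>Q\<in>?C. A \<inter> Q)"
    using dcell_self by (intro dcontent_mono) blast
  also have "\<dots> \<le> (\<Sum>Q\<in>?C. dcontent \<theta> (A \<inter> Q))" by (rule dcontent_finite_UN_le[OF finC])
  also have "\<dots> = (\<Sum>Q\<in>?C. ennreal (m Q))" by (rule sum.cong) (simp_all add: m)
  also have "\<dots> = ennreal M" unfolding M_def by (rule sum_ennreal) (rule m0)
  finally have aM: "a \<le> M" using m0 by (simp add: ennreal_le_iff M_def sum_nonneg)
  \<comment> \<open>Subadditivity gives \<open>a \<le> M\<close>, so a share of \<open>a\<close>
    proportional to \<open>m Q\<close> never exceeds \<open>m Q\<close>, and the induction
    hypothesis applies to it. For M = 0 also a = 0.\<close>
  define b where "b Q = (if M = 0 then 0 else a * m Q / M)" for Q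
  have M0: "0 \<le> M" unfolding M_def using m0 by (rule sum_nonneg)
  have b0: "0 \<le> b Q" for Q using Suc.prems(1) m0 M0 by (simp add: b_def)
  have bm: "b Q \<le> m Q" for Q
  proof (cases "M = 0")
    case False
    then have "a * m Q \<le> M * m Q" using aM m0 by (intro mult_right_mono) auto
    then show ?thesis using False M0 by (simp add: b_def field_simps)
  qed (simp add: b_def m0)
  have bsum: "(\<Sum>Q\<in>?C. b Q) = a"
  proof (cases "M = 0")
    case True
    then show ?thesis using aM Suc.prems(1) by (simp add: b_def)
  next
    case False
    then have "(\<Sum>Q\<in>?C. b Q) = a * M / M" by (simp add: b_def M_def sum_distrib_left sum_divide_distrib)
    then show ?thesis using False by simp
  qed
  have "\<forall>Q\<in>?C. \<exists>w :: 'a \<Rightarrow> real. finite {p. w p \<noteq> 0} \<and> (\<forall>p. 0 \<le> w p) \<and> {p. w p \<noteq> 0} \<subseteq> A \<inter> Q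
      \<and> (\<Sum>p | w p \<noteq> 0. w p) = b Q
      \<and> (\<forall>j y. Suc k \<le> j \<longrightarrow> j \<le> Suc k + N \<longrightarrow> (\<Sum>p\<in>{p. w p \<noteq> 0} \<inter> dcell j y. w p) \<le> \<theta> ^ j)"
  proof
    fix Q assume Q: "Q \<in> ?C"
    then obtain y where y: "Q = dcell (Suc k) y" by blast
    have "ennreal (b Q) \<le> dcontent \<theta> (A \<inter> dcell (Suc k) y)"
      using m[OF Q] bm[of Q] by (metis ennreal_leI y)
    from Suc.IH[OF b0 this] show "\<exists>w :: 'a \<Rightarrow> real. finite {p. w p \<noteq> 0} \<and> (\<forall>p. 0 \<le> w p) \<and> {p. w p \<noteq> 0} \<subseteq> A \<inter> Q
      \<and> (\<Sum>p | w p \<noteq> 0. w p) = b Q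
      \<and> (\<forall>j y. Suc k \<le> j \<longrightarrow> j \<le> Suc k + N \<longrightarrow> (\<Sum>p\<in>{p. w p \<noteq> 0} \<inter> dcell j y. w p) \<le> \<theta> ^ j)"
      unfolding y .
  qed
  from bchoice[OF this] obtain W where W0: "\<forall>Q\<in>?C. finite {p. W Q p \<noteq> 0} \<and> (\<forall>p. 0 \<le> W Q p) \<and> {p. W Q p \<noteq> 0} \<subseteq> A \<inter> Q
      \<and> (\<Sum>p | W Q p \<noteq> 0. W Q p) = b Q
      \<and> (\<forall>j y. Suc k \<le> j \<longrightarrow> j \<le> Suc k + N \<longrightarrow> (\<Sum>p\<in>{p. W Q p \<noteq> 0} \<inter> dcell j y. W Q p) \<le> \<theta> ^ j)" ..
  then have W: "finite {p. W Q p \<noteq> 0}" "0 \<le> W Q p" "{p. W Q p \<noteq> 0} \<subseteq> A \<inter> Q" "(\<Sum>p | W Q p \<noteq> 0. W Q p) = b Q"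
      "Suc k \<le> j \<Longrightarrow> j \<le> Suc k + N \<Longrightarrow> (\<Sum>p\<in>{p. W Q p \<noteq> 0} \<inter> dcell j y. W Q p) \<le> \<theta> ^ j"
    if "Q \<in> ?C" for Q p j y using bspec[OF W0 that] by blast+
  define w where "w p = (if p \<in> dcell k x then W (dcell (Suc k) p) p else 0)" for p
  have wQ: "w p = W Q p" if "Q \<in> ?C" "p \<in> Q" for Q p
    using Qeq[OF that] Qsub[OF that(1)] that(2) by (auto simp: w_def)
  have supp: "{p. w p \<noteq> 0} = (\<Union>Q\<in>?C. {p. W Q p \<noteq> 0})"
  proof (intro equalityI subsetI)
    fix p assume p: "p \<in> {p. w p \<noteq> 0}"
    then have "p \<in> dcell k x" "W (dcell (Suc k) p) p \<noteq> 0" by (auto simp: w_def split: if_splits)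
    then show "p \<in> (\<Union>Q\<in>?C. {p. W Q p \<noteq> 0})" by blast
  next
    fix p assume "p \<in> (\<Union>Q\<in>?C. {p. W Q p \<noteq> 0})"
    then obtain Q where Q: "Q \<in> ?C" "W Q p \<noteq> 0" by blast
    then have "p \<in> Q" using W(3)[OF Q(1)] by blast
    then show "p \<in> {p. w p \<noteq> 0}" using wQ Q by simp
  qed
  have fin: "finite {p. w p \<noteq> 0}" unfolding supp using finC W(1) by (intro finite_UN_I)
  have nonneg: "0 \<le> w p" for p using W(2) by (auto simp: w_def)
  have sub: "{p. w p \<noteq> 0} \<subseteq> A \<inter> dcell k x" unfolding supp using W(3) Qsub by blast
  have total: "(\<Sum>p | w p \<noteq> 0. w p) = a"
  proof -
    have "(\<Sum>p | w p \<noteq> 0. w p) = (\<Sum>Q\<in>?C. \<Sum>p | W Q p \<noteq> 0. w p)"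
      unfolding supp
    proof (rule sum.UNION_disjoint[OF finC])
      show "\<forall>Q\<in>?C. finite {p. W Q p \<noteq> 0}" using W(1) by blast
      show "\<forall>Q\<in>?C. \<forall>Q'\<in>?C. Q \<noteq> Q' \<longrightarrow> {p. W Q p \<noteq> 0} \<inter> {p. W Q' p \<noteq> 0} = {}"
      proof (intro ballI impI, rule ccontr)
        fix Q Q' assume Q: "Q \<in> ?C" "Q' \<in> ?C" "Q \<noteq> Q'" "{p. W Q p \<noteq> 0} \<inter> {p. W Q' p \<noteq> 0} \<noteq> {}"
        then obtain p where "p \<in> Q" "p \<in> Q'" using W(3)[OF Q(1)] W(3)[OF Q(2)] by blast
        then show False using Qeq Q by blast
      qed
    qed
    also have "\<dots> = (\<Sum>Q\<in>?C. \<Sum>p | W Q p \<noteq> 0. W Q p)"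
      by (intro sum.cong refl wQ) (use W(3) in auto)
    also have "\<dots> = (\<Sum>Q\<in>?C. b Q)" by (rule sum.cong) (simp_all add: W(4))
    finally show ?thesis using bsum by simp
  qed
  \<comment> \<open>Below level \<open>k\<close>, a cell that meets the support lies in one child,
    where the induction hypothesis applies; at level \<open>k\<close> the total mass is the
    bound.\<close>
  have bound: "(\<Sum>p\<in>{p. w p \<noteq> 0} \<inter> dcell j y. w p) \<le> \<theta> ^ j" if j: "k \<le> j" "j \<le> k + Suc N" for j y
  proof (cases "j = k")
    case True
    have "(\<Sum>p\<in>{p. w p \<noteq> 0} \<inter> dcell j y. w p) \<le> (\<Sum>p | w p \<noteq> 0. w p)"
      using nonneg by (intro sum_mono2 fin) auto
    also have "\<dots> = a" by (rule total)
    also have "a \<le> \<theta> ^ k"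
    proof -
      have "ennreal a \<le> ennreal (\<theta> ^ k)"
        using Suc.prems(2) dcontent_dcell_le[of "A \<inter> dcell k x" k x \<theta>] by (auto intro: order_trans)
      then show ?thesis using \<theta> by (simp add: ennreal_le_iff)
    qed
    finally show ?thesis using True by simp
  next
    case False
    then have kj: "Suc k \<le> j" using j by simp
    show ?thesis
    proof (cases "{p. w p \<noteq> 0} \<inter> dcell j y = {}")
      case True
      then show ?thesis using \<theta> by simp
    next
      case nonempty: False
      then obtain z where z: "w z \<noteq> 0" "z \<in> dcell j y" by blast
      let ?Q = "dcell (Suc k) z"
      have Q: "?Q \<in> ?C" using z sub by blast
      have cell: "dcell j y \<subseteq> ?Q" using dcell_antimono[OF kj, of z] dcell_eq[OF z(2)] by simp
      have "{p. w p \<noteq> 0} \<inter> dcell j y = {p. W ?Q p \<noteq> 0} \<inter> dcell j y"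
        using wQ[OF Q] cell by auto
      then have "(\<Sum>p\<in>{p. w p \<noteq> 0} \<inter> dcell j y. w p) = (\<Sum>p\<in>{p. W ?Q p \<noteq> 0} \<inter> dcell j y. W ?Q p)"
        using wQ[OF Q] cell by (intro sum.cong) auto
      also have "\<dots> \<le> \<theta> ^ j" using W(5)[OF Q kj] j by simp
      finally show ?thesis .
    qed
  qed
  show ?case using fin nonneg sub total bound by (intro exI[of _ w]) simp
qed

text \<open>A layer-cake bound: the kernel at scale 2^-j becomes a sum of indicators of balls of
  radius 2^-i with geometric weights, ready to be summed against a Frostman bound. The first summand
  takes care of |z| > 1.\<close>

lemma kernel_phi_dyadic_le:
  "kernel_phi m ((1 / 2) ^ j) z
    \<le> ((1 / 2) ^ m) ^ j + (\<Sum>i\<le>j. 2 ^ m * ((1 / 2) ^ m) ^ (j - i) * of_bool (norm z \<le> (1 / 2) ^ i))"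
proof -
  let ?f = "\<lambda>i. 2 ^ m * ((1 / 2) ^ m) ^ (j - i) * of_bool (norm z \<le> (1 / 2) ^ i) :: real"
  have f0: "0 \<le> ?f i" for i by simp
  show ?thesis
  proof (cases "norm z \<le> 1")
    case False
    then have "kernel_phi m ((1 / 2) ^ j) z \<le> ((1 / 2) ^ j / norm z) ^ m" by (auto simp: kernel_phi_power)
    also have "\<dots> \<le> ((1 / 2) ^ j / 1) ^ m"
      using False by (intro power_mono divide_left_mono) auto
    also have "\<dots> = ((1 / 2) ^ j) ^ m" by simp
    also have "\<dots> = ((1 / 2) ^ m) ^ j" by (simp only: power_mult[symmetric] mult.commute)
    also have "\<dots> \<le> ((1 / 2) ^ m) ^ j + (\<Sum>i\<le>j. ?f i)" using sum_nonneg[of "{..j}" ?f] f0 by simp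
    finally show ?thesis .
  next
    case True
    \<comment> \<open>The finest level up to \<open>j\<close> whose ball contains \<open>z\<close>.
      Unless i = j, the next finer ball misses \<open>z\<close>, and the factor 2 between the two
      radii becomes 2^m.\<close>
    define i where "i = (GREATEST i. i \<le> j \<and> norm z \<le> (1 / 2) ^ i)"
    have ex: "0 \<le> j \<and> norm z \<le> (1 / 2) ^ 0" using True by simp
    have i: "i \<le> j" "norm z \<le> (1 / 2) ^ i"
      using GreatestI_nat[of "\<lambda>i. i \<le> j \<and> norm z \<le> (1 / 2) ^ i", OF ex, of j] unfolding i_def by auto
    have "kernel_phi m ((1 / 2) ^ j) z \<le> 2 ^ m * ((1 / 2) ^ m) ^ (j - i)"
    proof (cases "i = j")
      case True
      have "kernel_phi m ((1 / 2) ^ j) z \<le> 1" by simp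
      also have "(1 :: real) \<le> 2 ^ m" by simp
      finally show ?thesis using True by simp
    next
      case False
      then have ij: "Suc i \<le> j" using i by simp
      have "\<not> norm z \<le> (1 / 2) ^ Suc i"
      proof
        assume "norm z \<le> (1 / 2) ^ Suc i"
        then have "Suc i \<le> i" 
          using Greatest_le_nat[of "\<lambda>i'. i' \<le> j \<and> norm z \<le> (1 / 2) ^ i'" "Suc i" j] ij
          unfolding i_def[symmetric] by auto
        then show False by simp
      qed
      then have far: "(1 / 2) ^ Suc i < norm z" by simp
      have z0: "0 < norm z" using far by (rule less_trans[rotated]) simp
      have "kernel_phi m ((1 / 2) ^ j) z \<le> ((1 / 2) ^ j / norm z) ^ m" using z0 by (auto simp: kernel_phi_power)
      also have "\<dots> \<le> ((1 / 2) ^ j / (1 / 2) ^ Suc i) ^ m"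
        using far z0 by (intro power_mono divide_left_mono) auto
      also have "(1 / 2) ^ j / (1 / 2) ^ Suc i = (2 * (1 / 2) ^ (j - i) :: real)"
        using i by (simp add: power_diff)
      also have "(2 * (1 / 2) ^ (j - i) :: real) ^ m = 2 ^ m * ((1 / 2) ^ m) ^ (j - i)"
        by (simp only: power_mult_distrib power_mult[symmetric] mult.commute)
      finally show ?thesis .
    qed
    also have "\<dots> = ?f i" using i by simp
    also have "\<dots> \<le> (\<Sum>i\<le>j. ?f i)" by (rule member_le_sum) (use i in auto)
    also have "\<dots> \<le> ((1 / 2) ^ m) ^ j + (\<Sum>i\<le>j. ?f i)" by simp
    finally show ?thesis .
  qed
qed

text \<open>At most \<open>3 ^ DIM('a)\<close> cells of level \<open>i\<close> meet the
  ball.\<close>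

lemma sum_weights_cball_le:
  fixes w :: "'a::euclidean_space \<Rightarrow> real"
  assumes S: "finite S" "\<And>p. 0 \<le> w p" and bd: "\<And>y. (\<Sum>p\<in>S \<inter> dcell i y. w p) \<le> \<theta> ^ i"
  shows "(\<Sum>q\<in>S \<inter> cball p ((1 / 2) ^ i). w q) \<le> 3 ^ DIM('a) * \<theta> ^ i"
proof -
  let ?B = "S \<inter> cball p ((1 / 2) ^ i)"
  have \<theta>: "0 \<le> \<theta> ^ i" using bd[of 0] sum_nonneg[of "S \<inter> dcell i 0" w] S(2) by (meson order_trans)
  have "(\<Sum>q\<in>?B. w q) = (\<Sum>Q\<in>dcell i ` ?B. \<Sum>q\<in>{q \<in> ?B. dcell i q = Q}. w q)"
    by (rule sum.image_gen) (use S in simp)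
  also have "\<dots> \<le> (\<Sum>Q\<in>dcell i ` ?B. \<theta> ^ i)"
  proof (rule sum_mono)
    fix Q assume "Q \<in> dcell i ` ?B"
    then obtain y where y: "Q = dcell i y" by blast
    have "(\<Sum>q\<in>{q \<in> ?B. dcell i q = Q}. w q) \<le> (\<Sum>q\<in>S \<inter> dcell i y. w q)"
      using S y dcell_self by (intro sum_mono2) auto
    then show "(\<Sum>q\<in>{q \<in> ?B. dcell i q = Q}. w q) \<le> \<theta> ^ i" using bd[of y] by linarith
  qed
  also have "\<dots> = real (card (dcell i ` ?B)) * \<theta> ^ i" by simp
  also have "\<dots> \<le> 3 ^ DIM('a) * \<theta> ^ i"
  proof (rule mult_right_mono[OF _ \<theta>])
    have "card (dcell i ` ?B) \<le> card (dcell i ` cball p ((1 / 2) ^ i))"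
      by (intro card_mono card_dcell_cball(1)) auto
    also have "\<dots> \<le> 3 ^ DIM('a)" by (rule card_dcell_cball(2))
    finally show "real (card (dcell i ` ?B)) \<le> 3 ^ DIM('a)" by (metis of_nat_le_iff of_nat_numeral of_nat_power)
  qed
  finally show ?thesis .
qed

text \<open>2^-m < \<theta> says that the weights have an exponent below \<open>m\<close>: the
  geometric series in \<beta> / \<theta> converges, and the finest scale, of mass \<theta>^j,
  dominates.\<close>

lemma sum_weights_kernel_le:
  fixes w :: "'a::euclidean_space \<Rightarrow> real"
  assumes S: "finite S" "\<And>p. 0 \<le> w p" and bd: "\<And>i y. i \<le> N \<Longrightarrow> (\<Sum>p\<in>S \<inter> dcell i y. w p) \<le> \<theta> ^ i"
    and \<theta>: "(1 / 2) ^ m < \<theta>" and j: "j \<le> N"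
  shows "(\<Sum>q\<in>S. w q * kernel_phi m ((1 / 2) ^ j) (p - q))
    \<le> ((\<Sum>q\<in>S. w q) + 2 ^ m * 3 ^ DIM('a) / (1 - (1 / 2) ^ m / \<theta>)) * \<theta> ^ j"
proof -
  define \<beta> :: real where "\<beta> = (1 / 2) ^ m"
  have \<beta>: "0 < \<beta>" "\<beta> < \<theta>" using \<theta> by (simp_all add: \<beta>_def)
  let ?K = "2 ^ m * 3 ^ DIM('a) :: real"
  have "(\<Sum>q\<in>S. w q * kernel_phi m ((1 / 2) ^ j) (p - q))
      \<le> (\<Sum>q\<in>S. w q * (\<beta> ^ j + (\<Sum>i\<le>j. 2 ^ m * \<beta> ^ (j - i) * of_bool (norm (p - q) \<le> (1 / 2) ^ i))))"
    unfolding \<beta>_def using S(2) by (intro sum_mono mult_left_mono kernel_phi_dyadic_le)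
  also have "\<dots> = (\<Sum>q\<in>S. w q) * \<beta> ^ j
      + (\<Sum>i\<le>j. 2 ^ m * \<beta> ^ (j - i) * (\<Sum>q\<in>S. w q * of_bool (norm (p - q) \<le> (1 / 2) ^ i)))"
    by (simp add: distrib_left sum.distrib sum_distrib_left sum_distrib_right sum.swap[of _ S] mult_ac)
  also have "\<dots> \<le> (\<Sum>q\<in>S. w q) * \<theta> ^ j + (\<Sum>i\<le>j. 2 ^ m * \<beta> ^ (j - i) * (3 ^ DIM('a) * \<theta> ^ i))"
  proof (intro add_mono mult_left_mono sum_mono)
    show "\<beta> ^ j \<le> \<theta> ^ j" using \<beta> by (intro power_mono) auto
    fix i assume i: "i \<in> {..j}"
    have "(\<Sum>q\<in>S. w q * of_bool (norm (p - q) \<le> (1 / 2) ^ i)) = (\<Sum>q\<in>S \<inter> cball p ((1 / 2) ^ i). w q)"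
      using S(1) by (simp add: cball_def dist_norm Int_def)
    also have "\<dots> \<le> 3 ^ DIM('a) * \<theta> ^ i"
      using i j by (intro sum_weights_cball_le S bd) auto
    finally show "(\<Sum>q\<in>S. w q * of_bool (norm (p - q) \<le> (1 / 2) ^ i)) \<le> 3 ^ DIM('a) * \<theta> ^ i" .
  qed (use S \<beta> in \<open>auto simp: sum_nonneg\<close>)
  also have "(\<Sum>i\<le>j. 2 ^ m * \<beta> ^ (j - i) * (3 ^ DIM('a) * \<theta> ^ i)) = ?K * (\<Sum>i\<le>j. \<beta> ^ (j - i) * \<theta> ^ i)"
    by (simp add: sum_distrib_left mult_ac)
  also have "(\<Sum>i\<le>j. \<beta> ^ (j - i) * \<theta> ^ i) = (\<Sum>i\<le>j. (\<beta> / \<theta>) ^ (j - i) * \<theta> ^ j)"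
  proof (rule sum.cong)
    fix i assume "i \<in> {..j}"
    then have "\<theta> ^ j = \<theta> ^ (j - i) * \<theta> ^ i" by (simp add: power_add[symmetric])
    then show "\<beta> ^ (j - i) * \<theta> ^ i = (\<beta> / \<theta>) ^ (j - i) * \<theta> ^ j" using \<beta> by (simp add: power_divide)
  qed simp
  also have "\<dots> = (\<Sum>i\<le>j. (\<beta> / \<theta>) ^ (j - i)) * \<theta> ^ j" by (rule sum_distrib_right[symmetric])
  also have "(\<Sum>i\<le>j. (\<beta> / \<theta>) ^ (j - i)) = (\<Sum>i\<le>j. (\<beta> / \<theta>) ^ i)"
    by (rule sum.nat_diff_reindex[of "\<lambda>i. (\<beta> / \<theta>) ^ i" "Suc j", simplified lessThan_Suc_atMost diff_Suc_1, simplified])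
  finally have *: "(\<Sum>q\<in>S. w q * kernel_phi m ((1 / 2) ^ j) (p - q))
      \<le> (\<Sum>q\<in>S. w q) * \<theta> ^ j + ?K * ((\<Sum>i\<le>j. (\<beta> / \<theta>) ^ i) * \<theta> ^ j)" .
  have "(\<Sum>i\<le>j. (\<beta> / \<theta>) ^ i) \<le> (\<Sum>i. (\<beta> / \<theta>) ^ i)"
    using \<beta> by (intro sum_le_suminf summable_geometric) auto
  also have "\<dots> = 1 / (1 - \<beta> / \<theta>)" using \<beta> by (intro suminf_geometric) auto
  finally have "?K * ((\<Sum>i\<le>j. (\<beta> / \<theta>) ^ i) * \<theta> ^ j) \<le> ?K * (1 / (1 - \<beta> / \<theta>) * \<theta> ^ j)"
    using \<beta> by (intro mult_left_mono mult_right_mono) auto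
  then show ?thesis using * by (simp add: \<beta>_def distrib_right)
qed

text \<open>With \<kappa> = 2^t, t > 0, the inner sum is comparable, for projections within distance
  1, to the distance of the projections to the power -t, cut off at scale 2^-N: a truncated
  \<open>t\<close>-energy of the projected weights. Truncation keeps the diagonal p = q
  finite.\<close>

definition slab_energy :: "real \<Rightarrow> nat \<Rightarrow> ('a::euclidean_space \<Rightarrow> real) \<Rightarrow> 'a set \<Rightarrow> real"
  where "slab_energy \<kappa> N w V = (\<Sum>p | w p \<noteq> 0. \<Sum>q | w q \<noteq> 0.
    w p * w q * (\<Sum>j\<le>N. \<kappa> ^ j * of_bool (norm (orth_proj V (p - q)) \<le> (1 / 2) ^ j)))"

lemma slab_energy_nonneg: "0 \<le> \<kappa> \<Longrightarrow> (\<And>p. 0 \<le> w p) \<Longrightarrow> 0 \<le> slab_energy \<kappa> N w V"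
  unfolding slab_energy_def by (intro sum_nonneg mult_nonneg_nonneg) auto

text \<open>Averaging over \<open>V\<close> turns scale \<open>j\<close> into \<kappa>^j times a
  kernel sum of order \<theta>^j. As \<kappa> \<theta> < 1 the scales form a convergent geometric
  series, and the bound is uniform in \<open>N\<close>.\<close>

lemma slab_energy_integral_le:
  fixes \<gamma> :: "(real ^ 'n) set measure" and w :: "real ^ 'n \<Rightarrow> real"
  assumes \<gamma>: "grassmann_measure m \<gamma>"
    and C: "0 \<le> C" "\<And>x \<rho>. 0 < \<rho> \<Longrightarrow>
      emeasure \<gamma> {V \<in> space \<gamma>. norm (orth_proj V x) \<le> \<rho>} \<le> ennreal (C * kernel_phi m \<rho> x)"
    and w: "finite {p. w p \<noteq> 0}" "\<And>p. 0 \<le> w p" "(\<Sum>p | w p \<noteq> 0. w p) = a"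
    and bd: "\<And>i y. i \<le> N \<Longrightarrow> (\<Sum>p\<in>{p. w p \<noteq> 0} \<inter> dcell i y. w p) \<le> \<theta> ^ i"
    and \<theta>: "(1 / 2) ^ m < \<theta>" and \<kappa>: "0 < \<kappa>" "\<kappa> * \<theta> < 1"
  shows "slab_energy \<kappa> N w \<in> borel_measurable \<gamma>"
    and "(\<integral>\<^sup>+V. ennreal (slab_energy \<kappa> N w V) \<partial>\<gamma>)
      \<le> ennreal (C * a * (a + 2 ^ m * 3 ^ CARD('n) / (1 - (1 / 2) ^ m / \<theta>)) / (1 - \<kappa> * \<theta>))"
proof -
  interpret prob_space \<gamma> using \<gamma> by (simp add: grassmann_measure_def)
  let ?S = "{p. w p \<noteq> 0}"
  define M where "M = a + 2 ^ m * 3 ^ CARD('n) / (1 - (1 / 2) ^ m / \<theta>)"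
  have \<theta>0: "0 < \<theta>" using \<theta> by (rule less_trans[rotated]) simp
  have a0: "0 \<le> a" using w by (auto intro: sum_nonneg)
  have M0: "0 \<le> M" unfolding M_def using a0 \<theta> \<theta>0 by (intro add_nonneg_nonneg divide_nonneg_nonneg) auto
  have [measurable]: "(\<lambda>V. orth_proj V x) \<in> borel_measurable \<gamma>" for x by (rule measurable_orth_proj[OF \<gamma>])
  define A where "A p q j = {V \<in> space \<gamma>. norm (orth_proj V (p - q)) \<le> (1 / 2) ^ j}" for p q j
  have A: "A p q j \<in> sets \<gamma>" for p q j unfolding A_def by measurable
  have eq: "slab_energy \<kappa> N w V = (\<Sum>p\<in>?S. \<Sum>q\<in>?S. \<Sum>j\<le>N. w p * w q * \<kappa> ^ j * indicator (A p q j) V)"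
    if "V \<in> space \<gamma>" for V
    unfolding slab_energy_def sum_distrib_left using that by (intro sum.cong refl) (simp add: A_def indicator_def)
  have "(\<lambda>V. \<Sum>p\<in>?S. \<Sum>q\<in>?S. \<Sum>j\<le>N. w p * w q * \<kappa> ^ j * indicator (A p q j) V) \<in> borel_measurable \<gamma>"
    using A by measurable
  then show "slab_energy \<kappa> N w \<in> borel_measurable \<gamma>" by (subst measurable_cong[OF eq])
  have ind: "(\<lambda>V. ennreal (w p * w q * \<kappa> ^ j) * indicator (A p q j) V) \<in> borel_measurable \<gamma>" for p q j
    using A by measurable
  have nn: "0 \<le> w p * w q * \<kappa> ^ j" for p q j using w(2) \<kappa> by simp
  have meas: "measure \<gamma> (A p q j) \<le> C * kernel_phi m ((1 / 2) ^ j) (p - q)" for p q j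
    using C(2)[of "(1 / 2) ^ j" "p - q"] C(1) unfolding A_def by (simp add: emeasure_eq_measure ennreal_le_iff)
  have "(\<integral>\<^sup>+V. ennreal (slab_energy \<kappa> N w V) \<partial>\<gamma>)
      = (\<integral>\<^sup>+V. (\<Sum>p\<in>?S. \<Sum>q\<in>?S. \<Sum>j\<le>N. ennreal (w p * w q * \<kappa> ^ j) * indicator (A p q j) V) \<partial>\<gamma>)"
  proof (rule nn_integral_cong)
    fix V assume "V \<in> space \<gamma>"
    then have "ennreal (slab_energy \<kappa> N w V)
        = (\<Sum>p\<in>?S. \<Sum>q\<in>?S. \<Sum>j\<le>N. ennreal (w p * w q * \<kappa> ^ j * indicator (A p q j) V))"
      using nn by (simp add: eq sum_ennreal sum_nonneg)
    then show "ennreal (slab_energy \<kappa> N w V)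
        = (\<Sum>p\<in>?S. \<Sum>q\<in>?S. \<Sum>j\<le>N. ennreal (w p * w q * \<kappa> ^ j) * indicator (A p q j) V)"
      using nn by (simp add: ennreal_mult ennreal_indicator)
  qed
  also have "\<dots> = (\<Sum>p\<in>?S. \<integral>\<^sup>+V. (\<Sum>q\<in>?S. \<Sum>j\<le>N. ennreal (w p * w q * \<kappa> ^ j) * indicator (A p q j) V) \<partial>\<gamma>)"
    by (intro nn_integral_sum borel_measurable_sum ind)
  also have "\<dots> = (\<Sum>p\<in>?S. \<Sum>q\<in>?S. \<integral>\<^sup>+V. (\<Sum>j\<le>N. ennreal (w p * w q * \<kappa> ^ j) * indicator (A p q j) V) \<partial>\<gamma>)"
    by (intro sum.cong refl nn_integral_sum borel_measurable_sum ind)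
  also have "\<dots> = (\<Sum>p\<in>?S. \<Sum>q\<in>?S. \<Sum>j\<le>N. \<integral>\<^sup>+V. ennreal (w p * w q * \<kappa> ^ j) * indicator (A p q j) V \<partial>\<gamma>)"
    by (intro sum.cong refl nn_integral_sum ind)
  also have "\<dots> = (\<Sum>p\<in>?S. \<Sum>q\<in>?S. \<Sum>j\<le>N. ennreal (w p * w q * \<kappa> ^ j) * emeasure \<gamma> (A p q j))"
    by (intro sum.cong refl nn_integral_cmult_indicator A)
  also have "\<dots> = ennreal (\<Sum>p\<in>?S. \<Sum>q\<in>?S. \<Sum>j\<le>N. w p * w q * \<kappa> ^ j * measure \<gamma> (A p q j))"
    using nn by (simp add: emeasure_eq_measure ennreal_mult[symmetric] sum_ennreal sum_nonneg)
  also have "\<dots> \<le> ennreal (C * a * M / (1 - \<kappa> * \<theta>))"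
  proof (rule ennreal_leI)
    have "(\<Sum>p\<in>?S. \<Sum>q\<in>?S. \<Sum>j\<le>N. w p * w q * \<kappa> ^ j * measure \<gamma> (A p q j))
        \<le> (\<Sum>p\<in>?S. \<Sum>q\<in>?S. \<Sum>j\<le>N. w p * w q * \<kappa> ^ j * (C * kernel_phi m ((1 / 2) ^ j) (p - q)))"
      by (intro sum_mono mult_left_mono meas nn)
    also have "\<dots> = (\<Sum>p\<in>?S. \<Sum>j\<le>N. \<Sum>q\<in>?S. w p * w q * \<kappa> ^ j * (C * kernel_phi m ((1 / 2) ^ j) (p - q)))"
      by (intro sum.cong refl sum.swap)
    also have "\<dots> = C * (\<Sum>p\<in>?S. w p * (\<Sum>j\<le>N. \<kappa> ^ j * (\<Sum>q\<in>?S. w q * kernel_phi m ((1 / 2) ^ j) (p - q))))"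
      by (simp add: sum_distrib_left mult_ac)
    also have "\<dots> \<le> C * (\<Sum>p\<in>?S. w p * (\<Sum>j\<le>N. \<kappa> ^ j * (M * \<theta> ^ j)))"
    proof (intro mult_left_mono sum_mono)
      fix p j assume "j \<in> {..N}"
      then show "(\<Sum>q\<in>?S. w q * kernel_phi m ((1 / 2) ^ j) (p - q)) \<le> M * \<theta> ^ j"
        using sum_weights_kernel_le[OF w(1,2) bd \<theta>, of N j p] w(3) by (simp add: M_def)
    qed (use w(2) \<kappa> C(1) in auto)
    also have "\<dots> = C * a * M * (\<Sum>j\<le>N. (\<kappa> * \<theta>) ^ j)"
    proof -
      have "(\<Sum>j\<le>N. \<kappa> ^ j * (M * \<theta> ^ j)) = M * (\<Sum>j\<le>N. (\<kappa> * \<theta>) ^ j)"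
        by (simp add: sum_distrib_left power_mult_distrib mult_ac)
      then show ?thesis by (simp add: sum_distrib_right[symmetric] w(3))
    qed
    also have "\<dots> \<le> C * a * M * (1 / (1 - \<kappa> * \<theta>))"
    proof (intro mult_left_mono)
      have "(\<Sum>j\<le>N. (\<kappa> * \<theta>) ^ j) \<le> (\<Sum>j. (\<kappa> * \<theta>) ^ j)"
        using \<kappa> \<theta>0 by (intro sum_le_suminf summable_geometric) auto
      also have "\<dots> = 1 / (1 - \<kappa> * \<theta>)" using \<kappa> \<theta>0 by (intro suminf_geometric) auto
      finally show "(\<Sum>j\<le>N. (\<kappa> * \<theta>) ^ j) \<le> 1 / (1 - \<kappa> * \<theta>)" .
    qed (use a0 M0 C(1) in auto)
    finally show "(\<Sum>p\<in>?S. \<Sum>q\<in>?S. \<Sum>j\<le>N. w p * w q * \<kappa> ^ j * measure \<gamma> (A p q j))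
        \<le> C * a * M / (1 - \<kappa> * \<theta>)" by simp
  qed
  finally show "(\<integral>\<^sup>+V. ennreal (slab_energy \<kappa> N w V) \<partial>\<gamma>)
      \<le> ennreal (C * a * (a + 2 ^ m * 3 ^ CARD('n) / (1 - (1 / 2) ^ m / \<theta>)) / (1 - \<kappa> * \<theta>))"
    unfolding M_def .
qed

text \<open>The energy form of the mass distribution principle, by the Cauchy--Schwarz inequality.\<close>
lemma slab_energy_cover_ge:
  fixes w :: "'a::euclidean_space \<Rightarrow> real"
  assumes V: "subspace V" and w: "finite {p. w p \<noteq> 0}" "\<And>p. 0 \<le> w p" "(\<Sum>p | w p \<noteq> 0. w p) = a"
    and \<kappa>: "0 < \<kappa>" and I: "finite I" "\<And>i. i \<in> I \<Longrightarrow> l i \<le> N"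
    and cov: "\<And>p. w p \<noteq> 0 \<Longrightarrow> \<exists>i\<in>I. orth_proj V p \<in> ball (c i) ((1 / 2) ^ Suc (l i))"
  shows "a\<^sup>2 \<le> slab_energy \<kappa> N w V * (\<Sum>i\<in>I. (1 / \<kappa>) ^ l i)"
proof -
  let ?S = "{p. w p \<noteq> 0}"
  have "\<forall>p\<in>?S. \<exists>i. i \<in> I \<and> orth_proj V p \<in> ball (c i) ((1 / 2) ^ Suc (l i))" using cov by blast
  from bchoice[OF this] obtain \<iota> where \<iota>: "\<forall>p\<in>?S. \<iota> p \<in> I \<and> orth_proj V p \<in> ball (c (\<iota> p)) ((1 / 2) ^ Suc (l (\<iota> p)))" ..
  let ?Si = "\<lambda>i. {p \<in> ?S. \<iota> p = i}"
  define b where "b i = (\<Sum>p\<in>?Si i. w p)" for i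
  have group: "(\<Sum>i\<in>I. \<Sum>p\<in>?Si i. h p) = (\<Sum>p\<in>?S. h p)" for h :: "'a \<Rightarrow> real"
    using \<iota> by (intro sum.group w I) auto
  have "a = (\<Sum>i\<in>I. b i)" unfolding b_def group w(3) ..
  \<comment> \<open>The factors \<kappa>^(l / 2) and \<kappa>^(-l / 2) are inserted so that
    Cauchy--Schwarz produces the energy on one side and the cost of the cover on the other.\<close>
  also have "\<dots> = (\<Sum>i\<in>I. (b i * sqrt (\<kappa> ^ l i)) * sqrt ((1 / \<kappa>) ^ l i))"
    using \<kappa> by (intro sum.cong refl) (simp add: real_sqrt_mult[symmetric] power_mult_distrib[symmetric])
  finally have "a\<^sup>2 \<le> (\<Sum>i\<in>I. (b i * sqrt (\<kappa> ^ l i))\<^sup>2) * (\<Sum>i\<in>I. (sqrt ((1 / \<kappa>) ^ l i))\<^sup>2)"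
    using Cauchy_Schwarz_ineq_sum[of "\<lambda>i. b i * sqrt (\<kappa> ^ l i)" "\<lambda>i. sqrt ((1 / \<kappa>) ^ l i)" I] by simp
  also have "\<dots> = (\<Sum>i\<in>I. (b i)\<^sup>2 * \<kappa> ^ l i) * (\<Sum>i\<in>I. (1 / \<kappa>) ^ l i)"
    using \<kappa> by (simp add: power_mult_distrib)
  also have "\<dots> \<le> slab_energy \<kappa> N w V * (\<Sum>i\<in>I. (1 / \<kappa>) ^ l i)"
  proof (rule mult_right_mono)
    let ?G = "\<lambda>p q. w p * w q * (\<Sum>j\<le>N. \<kappa> ^ j * of_bool (norm (orth_proj V (p - q)) \<le> (1 / 2) ^ j))"
    have G0: "0 \<le> ?G p q" for p q using w(2) \<kappa> by (intro mult_nonneg_nonneg sum_nonneg) auto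
    have "(\<Sum>i\<in>I. (b i)\<^sup>2 * \<kappa> ^ l i) \<le> (\<Sum>i\<in>I. \<Sum>p\<in>?Si i. \<Sum>q\<in>?S. ?G p q)"
    proof (rule sum_mono)
      fix i assume i: "i \<in> I"
      have "(b i)\<^sup>2 * \<kappa> ^ l i = (\<Sum>p\<in>?Si i. \<Sum>q\<in>?Si i. w p * w q * \<kappa> ^ l i)"
        unfolding b_def power2_eq_square sum_product by (simp only: sum_distrib_right)
      also have "\<dots> \<le> (\<Sum>p\<in>?Si i. \<Sum>q\<in>?Si i. ?G p q)"
      proof (intro sum_mono mult_left_mono)
        fix p q assume pq: "p \<in> ?Si i" "q \<in> ?Si i"
        have "orth_proj V p \<in> ball (c i) ((1 / 2) ^ Suc (l i))" "orth_proj V q \<in> ball (c i) ((1 / 2) ^ Suc (l i))"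
          using pq \<iota> by auto
        then have "dist (orth_proj V p) (orth_proj V q) \<le> (1 / 2) ^ Suc (l i) + (1 / 2) ^ Suc (l i)"
          using dist_triangle3[of "orth_proj V p" "orth_proj V q" "c i"] by simp
        then have "norm (orth_proj V (p - q)) \<le> (1 / 2) ^ l i" by (simp add: dist_orth_proj[OF V])
        then have "\<kappa> ^ l i = \<kappa> ^ l i * of_bool (norm (orth_proj V (p - q)) \<le> (1 / 2) ^ l i)" by simp
        also have "\<dots> \<le> (\<Sum>j\<le>N. \<kappa> ^ j * of_bool (norm (orth_proj V (p - q)) \<le> (1 / 2) ^ j))"
          using I(2)[OF i] \<kappa> by (intro member_le_sum) auto
        finally show "\<kappa> ^ l i \<le> (\<Sum>j\<le>N. \<kappa> ^ j * of_bool (norm (orth_proj V (p - q)) \<le> (1 / 2) ^ j))" .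
        show "0 \<le> w p * w q" using w(2) by simp
      qed
      also have "\<dots> \<le> (\<Sum>p\<in>?Si i. \<Sum>q\<in>?S. ?G p q)"
        using w(1) G0 by (intro sum_mono sum_mono2) auto
      finally show "(b i)\<^sup>2 * \<kappa> ^ l i \<le> (\<Sum>p\<in>?Si i. \<Sum>q\<in>?S. ?G p q)" .
    qed
    also have "\<dots> = slab_energy \<kappa> N w V" unfolding group slab_energy_def ..
    finally show "(\<Sum>i\<in>I. (b i)\<^sup>2 * \<kappa> ^ l i) \<le> slab_energy \<kappa> N w V" .
  qed (use \<kappa> in \<open>auto intro: sum_nonneg\<close>)
  finally show ?thesis .
qed

section \<open>Compactness of box sections\<close>

lemma tendsto_fun_iff:
  fixes f :: "'b \<Rightarrow> nat \<Rightarrow> real"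
  shows "(f \<longlongrightarrow> l) F \<longleftrightarrow> (\<forall>i. ((\<lambda>x. f x i) \<longlongrightarrow> l i) F)"
  using limitin_componentwise[of "\<lambda>_ :: nat. euclidean :: real topology" UNIV f l F]
  by (simp add: euclidean_product_topology)

lemma compact_fun_box: "compact {\<sigma> :: nat \<Rightarrow> real. \<forall>i. \<bar>\<sigma> i\<bar> \<le> b i}"
proof -
  have "compactin (product_topology (\<lambda>_ :: nat. euclidean :: real topology) UNIV) (PiE UNIV (\<lambda>i. {- b i..b i}))"
    unfolding compactin_PiE by simp
  moreover have "PiE UNIV (\<lambda>i. {- b i..b i}) = {\<sigma> :: nat \<Rightarrow> real. \<forall>i. \<bar>\<sigma> i\<bar> \<le> b i}"
    by (auto simp: PiE_UNIV_domain abs_le_iff minus_le_iff) 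
  ultimately show ?thesis by (simp add: euclidean_product_topology)
qed

text \<open>
  The sets on the left decrease to a compact subset of the projection of \<open>D\<close>, so that an open
  cover of that projection covers one of them by finitely many members.
\<close>
lemma box_section_finite_cover:
  fixes D :: "('a::euclidean_space \<times> (nat \<Rightarrow> real)) set"
  assumes D: "closed D" "bounded (fst ` D)" and b: "\<And>i. 0 \<le> b i"
    and W: "\<And>i :: nat. open (W i)" "fst ` D \<subseteq> (\<Union>i. W i)"
  obtains N where "fst ` (D \<inter> {z. \<forall>i<N. \<bar>snd z i\<bar> \<le> b i}) \<subseteq> (\<Union>i<N. W i)"
proof (rule ccontr)
  assume "\<not> thesis"
  then have "\<exists>z. z \<in> D \<and> (\<forall>i<N. \<bar>snd z i\<bar> \<le> b i) \<and> fst z \<notin> (\<Union>i<N. W i)" for N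
    using that[of N] by blast
  then obtain z where z: "\<And>N. z N \<in> D" "\<And>N i. i < N \<Longrightarrow> \<bar>snd (z N) i\<bar> \<le> b i"
    "\<And>N. fst (z N) \<notin> (\<Union>i<N. W i)" by metis
  \<comment> \<open>Only the first \<open>N\<close> coordinates of \<open>snd (z N)\<close> are
    bounded; the others are set to 0, which stays in the box as \<open>b\<close> is nonnegative.
    Each coordinate is altered for finitely many \<open>N\<close> only, so limits agree.\<close>
  define \<tau> where "\<tau> N i = (if i < N then snd (z N) i else 0)" for N i
  let ?K = "closure (fst ` D) \<times> {\<sigma> :: nat \<Rightarrow> real. \<forall>i. \<bar>\<sigma> i\<bar> \<le> b i}"
  have cK: "compact ?K" using D(2) compact_fun_box by (intro compact_Times) (simp_all add: compact_closure)
  have mem: "\<forall>N. (fst (z N), \<tau> N) \<in> ?K"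
    using z(1,2) b closure_subset[of "fst ` D"] by (auto simp: \<tau>_def)
  obtain l r where lr: "l \<in> ?K" "strict_mono r" "((\<lambda>N. (fst (z N), \<tau> N)) \<circ> r) \<longlonglongrightarrow> l"
    by (rule seq_compactE[OF compact_imp_seq_compact[OF cK] mem])
  have f: "(\<lambda>N. fst (z (r N))) \<longlonglongrightarrow> fst l" using tendsto_fst[OF lr(3)] by (simp add: o_def)
  have s: "(\<lambda>N. \<tau> (r N)) \<longlonglongrightarrow> snd l" using tendsto_snd[OF lr(3)] by (simp add: o_def)
  have "(\<lambda>N. snd (z (r N))) \<longlonglongrightarrow> snd l"
    unfolding tendsto_fun_iff
  proof
    fix i
    have "(\<lambda>N. \<tau> (r N) i) \<longlonglongrightarrow> snd l i" using s unfolding tendsto_fun_iff by blast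
    moreover have "\<forall>\<^sub>F N in sequentially. \<tau> (r N) i = snd (z (r N)) i"
      using eventually_gt_at_top[of i]
    proof eventually_elim
      case (elim N)
      then have "i < r N" using seq_suble[OF lr(2), of N] by linarith
      then show ?case by (simp add: \<tau>_def)
    qed
    ultimately show "(\<lambda>N. snd (z (r N)) i) \<longlonglongrightarrow> snd l i" by (rule Lim_transform_eventually)
  qed
  from tendsto_Pair[OF f this] have "(\<lambda>N. z (r N)) \<longlonglongrightarrow> l" by simp
  then have "l \<in> D" using closed_sequentially[OF D(1), of "\<lambda>N. z (r N)" l] z(1) by simp
  then obtain i where i: "fst l \<in> W i" using W(2) by blast
  have "\<forall>\<^sub>F N in sequentially. fst (z (r N)) \<in> W i" using f W(1) i by (rule topological_tendstoD)
  moreover have "\<forall>\<^sub>F N in sequentially. i < N" by (rule eventually_gt_at_top)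
  ultimately have "\<forall>\<^sub>F N in sequentially. False"
  proof eventually_elim
    case (elim N)
    then have "i < r N" using seq_suble[OF lr(2), of N] by linarith
    then show ?case using elim z(3)[of "r N"] by blast
  qed
  then show False by simp
qed

text \<open>Choquet's capacitability argument: bounding coordinate \<open>N\<close> by larger and
  larger \<open>j\<close> exhausts the set, so by continuity along increasing sequences some
  \<open>j\<close> keeps the content above \<open>t\<close>. The coordinates are bounded one after
  the other.\<close>

lemma dcontent_box_sections:
  fixes D :: "('a::euclidean_space \<times> (nat \<Rightarrow> real)) set"
  assumes \<theta>: "0 < \<theta>" "\<theta> < 1" and D: "fst ` D \<subseteq> dcell 0 x0" and t: "0 \<le> t" "ennreal t < dcontent \<theta> (fst ` D)"
  obtains b :: "nat \<Rightarrow> real" where "\<And>i. 0 \<le> b i"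
    "\<And>N. ennreal t < dcontent \<theta> (fst ` (D \<inter> {z. \<forall>i<N. \<bar>snd z i\<bar> \<le> b i}))"
proof -
  let ?X = "\<lambda>N b. fst ` (D \<inter> {z. \<forall>i<N. \<bar>snd z i\<bar> \<le> (b i :: real)})"
  let ?P = "\<lambda>N b. (\<forall>i. 0 \<le> b i) \<and> ennreal t < dcontent \<theta> (?X N b)"
  \<comment> \<open>A later choice leaves the earlier coordinates alone, so the diagonal sequence
    \<open>b\<close> agrees with \<open>f N\<close> below \<open>N\<close>.\<close>
  have "\<exists>f. \<forall>N. ?P N (f N) \<and> (\<forall>i<N. f (Suc N) i = f N i)"
  proof (rule dependent_nat_choice)
    show "\<exists>b. ?P 0 b" using t by (intro exI[of _ "\<lambda>_. 0"]) simp
    fix b :: "nat \<Rightarrow> real" and N assume b: "?P N b"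
    let ?Y = "\<lambda>j :: nat. ?X (Suc N) (b(N := real j))"
    have eqY: "?Y j = fst ` (D \<inter> {z. (\<forall>i<N. \<bar>snd z i\<bar> \<le> b i) \<and> \<bar>snd z N\<bar> \<le> real j})" for j
      by (intro arg_cong[of _ _ "(`) fst"]) (auto simp: less_Suc_eq)
    have "incseq ?Y" unfolding eqY by (intro incseq_SucI) fastforce
    moreover have "(\<Union>j. ?Y j) \<subseteq> dcell 0 x0" using D by blast
    moreover have "?X N b \<subseteq> (\<Union>j. ?Y j)"
    proof
      fix x assume "x \<in> ?X N b"
      then obtain z where z: "z \<in> D" "\<forall>i<N. \<bar>snd z i\<bar> \<le> b i" "x = fst z" by blast
      obtain j :: nat where "\<bar>snd z N\<bar> \<le> real j" using real_arch_simple by blast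
      then show "x \<in> (\<Union>j. ?Y j)" unfolding eqY using z by blast
    qed
    then have "ennreal t < dcontent \<theta> (\<Union>j. ?Y j)" using b dcontent_mono by (meson less_le_trans)
    ultimately obtain j where "ennreal t < dcontent \<theta> (?Y j)"
      using dcontent_incseq_UN_less[OF \<theta>, of ?Y x0 t] t(1) by blast
    then show "\<exists>b'. ?P (Suc N) b' \<and> (\<forall>i<N. b' i = b i)"
      using b by (intro exI[of _ "b(N := real j)"]) simp
  qed
  then obtain f where f: "\<And>N. ?P N (f N)" "\<And>N i. i < N \<Longrightarrow> f (Suc N) i = f N i" by blast
  define b where "b i = f (Suc i) i" for i
  have fb: "i < N \<Longrightarrow> f N i = b i" for i N
  proof (induction N)
    case (Suc N)
    then show ?case using f(2)[of i N] by (cases "i = N") (auto simp: b_def)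
  qed simp
  show thesis
  proof (rule that[of b])
    show "0 \<le> b i" for i using f(1) by (simp add: b_def)
    show "ennreal t < dcontent \<theta> (?X N b)" for N
    proof -
      have "?X N b = ?X N (f N)" using fb by (intro arg_cong[of _ _ "(`) fst"]) auto
      then show ?thesis using f(1)[of N] by simp
    qed
  qed
qed

text \<open>The strict bound lets an open ball of radius 2^-(l + 1) contain any set of diameter at
  most \<open>d\<close> that contains its centre; the other bound limits the loss to a factor
  4.\<close>

lemma dyadic_between:
  assumes "0 < d" "d < 1 / 2"
  obtains l :: nat where "d < (1 / 2) ^ Suc l" "(1 / 2) ^ l \<le> 4 * (d :: real)"
proof -
  have ex: "\<exists>n. (1 / 2) ^ n \<le> d" using real_arch_pow_inv[of d "1 / 2"] assms by (auto intro: less_imp_le)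
  define n where "n = (LEAST n. (1 / 2) ^ n \<le> d)"
  have n: "(1 / 2) ^ n \<le> d" unfolding n_def using ex by (rule LeastI_ex)
  have "2 \<le> n"
  proof (rule ccontr)
    assume "\<not> 2 \<le> n"
    then have "n = 0 \<or> n = 1" by linarith
    then show False using n assms by auto
  qed
  then obtain l where l: "n = Suc (Suc l)" by (metis Suc_le_D numeral_2_eq_2 Suc_le_mono)
  show thesis
  proof (rule that[of l])
    have "\<not> (1 / 2) ^ Suc l \<le> d" using not_less_Least[of "Suc l" "\<lambda>n. (1 / 2) ^ n \<le> d"] l unfolding n_def by simp
    then show "d < (1 / 2) ^ Suc l" by simp
    show "(1 / 2) ^ l \<le> 4 * d" using n l by simp
  qed
qed

text \<open>Covering sets are replaced by open balls of dyadic radius, open for the compactness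
  argument and dyadic for comparison with slab energies.\<close>

lemma hausdorff_null_ball_cover:
  fixes X :: "'a::euclidean_space set"
  assumes null: "hausdorff_measure t X = 0" and t: "0 < t" and \<eta>: "0 < \<eta>"
  shows "\<exists>c l. X \<subseteq> (\<Union>i :: nat. ball (c i) ((1 / 2) ^ Suc (l i)))
    \<and> (\<forall>I. finite I \<longrightarrow> (\<Sum>i\<in>I. ((1 / 2) powr t) ^ l i) \<le> \<eta>)"
proof -
  \<comment> \<open>The dyadic radius obeys 2^-l \<le> 4 (diameter + \<epsilon>), at most 8 times
    the larger of the two.\<close>
  define K where "K = 8 powr t"
  have K: "0 < K" by (simp add: K_def)
  \<comment> \<open>One half of \<eta> / K is for the diameters, the other for the enlargements
    \<open>\<epsilon> i\<close>.\<close>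
  define \<eta>' where "\<eta>' = \<eta> / (2 * K)"
  have \<eta>': "0 < \<eta>'" using \<eta> K by (simp add: \<eta>'_def)
  have "hausdorff_content (1 / 8) t X = 0" using null by (simp add: hausdorff_measure_eq_0_iff)
  then have "cover_content {U. bounded U \<and> diameter U \<le> 1 / 8} (\<lambda>U. U) (diam_pow t) X < ennreal \<eta>'"
    using \<eta>' by (simp add: hausdorff_content_eq)
  then obtain U where U: "\<And>i. bounded (U i)" "\<And>i. diameter (U i) \<le> 1 / 8" "X \<subseteq> (\<Union>i. U i)"
    "(\<Sum>i. diam_pow t (U i)) < ennreal \<eta>'" by (rule cover_content_lessE) auto
  \<comment> \<open>Gives sets of diameter 0 a positive radius. The \<open>t\<close>-th powers sum
    to at most \<open>\<eta>'\<close>, and 1 / 8 + 1 / 8 stays below the 1 / 2 demanded by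
    \<open>dyadic_between\<close>.\<close>
  define \<epsilon> where "\<epsilon> i = min (1 / 8) ((\<eta>' * (1 / 2) ^ Suc i) powr (1 / t))" for i
  have \<epsilon>: "0 < \<epsilon> i" "\<epsilon> i \<le> 1 / 8" "\<epsilon> i powr t \<le> \<eta>' * (1 / 2) ^ Suc i" for i
  proof -
    show "0 < \<epsilon> i" "\<epsilon> i \<le> 1 / 8" using \<eta>' by (auto simp: \<epsilon>_def)
    have "\<epsilon> i powr t \<le> ((\<eta>' * (1 / 2) ^ Suc i) powr (1 / t)) powr t"
      using t \<open>0 < \<epsilon> i\<close> by (intro powr_mono2) (auto simp: \<epsilon>_def)
    also have "\<dots> = \<eta>' * (1 / 2) ^ Suc i" using t \<eta>' by (simp add: powr_powr)
    finally show "\<epsilon> i powr t \<le> \<eta>' * (1 / 2) ^ Suc i" .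
  qed
  have d0: "0 \<le> diameter (U i)" for i using U(1) by (rule diameter_ge_0)
  have "\<exists>l. diameter (U i) + \<epsilon> i < (1 / 2) ^ Suc l \<and> (1 / 2) ^ l \<le> 4 * (diameter (U i) + \<epsilon> i)" for i
  proof -
    have "0 < diameter (U i) + \<epsilon> i" "diameter (U i) + \<epsilon> i < 1 / 2"
      using d0[of i] U(2)[of i] \<epsilon>(1,2)[of i] by linarith+
    then obtain l where "diameter (U i) + \<epsilon> i < (1 / 2) ^ Suc l" "(1 / 2) ^ l \<le> 4 * (diameter (U i) + \<epsilon> i)"
      by (rule dyadic_between)
    then show ?thesis by blast
  qed
  then obtain l where l: "\<And>i. diameter (U i) + \<epsilon> i < (1 / 2) ^ Suc (l i)" "\<And>i. (1 / 2) ^ l i \<le> 4 * (diameter (U i) + \<epsilon> i)"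
    by metis
  define c where "c i = (SOME x. x \<in> U i)" for i
  have ball: "U i \<subseteq> ball (c i) ((1 / 2) ^ Suc (l i))" for i
  proof
    fix x assume x: "x \<in> U i"
    then have "c i \<in> U i" unfolding c_def by (rule someI)
    then have "dist (c i) x \<le> diameter (U i)" using x U(1) by (intro diameter_bounded_bound)
    also have "\<dots> < (1 / 2) ^ Suc (l i)" using l(1)[of i] \<epsilon>(1)[of i] by linarith
    finally show "x \<in> ball (c i) ((1 / 2) ^ Suc (l i))" by simp
  qed
  have bnd: "((1 / 2) powr t) ^ l i \<le> K * (diameter (U i) powr t + \<eta>' * (1 / 2) ^ Suc i)" for i
  proof -
    let ?M = "max (diameter (U i)) (\<epsilon> i)"
    have "((1 / 2) powr t) ^ l i = ((1 / 2) ^ l i) powr t"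
      by (simp add: powr_realpow[symmetric] powr_powr mult.commute)
    also have "\<dots> \<le> (8 * ?M) powr t"
      using l(2)[of i] t by (intro powr_mono2) auto
    also have "\<dots> = K * ?M powr t" using d0[of i] by (simp add: K_def powr_mult)
    also have "?M powr t \<le> diameter (U i) powr t + \<epsilon> i powr t" by (simp add: max_def)
    also have "\<dots> \<le> diameter (U i) powr t + \<eta>' * (1 / 2) ^ Suc i" using \<epsilon>(3) by simp
    finally show ?thesis using K by simp
  qed
  show ?thesis
  proof (intro exI[of _ c] exI[of _ l] conjI allI impI)
    show "X \<subseteq> (\<Union>i. ball (c i) ((1 / 2) ^ Suc (l i)))" using U(3) ball by blast
    fix I :: "nat set" assume I: "finite I"
    have "(\<Sum>i\<in>I. diameter (U i) powr t) \<le> \<eta>'"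
    proof -
      have "ennreal (\<Sum>i\<in>I. diameter (U i) powr t) = (\<Sum>i\<in>I. diam_pow t (U i))"
        using t by (simp add: diam_pow_def sum_ennreal[symmetric] del: sum_ennreal) (intro sum.cong; simp add: diameter_def)
      also have "\<dots> \<le> (\<Sum>i. diam_pow t (U i))" using I by (intro sum_le_suminf) auto
      also have "\<dots> \<le> ennreal \<eta>'" using U(4) by (rule less_imp_le)
      finally show ?thesis using \<eta>' by (simp add: ennreal_le_iff)
    qed
    moreover have "(\<Sum>i\<in>I. \<eta>' * (1 / 2) ^ Suc i) \<le> \<eta>'"
    proof -
      have s: "(\<lambda>i. \<eta>' * (1 / 2) ^ Suc i) sums (\<eta>' * 1)" by (intro sums_mult power_half_series)
      have "(\<Sum>i\<in>I. \<eta>' * (1 / 2) ^ Suc i) \<le> (\<Sum>i. \<eta>' * (1 / 2) ^ Suc i)"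
        using I \<eta>' sums_summable[OF s] by (intro sum_le_suminf) auto
      then show ?thesis using sums_unique[OF s] by simp
    qed
    ultimately have "(\<Sum>i\<in>I. K * (diameter (U i) powr t + \<eta>' * (1 / 2) ^ Suc i)) \<le> K * (2 * \<eta>')"
      using K by (simp add: sum_distrib_left[symmetric] sum.distrib)
    moreover have "(\<Sum>i\<in>I. ((1 / 2) powr t) ^ l i) \<le> (\<Sum>i\<in>I. K * (diameter (U i) powr t + \<eta>' * (1 / 2) ^ Suc i))"
      by (rule sum_mono) (rule bnd)
    moreover have "K * (2 * \<eta>') = \<eta>" using K by (simp add: \<eta>'_def)
    ultimately show "(\<Sum>i\<in>I. ((1 / 2) powr t) ^ l i) \<le> \<eta>" by linarith
  qed
qed

text \<open>Small cost forces a fine mesh: a cover of cost below \<theta>^k contains only cells of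
  level above \<open>k\<close>, so the covers that show the content to be 0 are admissible for any
  \<delta>.\<close>

lemma hausdorff_null_of_dcontent_null:
  fixes A :: "'a::euclidean_space set"
  assumes s: "0 < s" and null: "dcontent ((1 / 2) powr s) A = 0"
  shows "hausdorff_measure s A = 0"
  unfolding hausdorff_measure_eq_0_iff
proof (intro allI impI)
  fix \<delta> :: real assume d: "0 < \<delta>"
  let ?\<theta> = "(1 / 2) powr s"
  define D where "D = 2 * real DIM('a)"
  have D: "0 < D" by (simp add: D_def)
  have \<theta>: "0 < ?\<theta>" "?\<theta> < 1" using s powr_less_mono2[of s "1 / 2" 1] by auto
  have diam: "diameter (dcell k x) \<le> D * (1 / 2) ^ k" "bounded (dcell k x)" for k and x :: 'a
  proof -
    have "norm (y - z) \<le> D * (1 / 2) ^ k" if "y \<in> dcell k x" "z \<in> dcell k x" for y z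
      using dist_dcell[OF that(1)] dist_dcell[OF that(2)] dist_triangle3[of y z x]
      by (simp add: D_def dist_norm)
    then show "diameter (dcell k x) \<le> D * (1 / 2) ^ k" using D by (intro diameter_le) auto
    show "bounded (dcell k x)" unfolding bounded_def using dist_dcell by blast
  qed
  obtain k where k: "D * (1 / 2) ^ k \<le> \<delta>"
  proof -
    obtain k where "(1 / 2) ^ k < \<delta> / D" using real_arch_pow_inv[of "\<delta> / D" "1 / 2"] d D by auto
    then show thesis using that[of k] D by (simp add: field_simps)
  qed
  have "hausdorff_content \<delta> s A \<le> ennreal (D powr s * \<eta>)" if \<eta>: "0 < \<eta>" "\<eta> \<le> ?\<theta> ^ k" for \<eta>
  proof -
    have "dcontent ?\<theta> A < ennreal \<eta>" using null \<eta> by simp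
    then obtain f where f: "A \<subseteq> (\<Union>i. dset (f i))" "(\<Sum>i. dcost ?\<theta> (f i)) < ennreal \<eta>" by (rule dcontent_lessE)
    have level: "k \<le> j" if fi: "f i = Some (j, y)" for i j y
    proof (rule ccontr)
      assume "\<not> k \<le> j"
      then have "?\<theta> ^ k \<le> ?\<theta> ^ j" using \<theta> by (intro power_decreasing) auto
      then have "ennreal \<eta> \<le> dcost ?\<theta> (f i)" using fi \<eta> by (simp add: ennreal_leI)
      also have "\<dots> \<le> (\<Sum>i. dcost ?\<theta> (f i))" using sum_le_suminf[of "\<lambda>i. dcost ?\<theta> (f i)" "{i}"] by simp
      finally show False using f(2) by simp
    qed
    have cell: "bounded (dset (f i)) \<and> diameter (dset (f i)) \<le> \<delta> \<and> diam_pow s (dset (f i)) \<le> ennreal (D powr s) * dcost ?\<theta> (f i)" for i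
    proof (cases "f i")
      case None
      then show ?thesis using d by (simp add: diam_pow_def)
    next
      case (Some u)
      then obtain j y where u: "f i = Some (j, y)" by (cases u) auto
      have "diameter (dcell j y) \<le> D * (1 / 2) ^ j" by (rule diam)
      also have "\<dots> \<le> D * (1 / 2) ^ k" using level[OF u] D by (intro mult_left_mono power_decreasing) auto
      finally have 1: "diameter (dcell j y) \<le> \<delta>" using k by simp
      have "diameter (dcell j y) powr s \<le> (D * (1 / 2) ^ j) powr s"
        using diam s by (intro powr_mono2 diameter_ge_0) auto
      also have "\<dots> = D powr s * ?\<theta> ^ j"
        using D by (simp add: powr_mult powr_realpow[symmetric] powr_powr mult.commute)
      finally have "ennreal (diameter (dcell j y) powr s) \<le> ennreal (D powr s * ?\<theta> ^ j)" by (rule ennreal_leI)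
      then show ?thesis using u 1 diam(2) s by (simp add: diam_pow_def ennreal_mult)
    qed
    have "hausdorff_content \<delta> s A \<le> (\<Sum>i. diam_pow s (dset (f i)))"
      unfolding hausdorff_content_eq by (rule cover_content_le) (use cell f in auto)
    also have "\<dots> \<le> (\<Sum>i. ennreal (D powr s) * dcost ?\<theta> (f i))"
      by (intro suminf_le allI) (use cell in auto)
    also have "\<dots> = ennreal (D powr s) * (\<Sum>i. dcost ?\<theta> (f i))" by simp
    also have "\<dots> \<le> ennreal (D powr s) * ennreal \<eta>" using f(2) by (intro mult_left_mono) auto
    finally show ?thesis using \<eta> by (simp add: ennreal_mult)
  qed note bound = this
  have "hausdorff_content \<delta> s A \<le> 0 + ennreal e" if e: "0 < e" for e
  proof -
    define \<eta> where "\<eta> = min (?\<theta> ^ k) (e / D powr s)"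
    have "0 < \<eta>" "\<eta> \<le> ?\<theta> ^ k" using \<theta> e D by (auto simp: \<eta>_def)
    then have "hausdorff_content \<delta> s A \<le> ennreal (D powr s * \<eta>)" by (rule bound)
    also have "D powr s * \<eta> \<le> D powr s * (e / D powr s)" by (intro mult_left_mono) (auto simp: \<eta>_def)
    also have "\<dots> = e" using D by simp
    finally show ?thesis by (simp add: ennreal_leI)
  qed
  then have "hausdorff_content \<delta> s A \<le> 0" by (rule ennreal_le_epsilon)
  then show "hausdorff_content \<delta> s A = 0" by simp
qed

lemma dcell_borel: "dcell k x \<in> sets borel"
proof -
  have "dcell k x = (\<Inter>b\<in>Basis. {y. of_int \<lfloor>2 ^ k * (x \<bullet> b)\<rfloor> \<le> 2 ^ k * (y \<bullet> b)} \<inter> {y. 2 ^ k * (y \<bullet> b) < of_int \<lfloor>2 ^ k * (x \<bullet> b)\<rfloor> + 1})"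
    by (auto simp: dcell_def floor_eq_iff)
  also have "\<dots> \<in> sets borel"
    by (intro sets.finite_INT sets.Int borel_closed borel_open closed_Collect_le open_Collect_less continuous_intros) auto
  finally show ?thesis .
qed

text \<open>Countably many unit cells cover the space and null sets are stable under countable
  unions; this cuts a bounded part out of \<open>E\<close>.\<close>

lemma hausdorff_positive_cell:
  fixes E :: "'a::euclidean_space set"
  assumes s: "0 < s" and E: "hausdorff_measure s E \<noteq> 0"
  obtains x where "dcontent ((1 / 2) powr s) (E \<inter> dcell 0 x) \<noteq> 0"
proof (rule ccontr)
  assume "\<not> thesis"
  then have null: "dcontent ((1 / 2) powr s) (E \<inter> dcell 0 x) = 0" for x using that by blast
  let ?Q = "from_nat_into (range (dcell 0 :: 'a \<Rightarrow> 'a set))"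
  have "hausdorff_measure s (E \<inter> ?Q i) = 0" for i
  proof -
    have "?Q i \<in> range (dcell 0 :: 'a \<Rightarrow> 'a set)" by (rule from_nat_into) simp
    then obtain x where "?Q i = dcell 0 x" by blast
    then show ?thesis using null[of x] by (simp add: hausdorff_null_of_dcontent_null[OF s])
  qed
  then have "hausdorff_measure s (\<Union>i. E \<inter> ?Q i) = 0" by (rule hausdorff_measure_UN_eq_0)
  moreover have "E \<subseteq> (\<Union>i. E \<inter> ?Q i)"
  proof
    fix x assume x: "x \<in> E"
    obtain i where "?Q i = dcell 0 x" using from_nat_into_surj[OF countable_dcell, of "dcell 0 x" 0] by auto
    then show "x \<in> (\<Union>i. E \<inter> ?Q i)" using x dcell_self[of x 0] by blast
  qed
  ultimately have "hausdorff_measure s E = 0" using hausdorff_measure_mono by (metis le_zero_eq)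
  then show False using E by simp
qed

text \<open>The weights have exponent \<open>s\<close>, with \<theta> = 2^-s, and \<open>s\<close>
  is below \<open>m\<close> so that the kernel sums converge; the energy has exponent
  \<open>t\<close>, with \<kappa> = 2^t, and \<open>t\<close> is below \<open>s\<close> so that
  \<kappa> \<theta> < 1.\<close>

lemma hausdorff_measure_proj_nonzero_AE:
  fixes \<gamma> :: "(real ^ 'n) set measure" and E :: "(real ^ 'n) set"
  assumes \<gamma>: "grassmann_measure m \<gamma>" and n: "2 \<le> CARD('n)" and E: "E \<in> sets borel"
    and st: "0 < t" "t < s" "s < real m" and pos: "hausdorff_measure s E \<noteq> 0"
  shows "AE V in \<gamma>. hausdorff_measure t (orth_proj V ` E) \<noteq> 0"
proof -
  define \<theta> where "\<theta> = (1 / 2 :: real) powr s"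
  have \<theta>: "0 < \<theta>" "\<theta> < 1" using st powr_less_mono2[of s "1 / 2" 1] by (auto simp: \<theta>_def)
  have \<theta>m: "(1 / 2) ^ m < \<theta>"
    using st powr_less_mono'[of "1 / 2" s "real m"] by (simp add: \<theta>_def powr_realpow[symmetric])
  define \<kappa> where "\<kappa> = (2 :: real) powr t"
  have \<kappa>0: "0 < \<kappa>" by (simp add: \<kappa>_def)
  have \<kappa>inv: "1 / \<kappa> = (1 / 2) powr t" by (simp add: \<kappa>_def powr_divide)
  have \<kappa>\<theta>: "\<kappa> * \<theta> < 1"
  proof -
    have "\<kappa> * \<theta> = 2 powr (t - s)" by (simp add: \<kappa>_def \<theta>_def powr_divide powr_diff)
    then show ?thesis using st powr_less_cancel_iff[of 2 "t - s" 0] by simp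
  qed
  obtain x0 where "dcontent \<theta> (E \<inter> dcell 0 x0) \<noteq> 0"
    using hausdorff_positive_cell[OF _ pos] st unfolding \<theta>_def by auto
  then obtain y where y: "0 < y" "y < dcontent \<theta> (E \<inter> dcell 0 x0)"
    using dense by (metis zero_less_iff_neq_zero)
  obtain a where a: "0 < a" "ennreal a < dcontent \<theta> (E \<inter> dcell 0 x0)"
  proof (cases y)
    case (real r)
    then show thesis using that[of r] y by auto
  next
    case top
    then show thesis using y(2) by simp
  qed
  have "E \<inter> dcell 0 x0 \<in> sets borel" using E dcell_borel by (rule sets.Int)
  then obtain D :: "((real ^ 'n) \<times> (nat \<Rightarrow> real)) set" where D: "closed D" "E \<inter> dcell 0 x0 = fst ` D"
    using analytic_borel unfolding analytic_def by blast
  have Dsub: "fst ` D \<subseteq> dcell 0 x0" using D(2) by blast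
  have "bounded (dcell 0 x0)" unfolding bounded_def using dist_dcell by blast
  then have Dbd: "bounded (fst ` D)" using Dsub by (rule bounded_subset)
  have "0 \<le> a" "ennreal a < dcontent \<theta> (fst ` D)" using a D(2) by simp_all
  then obtain b where b: "\<And>i. 0 \<le> b i"
    "\<And>N. ennreal a < dcontent \<theta> (fst ` (D \<inter> {z. \<forall>i<N. \<bar>snd z i\<bar> \<le> b i}))"
    by (rule dcontent_box_sections[OF \<theta> Dsub]) (rule that)
  define A where "A N = fst ` (D \<inter> {z. \<forall>i<N. \<bar>snd z i\<bar> \<le> b i})" for N
  have Aanti: "A N' \<subseteq> A N" if "N \<le> N'" for N N' using that by (force simp: A_def)
  have "\<exists>w :: real ^ 'n \<Rightarrow> real. finite {p. w p \<noteq> 0} \<and> (\<forall>p. 0 \<le> w p) \<and> {p. w p \<noteq> 0} \<subseteq> A N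
      \<and> (\<Sum>p | w p \<noteq> 0. w p) = a
      \<and> (\<forall>j y. j \<le> N \<longrightarrow> (\<Sum>p\<in>{p. w p \<noteq> 0} \<inter> dcell j y. w p) \<le> \<theta> ^ j)" for N
  proof -
    have "A N \<inter> dcell 0 x0 = A N" using Dsub by (auto simp: A_def)
    then have "ennreal a \<le> dcontent \<theta> (A N \<inter> dcell 0 x0)" using b(2)[of N] by (simp add: A_def less_imp_le)
    from dcontent_weights[OF \<theta> _ this, of N] a show ?thesis by auto
  qed
  then obtain w where w: "\<And>N. finite {p. w N p \<noteq> 0}" "\<And>N p. 0 \<le> w N (p :: real ^ 'n)" "\<And>N. {p. w N p \<noteq> 0} \<subseteq> A N"
      "\<And>N. (\<Sum>p | w N p \<noteq> 0. w N p) = a"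
      "\<And>N j y. j \<le> N \<Longrightarrow> (\<Sum>p\<in>{p. w N p \<noteq> 0} \<inter> dcell j y. w N p) \<le> \<theta> ^ j"
    by metis
  obtain C where C: "1 \<le> C" "\<And>x \<rho>. 0 < \<rho> \<Longrightarrow>
      emeasure \<gamma> {V \<in> space \<gamma>. norm (orth_proj V x) \<le> \<rho>} \<le> ennreal (C * kernel_phi m \<rho> x)"
    using grassmann_slab[OF \<gamma> n] by blast
  let ?\<Lambda> = "C * a * (a + 2 ^ m * 3 ^ CARD('n) / (1 - (1 / 2) ^ m / \<theta>)) / (1 - \<kappa> * \<theta>)"
  have C0: "0 \<le> C" using C(1) by simp
  note energy = slab_energy_integral_le[OF \<gamma> C0 C(2) w(1,2,4) w(5) \<theta>m \<kappa>0 \<kappa>\<theta>]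
  let ?F = "\<lambda>N V. ennreal (slab_energy \<kappa> N (w N) V)"
  have Fm: "?F N \<in> borel_measurable \<gamma>" for N using energy(1)[of N N] by measurable
  \<comment> \<open>Fatou's lemma acts on the energies while the weights may vary freely with
    \<open>N\<close>: for almost all \<open>V\<close>, infinitely many levels have energies below a
    common bound.\<close>
  have "(\<integral>\<^sup>+V. liminf (\<lambda>N. ?F N V) \<partial>\<gamma>) \<le> liminf (\<lambda>N. \<integral>\<^sup>+V. ?F N V \<partial>\<gamma>)"
    by (rule nn_integral_liminf) (rule Fm)
  also have "\<dots> \<le> liminf (\<lambda>N. ennreal ?\<Lambda>)"
    by (intro Liminf_mono always_eventually allI energy(2)) simp
  also have "\<dots> < \<infinity>" by (simp add: Liminf_const)
  finally have "AE V in \<gamma>. liminf (\<lambda>N. ?F N V) \<noteq> \<infinity>"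
    by (intro nn_integral_PInf_AE borel_measurable_liminf Fm) simp
  moreover have "AE V in \<gamma>. V \<in> space \<gamma>" by simp
  ultimately show ?thesis
  proof eventually_elim
    case (elim V)
    then have V: "subspace V" by (simp add: space_grassmann_measure[OF \<gamma>] grassmannian_def)
    show ?case
    proof
      assume "hausdorff_measure t (orth_proj V ` E) = 0"
      moreover have "fst ` D \<subseteq> E" using D(2) by blast
      then have "hausdorff_measure t (orth_proj V ` fst ` D) \<le> hausdorff_measure t (orth_proj V ` E)"
        by (intro hausdorff_measure_mono image_mono)
      ultimately have null: "hausdorff_measure t (orth_proj V ` fst ` D) = 0" by simp
      obtain B where B: "0 < B" "liminf (\<lambda>N. ?F N V) < ennreal B"
      proof -
        obtain B' where "liminf (\<lambda>N. ?F N V) = ennreal B'" "0 \<le> B'"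
          using elim(1) by (cases "liminf (\<lambda>N. ?F N V)") auto
        then show thesis using that[of "B' + 1"] by (simp add: ennreal_less_iff)
      qed
      \<comment> \<open>Makes \<open>B * \<eta>\<close> half of a^2, against the lower bound a^2 of
        the energy inequality.\<close>
      define \<eta> where "\<eta> = a\<^sup>2 / (2 * B)"
      have \<eta>: "0 < \<eta>" using a B by (simp add: \<eta>_def)
      from hausdorff_null_ball_cover[OF null st(1) \<eta>]
      obtain c l where cl: "orth_proj V ` fst ` D \<subseteq> (\<Union>i :: nat. ball (c i) ((1 / 2) ^ Suc (l i)))"
        "\<forall>I. finite I \<longrightarrow> (\<Sum>i\<in>I. ((1 / 2) powr t) ^ l i) \<le> \<eta>"
        by (elim exE conjE)
      let ?W = "\<lambda>i. orth_proj V -` ball (c i) ((1 / 2) ^ Suc (l i))"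
      have "open (?W i)" for i by (intro open_vimage continuous_orth_proj V) simp
      moreover have "fst ` D \<subseteq> (\<Union>i. ?W i)" using cl(1) by blast
      ultimately have "\<exists>N. A N \<subseteq> (\<Union>i<N. ?W i)"
        unfolding A_def by (rule box_section_finite_cover[OF D(1) Dbd b(1)]) (rule exI)
      then obtain N where N: "A N \<subseteq> (\<Union>i<N. ?W i)" ..
      \<comment> \<open>Beyond \<open>N\<close> the support of \<open>w k\<close> lies in
        \<open>A N\<close>, and beyond every \<open>l i\<close> all levels of the finite cover occur
        in the energy; the sum of the \<open>l i\<close> bounds each of them.\<close>
      have "\<exists>k. N + (\<Sum>i<N. l i) < k \<and> ?F k V < ennreal B"
      proof (rule ccontr)
        assume "\<not> (\<exists>k. N + (\<Sum>i<N. l i) < k \<and> ?F k V < ennreal B)"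
        then have "ennreal B \<le> ?F k V" if "N + (\<Sum>i<N. l i) < k" for k using that by (meson not_le)
        then have "\<forall>\<^sub>F k in sequentially. ennreal B \<le> ?F k V"
          by (rule eventually_mono[OF eventually_gt_at_top])
        then have "ennreal B \<le> liminf (\<lambda>N. ?F N V)" by (rule Liminf_bounded)
        then show False using B(2) by simp
      qed
      then obtain k where k: "N + (\<Sum>i<N. l i) < k" "?F k V < ennreal B" by blast
      have "a\<^sup>2 \<le> slab_energy \<kappa> k (w k) V * (\<Sum>i<N. (1 / \<kappa>) ^ l i)"
      proof (rule slab_energy_cover_ge[OF V w(1,2,4) \<kappa>0])
        fix i assume "i \<in> {..<N}"
        then have "l i \<le> (\<Sum>i<N. l i)" by (intro member_le_sum) auto
        then show "l i \<le> k" using k(1) by linarith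
      next
        fix p assume "w k p \<noteq> 0"
        then have "p \<in> A N" using w(3)[of k] Aanti[of N k] k(1) by auto
        then show "\<exists>i\<in>{..<N}. orth_proj V p \<in> ball (c i) ((1 / 2) ^ Suc (l i))" using N by blast
      qed simp
      also have "\<dots> \<le> B * \<eta>"
      proof (rule mult_mono)
        show "slab_energy \<kappa> k (w k) V \<le> B" using k(2) B by (simp add: ennreal_less_iff slab_energy_nonneg less_imp_le \<kappa>0 w(2))
        show "(\<Sum>i<N. (1 / \<kappa>) ^ l i) \<le> \<eta>" unfolding \<kappa>inv using cl(2) by simp
      qed (use B \<kappa>0 in \<open>auto intro: sum_nonneg\<close>)
      also have "\<dots> = a\<^sup>2 / 2" using B by (simp add: \<eta>_def)
      finally show False using a by simp
    qed
  qed
qed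

text \<open>The strict inequality leaves room for the intermediate exponent \<open>s\<close>; for t
  \<le> 0 nonnegativity of the dimension is enough.\<close>

lemma hausdorff_dim_proj_ge_AE:
  fixes \<gamma> :: "(real ^ 'n) set measure" and E :: "(real ^ 'n) set"
  assumes \<gamma>: "grassmann_measure m \<gamma>" and n: "2 \<le> CARD('n)" and E: "E \<in> sets borel"
  shows "AE V in \<gamma>. hausdorff_profile m E \<le> hausdorff_dim (orth_proj V ` E)"
proof (rule AE_ereal_le)
  fix t assume t: "ereal t < hausdorff_profile m E"
  show "AE V in \<gamma>. ereal t \<le> hausdorff_dim (orth_proj V ` E)"
  proof (cases "0 < t")
    case True
    obtain s where s: "ereal t < ereal s" "ereal s < hausdorff_profile m E"
      using ereal_dense2[OF t] by blast
    then have ts: "t < s" "s < real m" "ereal s < hausdorff_dim E" by (auto simp: hausdorff_profile_def)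
    have "hausdorff_measure s E \<noteq> 0" using hausdorff_measure_0_less_dim[OF ts(3)] True ts(1) by simp
    from hausdorff_measure_proj_nonzero_AE[OF \<gamma> n E True ts(1,2) this]
    show ?thesis by eventually_elim (rule hausdorff_dim_geI)
  next
    case False
    then have "ereal t \<le> 0" by simp
    then show ?thesis using hausdorff_dim_nonneg order_trans by (intro AE_I2) blast
  qed
qed

theorem theorem1p1:
  fixes E :: "(real ^ 'n) set" and m :: nat
  assumes "1 \<le> m" and "m \<le> CARD('n) - 1"
    and "E \<noteq> {}" and "E \<in> sets borel"
  shows
    "(\<forall>V \<in> grassmannian m.
        (hausdorff_dim (orth_proj V ` E) \<le> hausdorff_profile m E \<and>
         hausdorff_profile m E = min (ereal m) (hausdorff_dim E)) \<and>
        (bounded E \<longrightarrow> lower_box_dim (orth_proj V ` E) \<le> lower_box_profile m E) \<and>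
        (bounded E \<longrightarrow> upper_box_dim (orth_proj V ` E) \<le> upper_box_profile m E) \<and>
        packing_dim (orth_proj V ` E) \<le> packing_profile m E) \<and>
     (\<forall>\<gamma>. grassmann_measure m \<gamma> \<longrightarrow>
        (AE V in \<gamma>. hausdorff_dim (orth_proj V ` E) = hausdorff_profile m E) \<and>
        (bounded E \<longrightarrow> (AE V in \<gamma>. lower_box_dim (orth_proj V ` E) = lower_box_profile m E)) \<and>
        (bounded E \<longrightarrow> (AE V in \<gamma>. upper_box_dim (orth_proj V ` E) = upper_box_profile m E)) \<and>
        (AE V in \<gamma>. packing_dim (orth_proj V ` E) = packing_profile m E))"
proof (intro conjI ballI allI impI)
  have n: "2 \<le> CARD('n)" using assms(1,2) by linarith
  {
    fix V :: "(real ^ 'n) set" assume V: "V \<in> grassmannian m"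
    show "hausdorff_dim (orth_proj V ` E) \<le> hausdorff_profile m E"
      using V by (rule hausdorff_dim_proj_le)
    show "hausdorff_profile m E = min (ereal m) (hausdorff_dim E)"
      by (rule hausdorff_profile_def)
    show "packing_dim (orth_proj V ` E) \<le> packing_profile m E"
      using V by (rule packing_dim_proj_le)
    assume "bounded E"
    then show "lower_box_dim (orth_proj V ` E) \<le> lower_box_profile m E"
      and "upper_box_dim (orth_proj V ` E) \<le> upper_box_profile m E"
      using box_dims_proj_le[OF V _ assms(3)] by auto
  next
    fix \<gamma> :: "(real ^ 'n) set measure" assume \<gamma>: "grassmann_measure m \<gamma>"
    have ae: "AE V in \<gamma>. V \<in> grassmannian m"
      using AE_space[of \<gamma>] by (simp add: space_grassmann_measure[OF \<gamma>])
    show "AE V in \<gamma>. hausdorff_dim (orth_proj V ` E) = hausdorff_profile m E"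
      using ae hausdorff_dim_proj_ge_AE[OF \<gamma> n assms(4)]
      by eventually_elim (intro antisym hausdorff_dim_proj_le)
    show "AE V in \<gamma>. packing_dim (orth_proj V ` E) = packing_profile m E"
      using ae packing_dim_proj_ge_AE[OF \<gamma> n assms(3,4)]
      by eventually_elim (intro antisym packing_dim_proj_le)
    assume E: "bounded E"
    note ge = box_dims_proj_ge_AE[OF \<gamma> n E assms(3)]
    show "AE V in \<gamma>. lower_box_dim (orth_proj V ` E) = lower_box_profile m E"
      using ae ge by eventually_elim (simp add: antisym box_dims_proj_le(1)[OF _ E assms(3)])
    show "AE V in \<gamma>. upper_box_dim (orth_proj V ` E) = upper_box_profile m E"
      using ae ge by eventually_elim (simp add: antisym box_dims_proj_le(2)[OF _ E assms(3)])
  }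
qed

end
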